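(* Let $n\in\{2,3,\dots\}\cup\{\infty\}$. Then the noncommutative analytic Toeplitz algebra $\mathfrak{L}_n$, regarded as a Banach space with the operator norm, has a unique predual (up to isometric isomorphism).
   Context: Let $\mathbb{F}_n^+$ be the free semigroup (with unit the empty word $\varnothing$) of all words in an alphabet of $n$ letters (countably infinitely many letters if $n=\infty$). Let $\ell^2(\mathbb{F}_n^+)$ be the Hilbert space with orthonormal basis $\{\xi_w: w\in\mathbb{F}_n^+\}$. For $v\in\mathbb{F}_n^+$ let $L_v$ be the isometry determined by $L_v\xi_w=\xi_{vw}$. The algebra $\mathfrak{L}_n$ is the unital algebra of operators on $\ell^2(\mathbb{F}_n^+)$, closed in the weak operator topology, generated by $L_i$ for $i$ ranging over the letters. A predual of a Banach space $X$ is a Banach space $E$ such that $E^*$ is isometrically isomorphic to $X$. $X$ has a unique predual if it has a predual and any two preduals of $X$ are isometrically isomorphic. *)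

theory Defs
  imports "HOL-Analysis.Analysis" "HOL-Library.Function_Algebras" "HOL-Library.Sublist"
begin

section \<open>The complex Hilbert space of square-summable families\<close>

typedef 'w ell2 = "{f :: 'w \<Rightarrow> complex. (\<lambda>w. (cmod (f w))\<^sup>2) summable_on UNIV}"
  morphisms ell2_coeff Abs_ell2
  by (rule exI[of _ "\<lambda>_. 0"]) simp

setup_lifting type_definition_ell2

lemma ell2_summable: "(\<lambda>w. (cmod (ell2_coeff x w))\<^sup>2) summable_on UNIV"
  using ell2_coeff[of x] by simp

lemma ell2_mult_summable:
  fixes f g :: "'w \<Rightarrow> complex"
  assumes "(\<lambda>w. (cmod (f w))\<^sup>2) summable_on UNIV" "(\<lambda>w. (cmod (g w))\<^sup>2) summable_on UNIV"
  shows "(\<lambda>w. f w * cnj (g w)) summable_on UNIV"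
proof -
  have "(\<lambda>w. norm ((cmod (f w))\<^sup>2 + (cmod (g w))\<^sup>2)) summable_on UNIV"
    using summable_on_add[OF assms] by simp
  then have "(\<lambda>w. norm (f w * cnj (g w))) summable_on UNIV"
  proof (rule Infinite_Sum.abs_summable_on_comparison_test)
    fix w
    have "2 * (cmod (f w) * cmod (g w)) \<le> (cmod (f w))\<^sup>2 + (cmod (g w))\<^sup>2"
      using sum_squares_bound[of "cmod (f w)" "cmod (g w)"] by simp
    moreover have "0 \<le> cmod (f w) * cmod (g w)" by simp
    ultimately have "cmod (f w) * cmod (g w) \<le> (cmod (f w))\<^sup>2 + (cmod (g w))\<^sup>2" by linarith
    then show "norm (f w * cnj (g w)) \<le> norm ((cmod (f w))\<^sup>2 + (cmod (g w))\<^sup>2)"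
      by (simp add: norm_mult)
  qed
  then show ?thesis by (rule Infinite_Sum.abs_summable_summable)
qed

lemma ell2_add_summable:
  fixes f g :: "'w \<Rightarrow> complex"
  assumes "(\<lambda>w. (cmod (f w))\<^sup>2) summable_on UNIV" "(\<lambda>w. (cmod (g w))\<^sup>2) summable_on UNIV"
  shows "(\<lambda>w. (cmod (f w + g w))\<^sup>2) summable_on UNIV"
proof -
  have "(\<lambda>w. norm (2 * (cmod (f w))\<^sup>2 + 2 * (cmod (g w))\<^sup>2)) summable_on UNIV"
    using summable_on_add[OF summable_on_cmult_right[OF assms(1), of 2]
        summable_on_cmult_right[OF assms(2), of 2]] by simp
  then have "(\<lambda>w. norm ((cmod (f w + g w))\<^sup>2)) summable_on UNIV"
  proof (rule Infinite_Sum.abs_summable_on_comparison_test)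
    fix w
    have "(cmod (f w + g w))\<^sup>2 \<le> (cmod (f w) + cmod (g w))\<^sup>2"
      by (intro power_mono norm_triangle_ineq) simp
    also have "\<dots> \<le> 2 * (cmod (f w))\<^sup>2 + 2 * (cmod (g w))\<^sup>2"
      using sum_squares_bound[of "cmod (f w)" "cmod (g w)"] by (simp add: power2_sum)
    finally show "norm ((cmod (f w + g w))\<^sup>2) \<le> norm (2 * (cmod (f w))\<^sup>2 + 2 * (cmod (g w))\<^sup>2)"
      by simp
  qed
  then show ?thesis by (rule Infinite_Sum.abs_summable_summable)
qed

lemma ell2_scale_summable:
  fixes f :: "'w \<Rightarrow> complex"
  assumes "(\<lambda>w. (cmod (f w))\<^sup>2) summable_on UNIV"
  shows "(\<lambda>w. (cmod (c * f w))\<^sup>2) summable_on UNIV"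
  using summable_on_cmult_right[OF assms, of "(cmod c)\<^sup>2"] by (simp add: norm_mult power_mult_distrib)

lift_definition ell2_scale :: "complex \<Rightarrow> 'w ell2 \<Rightarrow> 'w ell2" is "\<lambda>c f w. c * f w"
  by (rule ell2_scale_summable)

definition ell2_cinner :: "'w ell2 \<Rightarrow> 'w ell2 \<Rightarrow> complex" where
  "ell2_cinner x y = (\<Sum>\<^sub>\<infinity>w. ell2_coeff x w * cnj (ell2_coeff y w))"

instantiation ell2 :: (type) ab_group_add
begin

lift_definition zero_ell2 :: "'a ell2" is "\<lambda>_. 0" by simp
lift_definition plus_ell2 :: "'a ell2 \<Rightarrow> 'a ell2 \<Rightarrow> 'a ell2" is "\<lambda>f g w. f w + g w"
  by (rule ell2_add_summable)
lift_definition uminus_ell2 :: "'a ell2 \<Rightarrow> 'a ell2" is "\<lambda>f w. - f w" by simp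
lift_definition minus_ell2 :: "'a ell2 \<Rightarrow> 'a ell2 \<Rightarrow> 'a ell2" is "\<lambda>f g w. f w - g w"
proof -
  fix f g :: "'a \<Rightarrow> complex"
  assume "(\<lambda>w. (cmod (f w))\<^sup>2) summable_on UNIV" "(\<lambda>w. (cmod (g w))\<^sup>2) summable_on UNIV"
  then show "(\<lambda>w. (cmod (f w - g w))\<^sup>2) summable_on UNIV"
    using ell2_add_summable[of f "\<lambda>w. - g w"] by simp
qed

instance by (standard; transfer; simp add: algebra_simps)

end

instantiation ell2 :: (type) real_inner
begin

definition scaleR_ell2 :: "real \<Rightarrow> 'a ell2 \<Rightarrow> 'a ell2" where
  "scaleR_ell2 r x = ell2_scale (complex_of_real r) x"

definition inner_ell2 :: "'a ell2 \<Rightarrow> 'a ell2 \<Rightarrow> real" where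
  "inner_ell2 x y = Re (ell2_cinner x y)"

definition norm_ell2 :: "'a ell2 \<Rightarrow> real" where "norm_ell2 x = sqrt (inner x x)"
definition sgn_ell2 :: "'a ell2 \<Rightarrow> 'a ell2" where "sgn_ell2 x = inverse (norm x) *\<^sub>R x"
definition dist_ell2 :: "'a ell2 \<Rightarrow> 'a ell2 \<Rightarrow> real" where "dist_ell2 x y = norm (x - y)"
definition uniformity_ell2 :: "('a ell2 \<times> 'a ell2) filter" where
  "uniformity_ell2 = (INF e\<in>{0 <..}. principal {(x, y). dist x y < e})"
definition open_ell2 :: "'a ell2 set \<Rightarrow> bool" where
  "open_ell2 U = (\<forall>x\<in>U. eventually (\<lambda>(x', y). x' = x \<longrightarrow> y \<in> U) uniformity)"

instance
proof
  fix x y z :: "'a ell2" and a b r :: real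
  show "a *\<^sub>R (x + y) = a *\<^sub>R x + a *\<^sub>R y"
    unfolding scaleR_ell2_def by (transfer; simp add: algebra_simps)
  show "(a + b) *\<^sub>R x = a *\<^sub>R x + b *\<^sub>R x"
    unfolding scaleR_ell2_def by (transfer; simp add: algebra_simps)
  show "a *\<^sub>R b *\<^sub>R x = (a * b) *\<^sub>R x"
    unfolding scaleR_ell2_def by (transfer; simp add: algebra_simps)
  show "1 *\<^sub>R x = x"
    unfolding scaleR_ell2_def by (transfer; simp)
  have sm: "(\<lambda>w. ell2_coeff u w * cnj (ell2_coeff v w)) summable_on UNIV" for u v :: "'a ell2"
    by (intro ell2_mult_summable ell2_summable)
  have inn: "inner u v = (\<Sum>\<^sub>\<infinity>w. Re (ell2_coeff u w * cnj (ell2_coeff v w)))" for u v :: "'a ell2"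
    unfolding inner_ell2_def ell2_cinner_def by (rule infsum_Re[OF sm, symmetric])
  have smR: "(\<lambda>w. Re (ell2_coeff u w * cnj (ell2_coeff v w))) summable_on UNIV" for u v :: "'a ell2"
    by (rule summable_on_Re[OF sm])
  show "inner x y = inner y x"
    unfolding inn by (intro infsum_cong) (simp add: algebra_simps)
  show "inner (x + y) z = inner x z + inner y z"
    unfolding inn plus_ell2.rep_eq
    by (subst infsum_add[OF smR smR, symmetric]) (simp add: algebra_simps)
  show "inner (r *\<^sub>R x) y = r * inner x y"
    unfolding inn scaleR_ell2_def ell2_scale.rep_eq
    by (subst infsum_cmult_right'[symmetric]) (simp add: algebra_simps)
  have sq: "inner x x = (\<Sum>\<^sub>\<infinity>w. (cmod (ell2_coeff x w))\<^sup>2)"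
    unfolding inn by (intro infsum_cong) (simp only: complex_mult_cnj cmod_power2 Re_complex_of_real)
  show "0 \<le> inner x x" unfolding sq by (rule infsum_nonneg) simp
  show "(inner x x = 0) = (x = 0)"
  proof
    assume "inner x x = 0"
    then have "(cmod (ell2_coeff x w))\<^sup>2 = 0" for w
      using nonneg_infsum_le_0D[OF _ ell2_summable[of x], of w] unfolding sq by simp
    then have "ell2_coeff x = ell2_coeff 0" by (simp add: zero_ell2.rep_eq fun_eq_iff)
    then show "x = 0" by (simp add: ell2_coeff_inject)
  next
    assume "x = 0"
    then show "inner x x = 0" unfolding sq by (simp add: zero_ell2.rep_eq)
  qed
qed (simp_all add: norm_ell2_def sgn_ell2_def dist_ell2_def uniformity_ell2_def open_ell2_def)

end

lemma norm_ell2_sq: "(norm x)\<^sup>2 = (\<Sum>\<^sub>\<infinity>w. (cmod (ell2_coeff x w))\<^sup>2)"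
proof -
  have "(norm x)\<^sup>2 = inner x x" by (simp add: power2_norm_eq_inner)
  also have "\<dots> = (\<Sum>\<^sub>\<infinity>w. Re (ell2_coeff x w * cnj (ell2_coeff x w)))"
    unfolding inner_ell2_def ell2_cinner_def
    by (rule infsum_Re[symmetric]) (intro ell2_mult_summable ell2_summable)
  also have "\<dots> = (\<Sum>\<^sub>\<infinity>w. (cmod (ell2_coeff x w))\<^sup>2)"
    by (intro infsum_cong) (simp only: complex_mult_cnj cmod_power2 Re_complex_of_real)
  finally show ?thesis .
qed

lemma sum_coeff_le_norm_ell2:
  assumes "finite F"
  shows "(\<Sum>w\<in>F. (cmod (ell2_coeff x w))\<^sup>2) \<le> (norm x)\<^sup>2"
  unfolding norm_ell2_sq by (rule finite_sum_le_infsum[OF ell2_summable assms]) auto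

lemma norm_ell2_scale: "norm (ell2_scale c x) = cmod c * norm x"
proof -
  have "(norm (ell2_scale c x))\<^sup>2 = (cmod c * norm x)\<^sup>2"
    by (simp add: norm_ell2_sq ell2_scale.rep_eq norm_mult power_mult_distrib infsum_cmult_right')
  then show ?thesis by (simp add: power2_eq_iff_nonneg)
qed

lemma bounded_linear_ell2_scale: "bounded_linear (ell2_scale c)"
proof (rule bounded_linear_intro[where K = "cmod c"])
  show "ell2_scale c (x + y) = ell2_scale c x + ell2_scale c y" for x y
    by (transfer; simp add: algebra_simps)
  show "ell2_scale c (r *\<^sub>R x) = r *\<^sub>R ell2_scale c x" for r x
    unfolding scaleR_ell2_def by (transfer; simp add: algebra_simps)
  show "norm (ell2_scale c x) \<le> norm x * cmod c" for x by (simp add: norm_ell2_scale)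
qed

instance ell2 :: (type) banach
proof
  fix X :: "nat \<Rightarrow> 'a ell2"
  assume C: "Cauchy X"
  have coeff: "cmod (ell2_coeff x w) \<le> norm x" for x :: "'a ell2" and w
    using sum_coeff_le_norm_ell2[of "{w}" x] by (simp add: power2_le_iff_abs_le)
  have "Cauchy (\<lambda>k. ell2_coeff (X k) w)" for w
  proof (rule metric_CauchyI)
    fix e :: real assume "0 < e"
    then obtain N where N: "\<And>m k. m \<ge> N \<Longrightarrow> k \<ge> N \<Longrightarrow> dist (X m) (X k) < e"
      using C \<open>0 < e\<close> unfolding Cauchy_def by meson
    have "dist (ell2_coeff (X m) w) (ell2_coeff (X k) w) < e" if "m \<ge> N" "k \<ge> N" for m k
      using coeff[of "X m - X k" w] N[OF that] by (simp add: dist_norm minus_ell2.rep_eq)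
    then show "\<exists>M. \<forall>m\<ge>M. \<forall>k\<ge>M. dist (ell2_coeff (X m) w) (ell2_coeff (X k) w) < e" by blast
  qed
  then have "\<forall>w. \<exists>l. (\<lambda>k. ell2_coeff (X k) w) \<longlonglongrightarrow> l"
    by (simp add: Cauchy_convergent_iff convergent_def)
  then obtain f where f: "\<And>w. (\<lambda>k. ell2_coeff (X k) w) \<longlonglongrightarrow> f w" by metis
  have fin: "\<exists>N. \<forall>k\<ge>N. \<forall>F. finite F \<longrightarrow> (\<Sum>w\<in>F. (cmod (ell2_coeff (X k) w - f w))\<^sup>2) \<le> e\<^sup>2"
    if "0 < e" for e :: real
  proof -
    obtain N where N: "\<And>m k. m \<ge> N \<Longrightarrow> k \<ge> N \<Longrightarrow> dist (X m) (X k) < e"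
      using C \<open>0 < e\<close> unfolding Cauchy_def by meson
    have "(\<Sum>w\<in>F. (cmod (ell2_coeff (X k) w - f w))\<^sup>2) \<le> e\<^sup>2" if k: "k \<ge> N" and F: "finite F" for k F
    proof (rule tendsto_upperbound)
      show "(\<lambda>m. \<Sum>w\<in>F. (cmod (ell2_coeff (X k) w - ell2_coeff (X m) w))\<^sup>2)
          \<longlonglongrightarrow> (\<Sum>w\<in>F. (cmod (ell2_coeff (X k) w - f w))\<^sup>2)"
        by (intro tendsto_intros f)
      show "\<forall>\<^sub>F m in sequentially. (\<Sum>w\<in>F. (cmod (ell2_coeff (X k) w - ell2_coeff (X m) w))\<^sup>2) \<le> e\<^sup>2"
      proof (rule eventually_sequentiallyI)
        fix m assume "N \<le> m"
        have "(\<Sum>w\<in>F. (cmod (ell2_coeff (X k) w - ell2_coeff (X m) w))\<^sup>2) \<le> (norm (X k - X m))\<^sup>2"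
          using sum_coeff_le_norm_ell2[OF F, of "X k - X m"] by (simp add: minus_ell2.rep_eq)
        also have "\<dots> \<le> e\<^sup>2"
          using N[OF k \<open>N \<le> m\<close>] by (intro power_mono) (auto simp: dist_norm)
        finally show "(\<Sum>w\<in>F. (cmod (ell2_coeff (X k) w - ell2_coeff (X m) w))\<^sup>2) \<le> e\<^sup>2" .
      qed
    qed simp
    then show ?thesis by blast
  qed
  have diff: "(\<lambda>w. (cmod (ell2_coeff (X k) w - f w))\<^sup>2) summable_on UNIV"
    if "\<And>F. finite F \<Longrightarrow> (\<Sum>w\<in>F. (cmod (ell2_coeff (X k) w - f w))\<^sup>2) \<le> e\<^sup>2" for k and e :: real
    by (rule nonneg_bdd_above_summable_on) (auto intro!: bdd_aboveI2[where M = "e\<^sup>2"] that)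
  obtain k0 where "\<And>F. finite F \<Longrightarrow> (\<Sum>w\<in>F. (cmod (ell2_coeff (X k0) w - f w))\<^sup>2) \<le> 1\<^sup>2"
    using fin[of 1] by auto
  note d0 = diff[OF this]
  have fs: "(\<lambda>w. (cmod (f w))\<^sup>2) summable_on UNIV"
    using ell2_add_summable[OF ell2_summable[of "X k0"], of "\<lambda>w. f w - ell2_coeff (X k0) w"] d0
    by (simp add: norm_minus_commute)
  define x where "x = Abs_ell2 f"
  have x: "ell2_coeff x = f" unfolding x_def by (rule Abs_ell2_inverse) (simp add: fs)
  have "X \<longlonglongrightarrow> x"
  proof (rule metric_LIMSEQ_I)
    fix e :: real assume e: "0 < e"
    obtain N where N: "\<And>k F. k \<ge> N \<Longrightarrow> finite F \<Longrightarrow>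
        (\<Sum>w\<in>F. (cmod (ell2_coeff (X k) w - f w))\<^sup>2) \<le> (e/2)\<^sup>2"
      using fin[of "e/2"] e by auto
    have "dist (X k) x < e" if "k \<ge> N" for k
    proof -
      have "(norm (X k - x))\<^sup>2 \<le> (e/2)\<^sup>2"
        unfolding norm_ell2_sq minus_ell2.rep_eq x
        by (rule infsum_le_finite_sums[OF diff[OF N[OF that]]]) (auto intro: N[OF that])
      then have "norm (X k - x) \<le> e/2" using e by (simp add: power2_le_iff_abs_le)
      then show ?thesis using e by (simp add: dist_norm)
    qed
    then show "\<exists>N. \<forall>k\<ge>N. dist (X k) x < e" by blast
  qed
  then show "convergent X" by (auto simp: convergent_def)
qed


section \<open>Bounded operators and the weak operator topology\<close>

type_synonym 'w ell2_op = "'w ell2 \<Rightarrow>\<^sub>L 'w ell2"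

text \<open>The library type \<open>\<Rightarrow>\<^sub>L\<close> consists of the bounded \<^emph>\<open>real\<close>-linear maps; the bounded
  operators of the complex Hilbert space are the complex-linear ones among them.\<close>

definition clinear_ops :: "'w ell2_op set" where
  "clinear_ops = {T. \<forall>c x. blinfun_apply T (ell2_scale c x) = ell2_scale c (blinfun_apply T x)}"

definition op_scale :: "complex \<Rightarrow> 'w ell2_op \<Rightarrow> 'w ell2_op" where
  "op_scale c T = Blinfun (\<lambda>x. ell2_scale c (blinfun_apply T x))"

lemma op_scale_apply: "blinfun_apply (op_scale c T) x = ell2_scale c (blinfun_apply T x)"
  unfolding op_scale_def
  by (subst bounded_linear_Blinfun_apply)
    (auto intro: bounded_linear_compose[OF bounded_linear_ell2_scale] blinfun.bounded_linear_right)

text \<open>The initial topology on the bounded operators for the maps \<open>T \<mapsto> \<langle>T x, y\<rangle>\<close>: the topology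
  \<open>euclidean\<close> on the function space is the product topology.\<close>

definition weak_operator_topology :: "'w ell2_op topology" where
  "weak_operator_topology =
    pullback_topology clinear_ops (\<lambda>T (x, y). ell2_cinner (blinfun_apply T x) y) euclidean"

definition unital_op_algebra :: "'w ell2_op set \<Rightarrow> bool" where
  "unital_op_algebra A \<longleftrightarrow> A \<subseteq> clinear_ops \<and> id_blinfun \<in> A \<and>
    (\<forall>S\<in>A. \<forall>T\<in>A. S + T \<in> A \<and> S o\<^sub>L T \<in> A) \<and> (\<forall>c. \<forall>T\<in>A. op_scale c T \<in> A)"


section \<open>The noncommutative analytic Toeplitz algebra\<close>

text \<open>The free semigroup on a set of letters \<open>'a\<close> is the monoid \<open>'a list\<close> under \<open>@\<close>.\<close>

definition ell2_basis :: "'w \<Rightarrow> 'w ell2" where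
  "ell2_basis w = Abs_ell2 (\<lambda>u. if u = w then 1 else 0)"

definition shift_coeff :: "'a list \<Rightarrow> ('a list \<Rightarrow> complex) \<Rightarrow> 'a list \<Rightarrow> complex" where
  "shift_coeff v f u = (if prefix v u then f (drop (length v) u) else 0)"

lemma shift_coeff_append [simp]: "shift_coeff v f (v @ w) = f w"
  by (simp add: shift_coeff_def)

lemma shift_coeff_has_sum:
  "(((\<lambda>u. (cmod (shift_coeff v f u))\<^sup>2) has_sum s) UNIV) \<longleftrightarrow> (((\<lambda>w. (cmod (f w))\<^sup>2) has_sum s) UNIV)"
proof -
  have "((\<lambda>u. (cmod (shift_coeff v f u))\<^sup>2) has_sum s) UNIV \<longleftrightarrow>
      ((\<lambda>u. (cmod (shift_coeff v f u))\<^sup>2) has_sum s) (range ((@) v))"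
    by (rule has_sum_cong_neutral) (auto simp: shift_coeff_def prefix_def)
  also have "\<dots> \<longleftrightarrow> ((\<lambda>w. (cmod (f w))\<^sup>2) has_sum s) UNIV"
    by (subst has_sum_reindex) (auto simp: inj_on_def o_def)
  finally show ?thesis .
qed

lift_definition left_shift_fun :: "'a list \<Rightarrow> 'a list ell2 \<Rightarrow> 'a list ell2" is shift_coeff
  using shift_coeff_has_sum unfolding summable_on_def by blast

lemma norm_left_shift_fun: "norm (left_shift_fun v x) = norm x"
proof -
  have "((\<lambda>w. (cmod (ell2_coeff x w))\<^sup>2) has_sum (norm x)\<^sup>2) UNIV"
    unfolding norm_ell2_sq by (rule has_sum_infsum[OF ell2_summable])
  then have "((\<lambda>w. (cmod (ell2_coeff (left_shift_fun v x) w))\<^sup>2) has_sum (norm x)\<^sup>2) UNIV"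
    unfolding left_shift_fun.rep_eq shift_coeff_has_sum .
  then have "(norm (left_shift_fun v x))\<^sup>2 = (norm x)\<^sup>2"
    unfolding norm_ell2_sq[of "left_shift_fun v x"] by (rule infsumI)
  then show ?thesis by (simp add: power2_eq_iff_nonneg)
qed

definition left_shift :: "'a list \<Rightarrow> 'a list ell2_op" where
  "left_shift v = Blinfun (left_shift_fun v)"

lemma left_shift_apply: "blinfun_apply (left_shift v) = left_shift_fun v"
  unfolding left_shift_def
proof (intro bounded_linear_Blinfun_apply bounded_linear_intro[where K = 1])
  fix x y :: "'a list ell2" and r :: real
  show "left_shift_fun v (x + y) = left_shift_fun v x + left_shift_fun v y"
    by (transfer; auto simp: shift_coeff_def fun_eq_iff)
  show "left_shift_fun v (r *\<^sub>R x) = r *\<^sub>R left_shift_fun v x"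
    unfolding scaleR_ell2_def by (transfer; auto simp: shift_coeff_def fun_eq_iff)
  show "norm (left_shift_fun v x) \<le> norm x * 1" by (simp add: norm_left_shift_fun)
qed

lemma ell2_coeff_basis: "ell2_coeff (ell2_basis w) = (\<lambda>u. if u = w then 1 else 0)"
proof -
  have "(\<lambda>u. (cmod (if u = w then 1 else 0))\<^sup>2) summable_on UNIV"
    using summable_on_cong_neutral[of UNIV "{w}" "\<lambda>u. (cmod (if u = w then 1 else 0))\<^sup>2"
        "\<lambda>u. (cmod (if u = w then 1 else 0))\<^sup>2"] by simp
  then show ?thesis unfolding ell2_basis_def by (intro Abs_ell2_inverse) simp
qed

lemma left_shift_basis: "blinfun_apply (left_shift v) (ell2_basis w) = ell2_basis (v @ w)"
proof -
  have "ell2_coeff (left_shift_fun v (ell2_basis w)) = ell2_coeff (ell2_basis (v @ w))"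
    unfolding left_shift_fun.rep_eq ell2_coeff_basis
    by (auto simp: shift_coeff_def prefix_def fun_eq_iff)
  then show ?thesis by (simp add: left_shift_apply ell2_coeff_inject)
qed

lemma left_shift_clinear: "left_shift v \<in> clinear_ops"
proof -
  have "left_shift_fun v (ell2_scale c x) = ell2_scale c (left_shift_fun v x)" for c x
    by (transfer; auto simp: shift_coeff_def fun_eq_iff)
  then show ?thesis by (simp add: clinear_ops_def left_shift_apply)
qed

definition nc_toeplitz_algebra :: "'a list ell2_op set" where
  "nc_toeplitz_algebra =
    (\<lambda>A. unital_op_algebra A \<and> closedin weak_operator_topology A) hull (range (\<lambda>i. left_shift [i]))"


section \<open>Complex Banach spaces, duals and preduals\<close>

text \<open>A complex normed space is carried by a linear subspace \<open>carr\<close> of a complex vector space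
  whose addition is that of the type \<open>'e\<close>; values of \<open>nrm\<close> outside \<open>carr\<close> are irrelevant.
  Explicit carriers are used so that one may quantify over Banach spaces within a formula.\<close>

record 'e cnormed =
  carr :: "'e set"
  scl :: "complex \<Rightarrow> 'e \<Rightarrow> 'e"
  nrm :: "'e \<Rightarrow> real"

definition complex_normed_space :: "'e::ab_group_add cnormed \<Rightarrow> bool" where
  "complex_normed_space V \<longleftrightarrow>
    vector_space (scl V) \<and> module.subspace (scl V) (carr V) \<and>
    (\<forall>x\<in>carr V. 0 \<le> nrm V x \<and> (nrm V x = 0 \<longleftrightarrow> x = 0)) \<and>
    (\<forall>c. \<forall>x\<in>carr V. nrm V (scl V c x) = cmod c * nrm V x) \<and>
    (\<forall>x\<in>carr V. \<forall>y\<in>carr V. nrm V (x + y) \<le> nrm V x + nrm V y)"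

definition complex_banach_space :: "'e::ab_group_add cnormed \<Rightarrow> bool" where
  "complex_banach_space V \<longleftrightarrow> complex_normed_space V \<and>
    (\<forall>X :: nat \<Rightarrow> 'e. range X \<subseteq> carr V \<longrightarrow>
      (\<forall>e>0. \<exists>N. \<forall>i\<ge>N. \<forall>j\<ge>N. nrm V (X i - X j) < e) \<longrightarrow>
      (\<exists>x\<in>carr V. (\<lambda>k. nrm V (X k - x)) \<longlonglongrightarrow> 0))"

text \<open>Functionals on \<open>V\<close> are represented by functions vanishing outside \<open>carr V\<close>; addition of
  functionals is pointwise.\<close>

definition dual_space :: "'e::ab_group_add cnormed \<Rightarrow> ('e \<Rightarrow> complex) cnormed" where
  "dual_space V =
    \<lparr>carr = {f. (\<forall>x\<in>carr V. \<forall>y\<in>carr V. f (x + y) = f x + f y) \<and>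
                (\<forall>c. \<forall>x\<in>carr V. f (scl V c x) = c * f x) \<and>
                (\<exists>K. \<forall>x\<in>carr V. cmod (f x) \<le> K * nrm V x) \<and>
                (\<forall>x. x \<notin> carr V \<longrightarrow> f x = 0)},
     scl = (\<lambda>c f x. c * f x),
     nrm = (\<lambda>f. SUP x\<in>{x \<in> carr V. nrm V x \<le> 1}. cmod (f x))\<rparr>"

definition isometrically_isomorphic ::
    "'e::ab_group_add cnormed \<Rightarrow> 'f::ab_group_add cnormed \<Rightarrow> bool" where
  "isometrically_isomorphic V W \<longleftrightarrow>
    (\<exists>J. bij_betw J (carr V) (carr W) \<and>
      (\<forall>x\<in>carr V. \<forall>y\<in>carr V. J (x + y) = J x + J y) \<and>
      (\<forall>c. \<forall>x\<in>carr V. J (scl V c x) = scl W c (J x)) \<and>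
      (\<forall>x\<in>carr V. nrm W (J x) = nrm V x))"

definition is_predual :: "'e::ab_group_add cnormed \<Rightarrow> 'x::ab_group_add cnormed \<Rightarrow> bool" where
  "is_predual E X \<longleftrightarrow> complex_banach_space E \<and> isometrically_isomorphic (dual_space E) X"

definition nc_toeplitz :: "'a list ell2_op cnormed" where
  "nc_toeplitz = \<lparr>carr = nc_toeplitz_algebra, scl = op_scale, nrm = norm\<rparr>"

lemma closedin_clinear_ops: "closedin weak_operator_topology clinear_ops"
proof -
  have "topspace weak_operator_topology = (clinear_ops :: 'a ell2_op set)"
    by (simp add: weak_operator_topology_def topspace_pullback_topology)
  then show ?thesis by (metis closedin_topspace)
qed

lemma unital_op_algebra_clinear_ops: "unital_op_algebra clinear_ops"
proof -
  have [simp]: "ell2_scale c (x + y) = ell2_scale c x + ell2_scale c y" for c and x y :: "'a ell2"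
    by (rule linear_add[OF bounded_linear.linear[OF bounded_linear_ell2_scale]])
  have "ell2_scale c (ell2_scale d x) = ell2_scale d (ell2_scale c x)" for c d and x :: "'a ell2"
    by (transfer; simp add: algebra_simps)
  then show ?thesis
    by (auto simp: unital_op_algebra_def clinear_ops_def op_scale_apply blinfun.add_left)
qed

lemma nc_toeplitz_algebra_props:
  "unital_op_algebra (nc_toeplitz_algebra :: 'a list ell2_op set)"
  "closedin weak_operator_topology (nc_toeplitz_algebra :: 'a list ell2_op set)"
  "left_shift [i :: 'a] \<in> nc_toeplitz_algebra"
proof -
  let ?N = "nc_toeplitz_algebra :: 'a list ell2_op set"
  let ?P = "\<lambda>A :: 'a list ell2_op set. unital_op_algebra A \<and> closedin weak_operator_topology A"
  let ?S = "range (\<lambda>i. left_shift [i]) :: 'a list ell2_op set"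
  define F where "F = {A. ?P A \<and> ?S \<subseteq> A}"
  have eq: "?N = \<Inter>F"
    unfolding nc_toeplitz_algebra_def hull_def F_def by simp
  have mem: "clinear_ops \<in> F"
    using unital_op_algebra_clinear_ops closedin_clinear_ops left_shift_clinear
    unfolding F_def by blast
  have alg: "unital_op_algebra A" if "A \<in> F" for A using that by (simp add: F_def)
  show "unital_op_algebra ?N"
    unfolding unital_op_algebra_def
  proof (intro conjI ballI allI)
    show "?N \<subseteq> clinear_ops" unfolding eq by (rule Inter_lower[OF mem])
    show "id_blinfun \<in> ?N"
      unfolding eq by (rule InterI) (drule alg, simp add: unital_op_algebra_def)
  next
    fix S T assume "S \<in> ?N" "T \<in> ?N"
    then have ST: "S \<in> A" "T \<in> A" if "A \<in> F" for A using that by (simp_all add: eq)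
    show "S + T \<in> ?N"
      unfolding eq by (rule InterI) (use ST alg in \<open>simp add: unital_op_algebra_def\<close>)
    show "S o\<^sub>L T \<in> ?N"
      unfolding eq by (rule InterI) (use ST alg in \<open>simp add: unital_op_algebra_def\<close>)
  next
    fix c T assume "T \<in> ?N"
    then have T: "T \<in> A" if "A \<in> F" for A using that by (simp add: eq)
    show "op_scale c T \<in> ?N"
      unfolding eq by (rule InterI) (use T alg in \<open>simp add: unital_op_algebra_def\<close>)
  qed
  show "closedin weak_operator_topology ?N"
    unfolding eq using mem by (intro closedin_Inter) (auto simp: F_def)
  show "left_shift [i] \<in> ?N"
    unfolding eq by (auto simp: F_def)
qed

lemma complex_normed_space_nc_toeplitz: "complex_normed_space (nc_toeplitz :: 'a list ell2_op cnormed)"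
proof -
  have A: "unital_op_algebra (nc_toeplitz_algebra :: 'a list ell2_op set)"
    by (rule nc_toeplitz_algebra_props)
  have vs: "vector_space (op_scale :: complex \<Rightarrow> 'a list ell2_op \<Rightarrow> _)"
  proof (unfold_locales; rule blinfun_eqI; simp only: op_scale_apply blinfun.add_left)
    fix a b :: complex and x y :: "'a list ell2"
    show "ell2_scale a (x + y) = ell2_scale a x + ell2_scale a y" by (transfer; simp add: algebra_simps)
    show "ell2_scale (a + b) x = ell2_scale a x + ell2_scale b x" by (transfer; simp add: algebra_simps)
    show "ell2_scale a (ell2_scale b x) = ell2_scale (a * b) x" by (transfer; simp add: algebra_simps)
    show "ell2_scale 1 x = x" by (transfer; simp)
  qed
  have z: "op_scale 0 T = 0" for T :: "'a list ell2_op"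
    by (rule blinfun_eqI) (simp add: op_scale_apply, transfer, simp)
  have "0 \<in> (nc_toeplitz_algebra :: 'a list ell2_op set)" using A z unfolding unital_op_algebra_def by metis
  then have sub: "module.subspace op_scale (nc_toeplitz_algebra :: 'a list ell2_op set)"
    using A unfolding unital_op_algebra_def by (simp add: module.subspace_def[OF vs[folded module_iff_vector_space]])
  have le: "norm (op_scale c T) \<le> cmod c * norm T" for c and T :: "'a list ell2_op"
    by (rule norm_blinfun_bound) (auto simp: op_scale_apply norm_ell2_scale mult.assoc intro!: mult_left_mono norm_blinfun)
  have "norm (op_scale c T) = cmod c * norm T" for c and T :: "'a list ell2_op"
  proof (cases "c = 0")
    case False
    have "norm T = norm (op_scale (inverse c) (op_scale c T))"
      by (simp only: vector_space.vector_space_assms(3)[OF vs] left_inverse[OF False]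
          vector_space.vector_space_assms(4)[OF vs])
    also have "\<dots> \<le> inverse (cmod c) * norm (op_scale c T)" using le by (metis norm_inverse)
    finally show ?thesis using le[of c T] False by (simp add: field_simps)
  qed (simp add: z)
  then show ?thesis using vs sub
    by (simp add: complex_normed_space_def nc_toeplitz_def norm_triangle_ineq)
qed

end

theory Submission
  imports Defs
begin

text \<open>
  Let \<open>X\<close> be the noncommutative analytic Toeplitz algebra. An element \<open>T\<close> of \<open>X\<close> is determined by
  its Fourier coefficients \<open>a\<^sub>w\<close>, the coefficients of the vector \<open>T \<xi>\<^sub>\<emptyset>\<close>.

  A predual \<open>E\<close> of \<open>X\<close> amounts to a compact topology on the unit ball of \<open>X\<close>: elements of \<open>X\<close>
  become functions on \<open>E\<close>, and by the Banach-Alaoglu theorem the ball is compact for pointwise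
  convergence. Such a linear injection into a power of the complex numbers with compact image of the
  unit ball is called a compact embedding below. Conversely, for every compact embedding the
  functionals that are continuous on the unit ball form a predual (\<open>Dixmier_Ng\<close>). As the weak
  operator topology makes the ball of \<open>X\<close> compact, the Fourier coefficients form a compact
  embedding, and \<open>X\<close> has a predual.

  For uniqueness it is enough that every single Fourier coefficient is continuous on bounded sets in
  the topology of every predual (\<open>predual_isomorphic_embedding_predual\<close>): a continuous bijection from
  a compact space to a Hausdorff space is a homeomorphism, so all preduals give the topology of the
  Fourier embedding on the unit ball, and the Hahn-Banach theorem identifies each of them with the
  predual that belongs to this embedding.

  The continuity of the coefficients uses two facts about an arbitrary predual topology. Norm balls
  are closed in it, so that \<open>\<parallel>y + z\<parallel> \<le> \<rho>\<close> for all \<open>y\<close> in a set implies \<open>\<parallel>x + z\<parallel> \<le> \<rho>\<close> for every \<open>x\<close> in the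
  closure of the set. And the generators have orthogonal ranges, so that
  \<open>\<parallel>y + t L\<^sub>j\<^sub>u\<parallel>\<^sup>2 \<le> \<parallel>y\<parallel>\<^sup>2 + \<bar>t\<bar>\<^sup>2\<close> for all scalars \<open>t\<close> if no word in the support of \<open>y\<close> is empty or
  starts with \<open>j\<close>. If \<open>x\<close> is a limit of such \<open>y\<close> of norm at most \<open>M\<close>, then the coefficient of \<open>x\<close> at
  \<open>ju\<close> satisfies \<open>\<bar>a + t\<bar>\<^sup>2 \<le> M\<^sup>2 + \<bar>t\<bar>\<^sup>2\<close> for all \<open>t\<close>, hence vanishes. The constant coefficient of \<open>x\<close>
  satisfies the same inequality, because \<open>\<parallel>c + t L\<^sub>j\<parallel> = \<bar>c\<bar> + \<bar>t\<bar>\<close> as for the unilateral shift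
  (\<open>fourier_sum_le_norm\<close> is the bound needed), and vanishes too. Therefore the elements supported on
  words that start in a given proper subset of the letters form a closed set
  (\<open>closed_letter_ideal_ball\<close>); this is the step that needs two letters.

  Split \<open>X\<close> into the scalars, the words starting with a letter \<open>i\<close>, and the words starting with
  another letter. The bounded parts of all three summands are compact, so the two projections used
  below are continuous on bounded sets (\<open>letter_decomposition_continuous\<close>). This settles the
  constant coefficient. For the coefficient at \<open>iw\<close> observe that \<open>y \<mapsto> L\<^sub>i y\<close> followed by the given
  embedding is again a compact embedding, and proceed by induction on the word, for all compact
  embeddings simultaneously (\<open>fourier_factors_through\<close>).
\<close>


section \<open>The Hahn-Banach theorem for complex seminorms\<close>

lemma rotate_to_nonneg: "\<exists>c. cmod c = 1 \<and> c * z = complex_of_real (cmod z)"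
proof (cases "z = 0")
  case True
  then show ?thesis by (intro exI[of _ 1]) simp
next
  case False
  then show ?thesis
    by (intro exI[of _ "cnj z / complex_of_real (cmod z)"])
      (simp add: norm_divide complex_norm_square[symmetric] mult.commute power2_eq_square)
qed

locale complex_seminorm = vector_space scale
  for scale :: "complex \<Rightarrow> 'e::ab_group_add \<Rightarrow> 'e" (infixr \<open>*s\<close> 75) +
  fixes C :: "'e set" and p :: "'e \<Rightarrow> real"
  assumes subspace_C: "subspace C"
    and p_scale: "x \<in> C \<Longrightarrow> p (c *s x) = cmod c * p x"
    and p_triangle: "\<lbrakk>x \<in> C; y \<in> C\<rbrakk> \<Longrightarrow> p (x + y) \<le> p x + p y"
begin

lemma p_zero: "p 0 = 0"
  using p_scale[of 0 0] subspace_0[OF subspace_C] by simp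

lemma p_minus: "x \<in> C \<Longrightarrow> p (- x) = p x"
  using p_scale[of x "-1"] by simp

lemma p_nonneg: "x \<in> C \<Longrightarrow> 0 \<le> p x"
  using p_triangle[of x "- x"] p_minus[of x] p_zero subspace_neg[OF subspace_C] by simp

text \<open>Partial real functionals below \<open>p\<close> are handled as graphs, so that Zorn's lemma applies to
  plain set inclusion. Domination by \<open>p\<close> already makes such a graph single-valued, because it
  forces \<open>a \<le> 0\<close> and \<open>- a \<le> 0\<close> for a value \<open>a\<close> attached to the zero vector.\<close>

definition dominated_graph :: "('e \<times> real) set \<Rightarrow> bool" where
  "dominated_graph G \<longleftrightarrow> (\<forall>x a. (x, a) \<in> G \<longrightarrow> x \<in> C \<and> a \<le> p x) \<and>
    (\<forall>x a y b. (x, a) \<in> G \<longrightarrow> (y, b) \<in> G \<longrightarrow> (x + y, a + b) \<in> G) \<and>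
    (\<forall>r x a. (x, a) \<in> G \<longrightarrow> (complex_of_real r *s x, r * a) \<in> G)"

lemma dominated_graph_unique:
  assumes G: "dominated_graph G" and "(x, a) \<in> G" "(x, b) \<in> G"
  shows "a = b"
proof -
  have "(x + complex_of_real (-1) *s x, a + (-1) * b) \<in> G"
    and "(x + complex_of_real (-1) *s x, b + (-1) * a) \<in> G"
    using assms unfolding dominated_graph_def by blast+
  then have "a - b \<le> p 0" "b - a \<le> p 0"
    using G unfolding dominated_graph_def by auto
  then show ?thesis by (simp add: p_zero)
qed

text \<open>The one-dimensional extension step. For \<open>t \<noteq> 0\<close> the bound at \<open>x + t e\<close> is obtained from the
  bounds at \<open>x / \<bar>t\<bar> + e\<close> and \<open>x / \<bar>t\<bar> - e\<close> by homogeneity.\<close>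

lemma dominated_graph_extend:
  assumes G: "dominated_graph G" and ne: "G \<noteq> {}" and e: "e \<in> C"
  shows "\<exists>\<alpha>. dominated_graph {(x + complex_of_real t *s e, a + t * \<alpha>) | x a t. (x, a) \<in> G}"
proof -
  note S = subspace_add[OF subspace_C] subspace_diff[OF subspace_C] subspace_scale[OF subspace_C]
  have dom: "x \<in> C" "a \<le> p x" if "(x, a) \<in> G" for x a
    using G that unfolding dominated_graph_def by auto
  have sep: "a - p (x - e) \<le> p (y + e) - b" if "(x, a) \<in> G" "(y, b) \<in> G" for x a y b
  proof -
    have "(x + y, a + b) \<in> G" using G that unfolding dominated_graph_def by blast
    then have "a + b \<le> p ((x - e) + (y + e))" using dom(2) by simp
    also have "\<dots> \<le> p (x - e) + p (y + e)"
      using dom(1) that e by (intro p_triangle S) auto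
    finally show ?thesis by simp
  qed
  define A where "A = {a - p (x - e) | x a. (x, a) \<in> G}"
  \<comment> \<open>The value at \<open>e\<close> may be any number between the left and the right sides of \<open>sep\<close>.\<close>
  define \<alpha> where "\<alpha> = Sup A"
  obtain x0 a0 where x0: "(x0, a0) \<in> G" using ne by auto
  have A: "A \<noteq> {}" using x0 unfolding A_def by blast
  have bdd: "bdd_above A" using sep[OF _ x0] unfolding A_def bdd_above_def by blast
  have lo: "a - \<alpha> \<le> p (x - e)" if "(x, a) \<in> G" for x a
    using cSup_upper[OF _ bdd, of "a - p (x - e)"] that unfolding \<alpha>_def A_def by fastforce
  have hi: "b + \<alpha> \<le> p (y + e)" if "(y, b) \<in> G" for y b
  proof -
    have "\<alpha> \<le> p (y + e) - b"
      unfolding \<alpha>_def by (rule cSup_least[OF A]) (use sep[OF _ that] in \<open>auto simp: A_def\<close>)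
    then show ?thesis by simp
  qed
  have sc: "(complex_of_real r *s x, r * a) \<in> G" if "(x, a) \<in> G" for r x a
    using G that unfolding dominated_graph_def by blast
  have le: "a + t * \<alpha> \<le> p (x + complex_of_real t *s e)" if xa: "(x, a) \<in> G" for x a t
  proof (cases t "0::real" rule: linorder_cases)
    case equal
    then show ?thesis using dom(2)[OF xa] by simp
  next
    case greater
    have "inverse t * a + \<alpha> \<le> p (complex_of_real (inverse t) *s x + e)"
      by (rule hi[OF sc[OF xa]])
    then have "t * (inverse t * a + \<alpha>) \<le> t * p (complex_of_real (inverse t) *s x + e)"
      using greater by simp
    also have "\<dots> = p (complex_of_real t *s (complex_of_real (inverse t) *s x + e))"
      using greater dom(1)[OF xa] e by (subst p_scale) (auto intro!: S)
    finally show ?thesis using greater by (simp add: scale_right_distrib algebra_simps)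
  next
    case less
    define s where "s = - t"
    have s: "s > 0" using less s_def by simp
    have "inverse s * a - \<alpha> \<le> p (complex_of_real (inverse s) *s x - e)"
      by (rule lo[OF sc[OF xa]])
    then have "s * (inverse s * a - \<alpha>) \<le> s * p (complex_of_real (inverse s) *s x - e)"
      using s by simp
    also have "\<dots> = p (complex_of_real s *s (complex_of_real (inverse s) *s x - e))"
      using s dom(1)[OF xa] e by (subst p_scale) (auto intro!: S)
    finally show ?thesis using s by (simp add: scale_right_diff_distrib algebra_simps s_def)
  qed
  have "dominated_graph {(x + complex_of_real t *s e, a + t * \<alpha>) | x a t. (x, a) \<in> G}"
    unfolding dominated_graph_def
  proof (intro conjI allI impI)
    fix y b assume "(y, b) \<in> {(x + complex_of_real t *s e, a + t * \<alpha>) | x a t. (x, a) \<in> G}"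
    then show "y \<in> C" "b \<le> p y" using dom(1) e le by (auto intro!: S)
  next
    fix y b z c
    assume "(y, b) \<in> {(x + complex_of_real t *s e, a + t * \<alpha>) | x a t. (x, a) \<in> G}"
      and "(z, c) \<in> {(x + complex_of_real t *s e, a + t * \<alpha>) | x a t. (x, a) \<in> G}"
    then obtain x a t x' a' t' where xa: "(x, a) \<in> G" "(x', a') \<in> G"
      and eq: "(y, b) = (x + complex_of_real t *s e, a + t * \<alpha>)"
        "(z, c) = (x' + complex_of_real t' *s e, a' + t' * \<alpha>)" by blast
    have "(x + x', a + a') \<in> G" using G xa unfolding dominated_graph_def by blast
    moreover have "y + z = x + x' + complex_of_real (t + t') *s e" "b + c = a + a' + (t + t') * \<alpha>"
      using eq by (simp_all add: scale_left_distrib algebra_simps)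
    ultimately show "(y + z, b + c) \<in> {(x + complex_of_real t *s e, a + t * \<alpha>) | x a t. (x, a) \<in> G}"
      by blast
  next
    fix r y b
    assume "(y, b) \<in> {(x + complex_of_real t *s e, a + t * \<alpha>) | x a t. (x, a) \<in> G}"
    then obtain x a t where xa: "(x, a) \<in> G"
      and eq: "y = x + complex_of_real t *s e" "b = a + t * \<alpha>" by auto
    have "complex_of_real r *s y = complex_of_real r *s x + complex_of_real (r * t) *s e"
      "r * b = r * a + (r * t) * \<alpha>"
      unfolding eq by (simp_all add: scale_right_distrib algebra_simps)
    then show "(complex_of_real r *s y, r * b) \<in> {(x + complex_of_real t *s e, a + t * \<alpha>) | x a t. (x, a) \<in> G}"
      using sc[OF xa, of r] by blast
  qed
  then show ?thesis by blast
qed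

lemma real_Hahn_Banach:
  assumes e: "e \<in> C"
  obtains g where "\<And>x y. \<lbrakk>x \<in> C; y \<in> C\<rbrakk> \<Longrightarrow> g (x + y) = g x + g y"
    and "\<And>r x. x \<in> C \<Longrightarrow> g (complex_of_real r *s x) = r * g x"
    and "\<And>x. x \<in> C \<Longrightarrow> g x \<le> p x"
    and "g e = p e"
proof -
  note S = subspace_add[OF subspace_C] subspace_diff[OF subspace_C] subspace_scale[OF subspace_C]
  define G0 where "G0 = {(complex_of_real r *s e, r * p e) | r. True}"
  have G0: "dominated_graph G0"
    unfolding dominated_graph_def
  proof (intro conjI allI impI)
    fix x a assume "(x, a) \<in> G0"
    then obtain r where "x = complex_of_real r *s e" "a = r * p e" unfolding G0_def by auto
    then show "x \<in> C" "a \<le> p x"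
      using e p_nonneg[OF e] by (auto intro!: S mult_right_mono simp: p_scale)
  next
    fix x a y b assume "(x, a) \<in> G0" "(y, b) \<in> G0"
    then obtain r s where "x = complex_of_real r *s e" "a = r * p e"
      "y = complex_of_real s *s e" "b = s * p e" unfolding G0_def by auto
    then have "x + y = complex_of_real (r + s) *s e" "a + b = (r + s) * p e"
      by (simp_all add: scale_left_distrib algebra_simps)
    then show "(x + y, a + b) \<in> G0" unfolding G0_def by blast
  next
    fix r x a assume "(x, a) \<in> G0"
    then obtain s where "x = complex_of_real s *s e" "a = s * p e" unfolding G0_def by auto
    then have "complex_of_real r *s x = complex_of_real (r * s) *s e" "r * a = (r * s) * p e"
      by simp_all
    then show "(complex_of_real r *s x, r * a) \<in> G0" unfolding G0_def by blast
  qed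
  have e0: "(e, p e) \<in> G0" unfolding G0_def by (auto intro!: exI[of _ 1])
  define \<A> where "\<A> = {G. dominated_graph G \<and> G0 \<subseteq> G}"
  have "\<exists>M\<in>\<A>. \<forall>X\<in>\<A>. M \<subseteq> X \<longrightarrow> X = M"
  proof (rule subset_Zorn_nonempty)
    show "\<A> \<noteq> {}" using G0 unfolding \<A>_def by blast
    fix \<C> assume ne: "\<C> \<noteq> {}" and ch: "subset.chain \<A> \<C>"
    have dg: "dominated_graph G" if "G \<in> \<C>" for G
      using ch that unfolding subset.chain_def \<A>_def by blast
    have "dominated_graph (\<Union>\<C>)"
      unfolding dominated_graph_def
    proof (intro conjI allI impI)
      fix x a assume "(x, a) \<in> \<Union>\<C>"
      then show "x \<in> C" "a \<le> p x" using dg unfolding dominated_graph_def by blast+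
    next
      fix x a y b assume "(x, a) \<in> \<Union>\<C>" "(y, b) \<in> \<Union>\<C>"
      then obtain G H where GH: "(x, a) \<in> G" "G \<in> \<C>" "(y, b) \<in> H" "H \<in> \<C>" by blast
      then have "G \<subseteq> H \<or> H \<subseteq> G" using ch unfolding subset.chain_def by blast
      then obtain K where "K \<in> \<C>" "(x, a) \<in> K" "(y, b) \<in> K" using GH by blast
      then show "(x + y, a + b) \<in> \<Union>\<C>" using dg unfolding dominated_graph_def by blast
    next
      fix r x a assume "(x, a) \<in> \<Union>\<C>"
      then show "(complex_of_real r *s x, r * a) \<in> \<Union>\<C>"
        using dg unfolding dominated_graph_def by blast
    qed
    moreover have "G0 \<subseteq> \<Union>\<C>" using ne ch unfolding subset.chain_def \<A>_def by blast
    ultimately show "\<Union>\<C> \<in> \<A>" unfolding \<A>_def by blast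
  qed
  then obtain M where "M \<in> \<A>" and max': "\<forall>X\<in>\<A>. M \<subseteq> X \<longrightarrow> X = M" ..
  then have M: "dominated_graph M" "G0 \<subseteq> M" unfolding \<A>_def by simp_all
  have max: "X = M" if "dominated_graph X" "M \<subseteq> X" for X
    using max' M(2) that unfolding \<A>_def by simp
  have total: "\<exists>a. (x, a) \<in> M" if x: "x \<in> C" for x
  proof -
    have ne: "M \<noteq> {}" using M(2) e0 by blast
    obtain \<alpha> where \<alpha>: "dominated_graph {(y + complex_of_real t *s x, a + t * \<alpha>) | y a t. (y, a) \<in> M}"
      (is "dominated_graph ?N") using dominated_graph_extend[OF M(1) ne x] by blast
    have "M \<subseteq> ?N"
    proof (rule subrelI)
      fix y a assume "(y, a) \<in> M"
      then show "(y, a) \<in> ?N" by (intro CollectI exI[of _ y] exI[of _ a] exI[of _ 0]) simp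
    qed
    then have N: "?N = M" by (rule max[OF \<alpha>])
    have "(complex_of_real 0 *s e, 0 * p e) \<in> M"
      using M e0 unfolding dominated_graph_def by blast
    then have "(0, 0) \<in> M" by simp
    then have "(0 + complex_of_real 1 *s x, 0 + 1 * \<alpha>) \<in> ?N" by blast
    then show ?thesis unfolding N by auto
  qed
  define g where "g x = (SOME a. (x, a) \<in> M)" for x
  have g: "(x, g x) \<in> M" if "x \<in> C" for x
    unfolding g_def by (rule someI_ex[OF total[OF that]])
  have gI: "g x = a" if "(x, a) \<in> M" for x a
    by (rule dominated_graph_unique[OF M(1) _ that], rule g)
      (use M(1) that in \<open>auto simp: dominated_graph_def\<close>)
  show ?thesis
  proof (rule that)
    show "g (x + y) = g x + g y" if "x \<in> C" "y \<in> C" for x y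
      using M(1) g[OF that(1)] g[OF that(2)] by (intro gI) (simp add: dominated_graph_def)
    show "g (complex_of_real r *s x) = r * g x" if "x \<in> C" for r x
      using M(1) g[OF that] by (intro gI) (simp add: dominated_graph_def)
    show "g x \<le> p x" if "x \<in> C" for x
      using M(1) g[OF that] by (simp add: dominated_graph_def)
    show "g e = p e" using M(2) e0 by (intro gI) (rule subsetD)
  qed
qed

text \<open>A complex functional is recovered from its real part \<open>g\<close> as \<open>x \<mapsto> g x - \<i> g (\<i> x)\<close>; rotating
  \<open>x\<close> so that the value becomes real shows that the bound by \<open>p\<close> survives.\<close>

theorem Hahn_Banach:
  assumes e: "e \<in> C"
  obtains h where "\<And>x y. \<lbrakk>x \<in> C; y \<in> C\<rbrakk> \<Longrightarrow> h (x + y) = h x + h y"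
    and "\<And>c x. x \<in> C \<Longrightarrow> h (c *s x) = c * h x"
    and "\<And>x. x \<in> C \<Longrightarrow> cmod (h x) \<le> p x"
    and "\<And>x. x \<notin> C \<Longrightarrow> h x = 0"
    and "h e = complex_of_real (p e)"
proof -
  note S = subspace_add[OF subspace_C] subspace_diff[OF subspace_C] subspace_scale[OF subspace_C]
  obtain g where g_add: "\<And>x y. \<lbrakk>x \<in> C; y \<in> C\<rbrakk> \<Longrightarrow> g (x + y) = g x + g y"
    and g_scale: "\<And>r x. x \<in> C \<Longrightarrow> g (complex_of_real r *s x) = r * g x"
    and g_le: "\<And>x. x \<in> C \<Longrightarrow> g x \<le> p x" and g_e: "g e = p e"
    using real_Hahn_Banach[OF e] by blast
  define h where "h x = (if x \<in> C then Complex (g x) (- g (\<i> *s x)) else 0)" for x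
  have add: "h (x + y) = h x + h y" if "x \<in> C" "y \<in> C" for x y
    using that by (simp add: h_def S g_add scale_right_distrib complex_eq_iff)
  have scale: "h (c *s x) = c * h x" if x: "x \<in> C" for c x
  proof -
    have split: "g (d *s x) = Re d * g x + Im d * g (\<i> *s x)" for d
    proof -
      have "d *s x = complex_of_real (Re d) *s x + complex_of_real (Im d) *s \<i> *s x"
        by (metis complex_eq mult.commute scale_left_distrib scale_scale)
      then show ?thesis using x by (simp only: g_add g_scale S)
    qed
    have "g (\<i> *s c *s x) = Re (\<i> * c) * g x + Im (\<i> * c) * g (\<i> *s x)"
      unfolding scale_scale by (rule split)
    then show ?thesis using x by (simp add: h_def S split[of c] complex_eq_iff algebra_simps)
  qed
  have bound: "cmod (h x) \<le> p x" if x: "x \<in> C" for x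
  proof -
    obtain c where c: "cmod c = 1" "c * h x = complex_of_real (cmod (h x))"
      using rotate_to_nonneg by blast
    have "cmod (h x) = Re (h (c *s x))" using x c(2) by (simp add: scale)
    also have "\<dots> = g (c *s x)" using x by (simp add: h_def S)
    also have "\<dots> \<le> p (c *s x)" using x by (intro g_le S)
    also have "\<dots> = p x" using x c(1) by (simp add: p_scale)
    finally show ?thesis .
  qed
  have "h e = complex_of_real (p e)"
  proof -
    have re: "Re (h e) = p e" using e by (simp add: h_def g_e)
    have "(Im (h e))\<^sup>2 \<le> 0"
      using power_mono[OF bound[OF e], of 2] re by (simp add: cmod_power2)
    then show ?thesis using re by (simp add: complex_eq_iff)
  qed
  then show ?thesis using that[of h] add scale bound by (auto simp: h_def)
qed

end

section \<open>Normed spaces, their duals and the Banach-Alaoglu theorem\<close>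

definition norm_ball :: "'e cnormed \<Rightarrow> real \<Rightarrow> 'e set" where
  "norm_ball V r = {x \<in> carr V. nrm V x \<le> r}"

lemma norm_ballI: "\<lbrakk>x \<in> carr V; nrm V x \<le> r\<rbrakk> \<Longrightarrow> x \<in> norm_ball V r"
  and norm_ballD: "x \<in> norm_ball V r \<Longrightarrow> x \<in> carr V" "x \<in> norm_ball V r \<Longrightarrow> nrm V x \<le> r"
  by (simp_all add: norm_ball_def)

locale normed_carrier =
  fixes V :: "'e::ab_group_add cnormed"
  assumes normed: "complex_normed_space V"
begin

sublocale complex_seminorm "scl V" "carr V" "nrm V"
  using normed unfolding complex_normed_space_def
  by (intro complex_seminorm.intro complex_seminorm_axioms.intro) auto

lemmas carr_closed = subspace_add[OF subspace_C] subspace_diff[OF subspace_C]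
  subspace_scale[OF subspace_C] subspace_neg[OF subspace_C] subspace_0[OF subspace_C]

lemma nrm_eq_0_iff: "x \<in> carr V \<Longrightarrow> nrm V x = 0 \<longleftrightarrow> x = 0"
  using normed unfolding complex_normed_space_def by blast

lemma nrm_diff_commute: "\<lbrakk>x \<in> carr V; y \<in> carr V\<rbrakk> \<Longrightarrow> nrm V (x - y) = nrm V (y - x)"
  using p_minus[of "x - y"] by (simp add: carr_closed)

lemma nrm_triangle_diff:
  "\<lbrakk>x \<in> carr V; y \<in> carr V; z \<in> carr V\<rbrakk> \<Longrightarrow> nrm V (x - z) \<le> nrm V (x - y) + nrm V (y - z)"
  using p_triangle[of "x - y" "y - z"] by (simp add: carr_closed)

lemma zero_in_norm_ball: "0 \<le> r \<Longrightarrow> 0 \<in> norm_ball V r"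
  by (simp add: norm_ball_def carr_closed p_zero)

lemma scale_in_norm_ball:
  "\<lbrakk>x \<in> norm_ball V r; cmod c * r \<le> s\<rbrakk> \<Longrightarrow> scl V c x \<in> norm_ball V s"
  using mult_left_mono[of "nrm V x" r "cmod c"]
  by (auto simp: norm_ball_def carr_closed p_scale)

lemma normalize_in_norm_ball:
  "\<lbrakk>x \<in> carr V; nrm V x \<le> r; 0 < r\<rbrakk> \<Longrightarrow> scl V (complex_of_real (inverse r)) x \<in> norm_ball V 1"
  by (rule scale_in_norm_ball[of _ r]) (auto simp: norm_ball_def norm_inverse)

lemma complex_normed_space_subspace:
  assumes "subspace S" "S \<subseteq> carr V"
  shows "complex_normed_space (V\<lparr>carr := S\<rparr>)"
  using normed assms by (simp add: complex_normed_space_def subset_iff)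

lemma dual_bdd_above:
  assumes "f \<in> carr (dual_space V)"
  shows "bdd_above ((\<lambda>x. cmod (f x)) ` {x \<in> carr V. nrm V x \<le> 1})"
proof -
  obtain K where K: "\<And>x. x \<in> carr V \<Longrightarrow> cmod (f x) \<le> K * nrm V x"
    using assms by (simp add: dual_space_def) blast
  have "cmod (f x) \<le> \<bar>K\<bar>" if "x \<in> carr V" "nrm V x \<le> 1" for x
  proof -
    have "cmod (f x) \<le> \<bar>K\<bar> * nrm V x"
      using K[OF that(1)] mult_right_mono[OF abs_ge_self[of K] p_nonneg[OF that(1)]] by linarith
    also have "\<dots> \<le> \<bar>K\<bar>" using that(2) by (simp add: mult_left_le)
    finally show ?thesis .
  qed
  then show ?thesis by (intro bdd_aboveI2[where M = "\<bar>K\<bar>"]) auto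
qed

lemma dual_add: "\<lbrakk>f \<in> carr (dual_space V); x \<in> carr V; y \<in> carr V\<rbrakk> \<Longrightarrow> f (x + y) = f x + f y"
  and dual_scale: "\<lbrakk>f \<in> carr (dual_space V); x \<in> carr V\<rbrakk> \<Longrightarrow> f (scl V c x) = c * f x"
  and dual_outside: "\<lbrakk>f \<in> carr (dual_space V); x \<notin> carr V\<rbrakk> \<Longrightarrow> f x = 0"
  by (simp_all add: dual_space_def)

lemma dual_diff: "\<lbrakk>f \<in> carr (dual_space V); x \<in> carr V; y \<in> carr V\<rbrakk> \<Longrightarrow> f (x - y) = f x - f y"
  using dual_add[of f "x - y" y] by (simp add: carr_closed)

lemma dual_zero: "f \<in> carr (dual_space V) \<Longrightarrow> f 0 = 0"
  using dual_diff[of f 0 0] by (simp add: carr_closed)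

lemma dual_unit_le:
  assumes "f \<in> carr (dual_space V)" "x \<in> carr V" "nrm V x \<le> 1"
  shows "cmod (f x) \<le> nrm (dual_space V) f"
  using cSUP_upper[OF _ dual_bdd_above[OF assms(1)], of x] assms(2,3) by (simp add: dual_space_def)

lemma dual_nrm_nonneg: "f \<in> carr (dual_space V) \<Longrightarrow> 0 \<le> nrm (dual_space V) f"
  using dual_unit_le[of f 0] by (simp add: carr_closed p_zero dual_zero)

lemma dual_apply_le:
  assumes f: "f \<in> carr (dual_space V)" and x: "x \<in> carr V"
  shows "cmod (f x) \<le> nrm (dual_space V) f * nrm V x"
proof (cases "x = 0")
  case True
  then show ?thesis using f by (simp add: p_zero dual_zero)
next
  case False
  then have pos: "0 < nrm V x" using p_nonneg[OF x] nrm_eq_0_iff[OF x] by simp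
  have "cmod (f (scl V (complex_of_real (inverse (nrm V x))) x)) \<le> nrm (dual_space V) f"
    using normalize_in_norm_ball[OF x order_refl pos] by (intro dual_unit_le f) (auto dest: norm_ballD)
  then show ?thesis using f x pos by (simp add: dual_scale norm_mult norm_inverse norm_divide field_simps)
qed

lemma dual_nrm_le:
  assumes "\<And>x. \<lbrakk>x \<in> carr V; nrm V x \<le> 1\<rbrakk> \<Longrightarrow> cmod (f x) \<le> K"
  shows "nrm (dual_space V) f \<le> K"
proof -
  have "0 \<in> {x \<in> carr V. nrm V x \<le> 1}" by (simp add: carr_closed p_zero)
  then show ?thesis using assms by (simp add: dual_space_def) (intro cSUP_least, auto)
qed

lemma dual_memI:
  assumes "\<And>x y. \<lbrakk>x \<in> carr V; y \<in> carr V\<rbrakk> \<Longrightarrow> f (x + y) = f x + f y"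
    and "\<And>c x. x \<in> carr V \<Longrightarrow> f (scl V c x) = c * f x"
    and "\<And>x. x \<in> carr V \<Longrightarrow> cmod (f x) \<le> K * nrm V x"
    and "\<And>x. x \<notin> carr V \<Longrightarrow> f x = 0"
  shows "f \<in> carr (dual_space V)"
  using assms by (simp add: dual_space_def) blast

lemma complex_normed_space_dual: "complex_normed_space (dual_space V)"
  unfolding complex_normed_space_def
proof (intro conjI ballI allI)
  have scl: "scl (dual_space V) = (\<lambda>c f x. c * f x)" by (simp add: dual_space_def)
  show vs: "vector_space (scl (dual_space V))"
    unfolding scl by unfold_locales (auto simp: fun_eq_iff algebra_simps)
  have sumle: "cmod (a + b) \<le> (K + L) * s" if "cmod a \<le> K * s" "cmod b \<le> L * s" for a b K L s
    using norm_triangle_ineq[of a b] that by (simp add: distrib_right)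
  have addc: "f + g \<in> carr (dual_space V)"
    if f: "f \<in> carr (dual_space V)" and g: "g \<in> carr (dual_space V)" for f g
  proof (rule dual_memI[where K = "nrm (dual_space V) f + nrm (dual_space V) g"])
    show "cmod ((f + g) x) \<le> (nrm (dual_space V) f + nrm (dual_space V) g) * nrm V x"
      if "x \<in> carr V" for x
      using dual_apply_le[OF f that] dual_apply_le[OF g that] by (simp add: sumle)
  qed (use f g in \<open>simp_all add: dual_add dual_scale dual_outside algebra_simps\<close>)
  have sclc: "scl (dual_space V) c f \<in> carr (dual_space V)" if f: "f \<in> carr (dual_space V)" for c f
  proof (rule dual_memI[where K = "cmod c * nrm (dual_space V) f"])
    show "cmod (scl (dual_space V) c f x) \<le> cmod c * nrm (dual_space V) f * nrm V x"
      if "x \<in> carr V" for x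
      using dual_apply_le[OF f that] by (simp add: scl norm_mult mult.assoc mult_left_mono)
  qed (use f in \<open>simp_all add: scl dual_add dual_scale dual_outside algebra_simps\<close>)
  have zero: "0 \<in> carr (dual_space V)" by (rule dual_memI[where K = 0]) auto
  show "module.subspace (scl (dual_space V)) (carr (dual_space V))"
    using addc sclc zero by (simp add: module.subspace_def[OF vs[folded module_iff_vector_space]])
  fix f assume f: "f \<in> carr (dual_space V)"
  show "0 \<le> nrm (dual_space V) f" by (rule dual_nrm_nonneg[OF f])
  show "(nrm (dual_space V) f = 0) = (f = 0)"
  proof
    assume 0: "nrm (dual_space V) f = 0"
    show "f = 0"
    proof
      fix x show "f x = 0 x"
        using dual_apply_le[OF f, of x] dual_outside[OF f, of x] 0 by (cases "x \<in> carr V") auto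
    qed
  next
    assume "f = 0"
    then show "nrm (dual_space V) f = 0"
      using dual_nrm_nonneg[OF f] dual_nrm_le[of f 0] by force
  qed
  fix c
  have le: "nrm (dual_space V) (scl (dual_space V) d g) \<le> cmod d * nrm (dual_space V) g"
    if "g \<in> carr (dual_space V)" for d g
    by (rule dual_nrm_le) (auto simp: scl norm_mult that intro!: mult_left_mono dual_unit_le)
  show "nrm (dual_space V) (scl (dual_space V) c f) = cmod c * nrm (dual_space V) f"
  proof (cases "c = 0")
    case True
    then show ?thesis using le[OF f, of c] dual_nrm_nonneg[OF sclc[OF f, of c]] by simp
  next
    case False
    have "scl (dual_space V) (inverse c) (scl (dual_space V) c f) = f"
      using False by (simp add: scl fun_eq_iff)
    then have "nrm (dual_space V) f \<le> inverse (cmod c) * nrm (dual_space V) (scl (dual_space V) c f)"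
      using le[OF sclc[OF f, of c], of "inverse c"] by (simp add: norm_inverse)
    then show ?thesis using le[OF f, of c] False by (simp add: field_simps)
  qed
  fix g assume g: "g \<in> carr (dual_space V)"
  show "nrm (dual_space V) (f + g) \<le> nrm (dual_space V) f + nrm (dual_space V) g"
  proof (rule dual_nrm_le)
    fix x assume "x \<in> carr V" "nrm V x \<le> 1"
    then show "cmod ((f + g) x) \<le> nrm (dual_space V) f + nrm (dual_space V) g"
      using dual_unit_le[OF f, of x] dual_unit_le[OF g, of x] norm_triangle_ineq[of "f x" "g x"]
      by simp
  qed
qed

lemma complex_banach_space_dual: "complex_banach_space (dual_space V)"
  unfolding complex_banach_space_def
proof (intro conjI complex_normed_space_dual allI impI)
  interpret D: normed_carrier "dual_space V" by (intro normed_carrier.intro complex_normed_space_dual)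
  fix X :: "nat \<Rightarrow> 'e \<Rightarrow> complex"
  assume X: "range X \<subseteq> carr (dual_space V)"
    and C: "\<forall>e>0. \<exists>N. \<forall>i\<ge>N. \<forall>j\<ge>N. nrm (dual_space V) (X i - X j) < e"
  have Xi: "X i \<in> carr (dual_space V)" for i using X by auto
  have diff: "cmod (X i x - X j x) \<le> nrm (dual_space V) (X i - X j) * nrm V x"
    if "x \<in> carr V" for i j x
    using dual_apply_le[OF D.carr_closed(2)[OF Xi Xi] that, of i j] by simp
  have ev: "\<exists>N. \<forall>i\<ge>N. \<forall>j\<ge>N. \<forall>x\<in>carr V. cmod (X i x - X j x) \<le> e * nrm V x" if e: "e > 0" for e
  proof -
    obtain N where "\<forall>i\<ge>N. \<forall>j\<ge>N. nrm (dual_space V) (X i - X j) < e" using C e by blast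
    then have "cmod (X i x - X j x) \<le> e * nrm V x" if "i \<ge> N" "j \<ge> N" "x \<in> carr V" for i j x
      using diff[OF that(3), of i j] that
        mult_right_mono[OF less_imp_le p_nonneg[OF that(3)], of "nrm (dual_space V) (X i - X j)" e]
      by fastforce
    then show ?thesis by blast
  qed
  have "Cauchy (\<lambda>n. X n x)" if x: "x \<in> carr V" for x
  proof (rule metric_CauchyI)
    fix e :: real assume e: "e > 0"
    have pos: "0 < nrm V x + 1" using p_nonneg[OF x] by simp
    obtain N where N: "\<And>i j. i \<ge> N \<Longrightarrow> j \<ge> N \<Longrightarrow> cmod (X i x - X j x) \<le> e / (nrm V x + 1) * nrm V x"
      using ev[of "e / (nrm V x + 1)"] e pos x by (meson divide_pos_pos)
    have "e / (nrm V x + 1) * nrm V x < e" using e pos by (simp add: field_simps)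
    then show "\<exists>M. \<forall>m\<ge>M. \<forall>n\<ge>M. dist (X m x) (X n x) < e"
      using N unfolding dist_norm by (meson le_less_trans)
  qed
  moreover have "Cauchy (\<lambda>n. X n x)" if "x \<notin> carr V" for x
    using that Xi by (simp add: dual_outside Cauchy_def)
  ultimately have "\<exists>l. (\<lambda>n. X n x) \<longlonglongrightarrow> l" for x
    using Cauchy_convergent_iff convergent_def by metis
  then obtain f where f: "\<And>x. (\<lambda>n. X n x) \<longlonglongrightarrow> f x" by metis
  have close: "\<exists>N. \<forall>i\<ge>N. \<forall>x\<in>carr V. cmod (X i x - f x) \<le> e * nrm V x" if e: "e > 0" for e
  proof -
    obtain N where N: "\<And>i j x. i \<ge> N \<Longrightarrow> j \<ge> N \<Longrightarrow> x \<in> carr V \<Longrightarrow> cmod (X i x - X j x) \<le> e * nrm V x"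
      using ev[OF e] by blast
    have "cmod (X i x - f x) \<le> e * nrm V x" if "i \<ge> N" "x \<in> carr V" for i x
    proof (rule tendsto_upperbound)
      show "(\<lambda>j. cmod (X i x - X j x)) \<longlonglongrightarrow> cmod (X i x - f x)" by (intro tendsto_intros f)
      show "\<forall>\<^sub>F j in sequentially. cmod (X i x - X j x) \<le> e * nrm V x"
        by (rule eventually_sequentiallyI[of N]) (use N that in auto)
    qed simp
    then show ?thesis by blast
  qed
  obtain N where N: "\<And>x. x \<in> carr V \<Longrightarrow> cmod (X N x - f x) \<le> 1 * nrm V x" using close[of 1] by auto
  have mem: "f \<in> carr (dual_space V)"
  proof (rule dual_memI[where K = "nrm (dual_space V) (X N) + 1"])
    fix x assume x: "x \<in> carr V"
    have "cmod (f x) \<le> cmod (X N x) + cmod (X N x - f x)"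
      by (metis norm_minus_commute norm_triangle_sub)
    also have "\<dots> \<le> (nrm (dual_space V) (X N) + 1) * nrm V x"
      using dual_apply_le[OF Xi x, of N] N[OF x] by (simp add: algebra_simps)
    finally show "cmod (f x) \<le> (nrm (dual_space V) (X N) + 1) * nrm V x" .
    show "f (scl V c x) = c * f x" for c
      using LIMSEQ_unique[OF f[of "scl V c x"]] tendsto_mult_left[OF f[of x], of c] Xi x
      by (simp add: dual_scale)
    fix y assume y: "y \<in> carr V"
    show "f (x + y) = f x + f y"
      using LIMSEQ_unique[OF f[of "x + y"]] tendsto_add[OF f[of x] f[of y]] Xi x y
      by (simp add: dual_add)
  next
    fix x assume "x \<notin> carr V"
    then have "(\<lambda>n. X n x) = (\<lambda>n. 0)" using Xi by (simp add: dual_outside)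
    then show "f x = 0" using f[of x] by (simp add: LIMSEQ_const_iff)
  qed
  have "(\<lambda>k. nrm (dual_space V) (X k - f)) \<longlonglongrightarrow> 0"
  proof (rule metric_LIMSEQ_I)
    fix e :: real assume e: "e > 0"
    obtain N where N: "\<And>i x. i \<ge> N \<Longrightarrow> x \<in> carr V \<Longrightarrow> cmod (X i x - f x) \<le> e / 2 * nrm V x"
      using close[of "e / 2"] e by auto
    have "nrm (dual_space V) (X i - f) \<le> e / 2" if "i \<ge> N" for i
    proof (rule dual_nrm_le)
      fix x assume "x \<in> carr V" "nrm V x \<le> 1"
      then have "cmod (X i x - f x) \<le> e / 2 * nrm V x" "e / 2 * nrm V x \<le> e / 2 * 1"
        using N[OF that, of x] e by (simp_all only: mult_left_mono half_gt_zero less_imp_le)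
      then show "cmod ((X i - f) x) \<le> e / 2" by simp
    qed
    then have "dist (nrm (dual_space V) (X i - f)) 0 < e" if "i \<ge> N" for i
      using that e dual_nrm_nonneg[OF D.carr_closed(2)[OF Xi mem], of i] by fastforce
    then show "\<exists>N. \<forall>i\<ge>N. dist (nrm (dual_space V) (X i - f)) 0 < e" by blast
  qed
  then show "\<exists>f\<in>carr (dual_space V). (\<lambda>k. nrm (dual_space V) (X k - f)) \<longlonglongrightarrow> 0" using mem by blast
qed

lemma dual_norming:
  assumes "e \<in> carr V"
  obtains h where "h \<in> norm_ball (dual_space V) 1" "h e = complex_of_real (nrm V e)"
proof (rule Hahn_Banach[OF assms])
  fix h
  assume h: "\<And>x y. \<lbrakk>x \<in> carr V; y \<in> carr V\<rbrakk> \<Longrightarrow> h (x + y) = h x + h y"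
    "\<And>c x. x \<in> carr V \<Longrightarrow> h (scl V c x) = c * h x"
    "\<And>x. x \<in> carr V \<Longrightarrow> cmod (h x) \<le> nrm V x"
    "\<And>x. x \<notin> carr V \<Longrightarrow> h x = 0" "h e = complex_of_real (nrm V e)"
  have "h \<in> carr (dual_space V)" by (rule dual_memI[where K = 1]) (use h in auto)
  moreover have "nrm (dual_space V) h \<le> 1" by (rule dual_nrm_le) (use h(3) in force)
  ultimately show ?thesis using h(5) by (intro that norm_ballI)
qed

end

lemma continuous_on_coordinate: "continuous_on S (\<lambda>p. p i)"
  by (rule continuous_on_product_then_coordinatewise[OF continuous_on_id])

lemma Hausdorff_space_fun: "Hausdorff_space (euclidean :: ('i \<Rightarrow> 'b::metric_space) topology)"
proof -
  have "Hausdorff_space (product_topology (\<lambda>_ :: 'i. euclidean :: 'b topology) UNIV)"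
    by (simp add: Hausdorff_space_product_topology)
  then show ?thesis by (simp only: euclidean_product_topology)
qed

lemma compact_imp_closed_fun:
  fixes K :: "('i \<Rightarrow> 'b::metric_space) set"
  assumes "compact K"
  shows "closed K"
  using compactin_imp_closedin[OF Hausdorff_space_fun, of K] assms by simp

lemma continuous_on_inv_fun:
  fixes f :: "'a::topological_space \<Rightarrow> 'i \<Rightarrow> 'b::metric_space"
  assumes f: "continuous_on S f" and S: "compact S" and g: "\<And>x. x \<in> S \<Longrightarrow> g (f x) = x"
  shows "continuous_on (f ` S) g"
  unfolding continuous_on_closed_invariant
proof (intro allI impI)
  fix B :: "'a set" assume B: "closed B"
  have "compact (f ` (S \<inter> B))"
    using f by (intro compact_continuous_image compact_Int_closed S B) (auto intro: continuous_on_subset)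
  moreover have "f ` (S \<inter> B) \<inter> f ` S = g -` B \<inter> f ` S" using g by auto
  ultimately show "\<exists>A. closed A \<and> A \<inter> f ` S = g -` B \<inter> f ` S"
    using compact_imp_closed_fun by blast
qed

lemma compact_PiE_UNIV:
  fixes K :: "'i \<Rightarrow> 'b::topological_space set"
  assumes "\<And>i. compact (K i)"
  shows "compact {f. \<forall>i. f i \<in> K i}"
proof -
  have "compactin (product_topology (\<lambda>i. euclidean) UNIV) (Pi\<^sub>E UNIV K)"
    using assms by (simp add: compactin_PiE)
  then show ?thesis
    by (simp add: euclidean_product_topology PiE_def Pi_def)
qed

theorem Banach_Alaoglu:
  assumes "complex_normed_space V"
  shows "compact (norm_ball (dual_space V) 1)"
proof -
  interpret normed_carrier V by (rule normed_carrier.intro[OF assms])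
  define P where "P = {f. \<forall>x. f x \<in> (if x \<in> carr V then cball 0 (nrm V x) else {0 :: complex})}"
  define L where "L = {f :: 'a \<Rightarrow> complex. \<forall>x y. x \<in> carr V \<longrightarrow> y \<in> carr V \<longrightarrow> f (x + y) = f x + f y}"
  define S where "S = {f. \<forall>c x. x \<in> carr V \<longrightarrow> f (scl V c x) = c * f x}"
  have "compact P" unfolding P_def by (intro compact_PiE_UNIV) auto
  moreover have "closed L" unfolding L_def
    by (intro closed_Collect_all closed_Collect_imp closed_Collect_eq continuous_intros
        continuous_on_coordinate) auto
  moreover have "closed S" unfolding S_def
    by (intro closed_Collect_all closed_Collect_imp closed_Collect_eq continuous_intros
        continuous_on_coordinate) auto
  ultimately have "compact (P \<inter> (L \<inter> S))" by (intro compact_Int_closed closed_Int)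
  moreover have "norm_ball (dual_space V) 1 = P \<inter> (L \<inter> S)"
  proof (intro equalityI subsetI)
    fix f assume f: "f \<in> norm_ball (dual_space V) 1"
    have "cmod (f x) \<le> nrm V x" if "x \<in> carr V" for x
    proof -
      have "cmod (f x) \<le> nrm (dual_space V) f * nrm V x" by (rule dual_apply_le[OF norm_ballD(1)[OF f] that])
      also have "\<dots> \<le> 1 * nrm V x" by (intro mult_right_mono norm_ballD(2)[OF f] p_nonneg[OF that])
      finally show ?thesis by simp
    qed
    then show "f \<in> P \<inter> (L \<inter> S)"
      using norm_ballD(1)[OF f] by (auto simp: P_def L_def S_def dual_add dual_scale dual_outside)
  next
    fix f assume f: "f \<in> P \<inter> (L \<inter> S)"
    have le: "cmod (f x) \<le> 1 * nrm V x" if "x \<in> carr V" for x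
      using f that unfolding P_def by (auto dest: spec[of _ x])
    have out: "f x = 0" if "x \<notin> carr V" for x
      using f that unfolding P_def by (auto dest: spec[of _ x])
    have "f \<in> carr (dual_space V)"
      by (rule dual_memI[OF _ _ le out]) (use f in \<open>auto simp: L_def S_def\<close>)
    moreover have "nrm (dual_space V) f \<le> 1" by (rule dual_nrm_le) (use le in force)
    ultimately show "f \<in> norm_ball (dual_space V) 1" by (rule norm_ballI)
  qed
  ultimately show ?thesis by simp
qed

section \<open>Compact embeddings and the Dixmier-Ng theorem\<close>

text \<open>A compact embedding records a topology on the bounded subsets of \<open>V\<close>, the one pulled back from
  the product topology. Each predual \<open>E\<close> of \<open>V\<close> provides one whose coordinates are indexed by \<open>E\<close>.\<close>

definition compact_embedding :: "'x::ab_group_add cnormed \<Rightarrow> ('x \<Rightarrow> 'i \<Rightarrow> complex) \<Rightarrow> bool" where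
  "compact_embedding V \<kappa> \<longleftrightarrow>
    (\<forall>x\<in>carr V. \<forall>y\<in>carr V. \<kappa> (x + y) = \<kappa> x + \<kappa> y) \<and>
    (\<forall>c. \<forall>x\<in>carr V. \<forall>i. \<kappa> (scl V c x) i = c * \<kappa> x i) \<and>
    inj_on \<kappa> (carr V) \<and> compact (\<kappa> ` norm_ball V 1)"

text \<open>Continuity on the ball of radius \<open>r\<close> for the topology of the embedding \<open>\<kappa>\<close>, expressed on the
  image of the ball so that \<open>V\<close> itself need not carry a topology.\<close>

definition factors_through ::
    "'x cnormed \<Rightarrow> ('x \<Rightarrow> 'i \<Rightarrow> complex) \<Rightarrow> real \<Rightarrow> ('x \<Rightarrow> 'b::topological_space) \<Rightarrow> bool" where
  "factors_through V \<kappa> r \<phi> \<longleftrightarrow>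
    (\<exists>g. continuous_on (\<kappa> ` norm_ball V r) g \<and> (\<forall>x\<in>norm_ball V r. \<phi> x = g (\<kappa> x)))"

lemma factors_throughI:
  "\<lbrakk>continuous_on (\<kappa> ` norm_ball V r) g; \<And>x. x \<in> norm_ball V r \<Longrightarrow> \<phi> x = g (\<kappa> x)\<rbrakk>
    \<Longrightarrow> factors_through V \<kappa> r \<phi>"
  unfolding factors_through_def by blast

lemma factors_throughE:
  assumes "factors_through V \<kappa> r \<phi>"
  obtains g where "continuous_on (\<kappa> ` norm_ball V r) g" "\<And>x. x \<in> norm_ball V r \<Longrightarrow> \<phi> x = g (\<kappa> x)"
  using assms unfolding factors_through_def by blast

text \<open>Continuity is required on the unit ball only. This makes the space of functionals closed under
  norm limits, and it is what the Krein-Smulian theorem would characterise as weak-star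
  continuity.\<close>

definition embedding_predual ::
    "'x::ab_group_add cnormed \<Rightarrow> ('x \<Rightarrow> 'i \<Rightarrow> complex) \<Rightarrow> ('x \<Rightarrow> complex) cnormed" where
  "embedding_predual V \<kappa> =
    (dual_space V)\<lparr>carr := {\<phi> \<in> carr (dual_space V). factors_through V \<kappa> 1 \<phi>}\<rparr>"

lemma sum_fun_apply: "(sum f A) x = (\<Sum>i\<in>A. f i x)"
  by (induction A rule: infinite_finite_induct) auto

lemma (in normed_carrier) lin_comb_mem:
  assumes "\<And>i. i \<in> S \<Longrightarrow> x i \<in> carr V"
  shows "(\<Sum>i\<in>S. scl V (c i) (x i)) \<in> carr V"
  using assms by (induction S rule: infinite_finite_induct) (auto simp: carr_closed)

lemma (in normed_carrier) dual_lin_comb: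
  assumes f: "f \<in> carr (dual_space V)" and "\<And>i. i \<in> S \<Longrightarrow> x i \<in> carr V"
  shows "f (\<Sum>i\<in>S. scl V (c i) (x i)) = (\<Sum>i\<in>S. c i * f (x i))"
  using assms(2)
proof (induction S rule: infinite_finite_induct)
  case (insert i S)
  then have "(\<Sum>i\<in>S. scl V (c i) (x i)) \<in> carr V" by (intro lin_comb_mem) auto
  then show ?case using insert by (simp add: dual_add[OF f] dual_scale[OF f] carr_closed)
qed (simp_all add: dual_zero[OF f])

locale compact_embedded = normed_carrier V for V :: "'x::ab_group_add cnormed" +
  fixes \<kappa> :: "'x \<Rightarrow> 'i \<Rightarrow> complex"
  assumes embedding: "compact_embedding V \<kappa>"
begin

lemma emb_add: "\<lbrakk>x \<in> carr V; y \<in> carr V\<rbrakk> \<Longrightarrow> \<kappa> (x + y) = \<kappa> x + \<kappa> y"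
  and emb_scale: "x \<in> carr V \<Longrightarrow> \<kappa> (scl V c x) i = c * \<kappa> x i"
  and emb_inj: "inj_on \<kappa> (carr V)"
  and compact_unit_ball: "compact (\<kappa> ` norm_ball V 1)"
  using embedding unfolding compact_embedding_def by blast+

lemma emb_zero: "\<kappa> 0 = 0"
  using emb_scale[of 0 0] by (simp add: carr_closed fun_eq_iff)

lemma compact_norm_ball: assumes r: "0 \<le> r" shows "compact (\<kappa> ` norm_ball V r)"
proof (cases "r = 0")
  case True
  have "norm_ball V 0 = {0}"
  proof (intro equalityI subsetI)
    fix x assume x: "x \<in> norm_ball V 0"
    then have "nrm V x = 0" using p_nonneg by (fastforce simp: norm_ball_def)
    then show "x \<in> {0}" using x nrm_eq_0_iff by (auto dest: norm_ballD)
  qed (auto intro: zero_in_norm_ball)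
  then show ?thesis using True by simp
next
  case False
  then have pos: "r > 0" using r by simp
  have "norm_ball V r = scl V (complex_of_real r) ` norm_ball V 1"
  proof (intro equalityI subsetI)
    fix x assume x: "x \<in> norm_ball V r"
    have "scl V (complex_of_real (inverse r)) x \<in> norm_ball V 1"
      using normalize_in_norm_ball[OF norm_ballD[OF x] pos] .
    moreover have "x = scl V (complex_of_real r) (scl V (complex_of_real (inverse r)) x)"
      using pos by (simp flip: of_real_mult)
    ultimately show "x \<in> scl V (complex_of_real r) ` norm_ball V 1" by blast
  qed (use r in \<open>auto intro: scale_in_norm_ball\<close>)
  then have "\<kappa> ` norm_ball V r = (\<lambda>x. \<kappa> (scl V (complex_of_real r) x)) ` norm_ball V 1"
    by (metis image_image)
  also have "\<dots> = (\<lambda>p i. complex_of_real r * p i) ` \<kappa> ` norm_ball V 1"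
    unfolding image_image
    by (rule image_cong[OF refl], rule ext, rule emb_scale, erule norm_ballD(1))
  also have "compact \<dots>"
    by (intro compact_continuous_image compact_unit_ball continuous_on_coordinatewise_then_product
        continuous_intros continuous_on_coordinate)
  finally show ?thesis .
qed

abbreviation "E0 \<equiv> embedding_predual V \<kappa>"

lemma predual_mem_iff: "\<phi> \<in> carr E0 \<longleftrightarrow> \<phi> \<in> carr (dual_space V) \<and> factors_through V \<kappa> 1 \<phi>"
  and predual_scl: "scl E0 = scl (dual_space V)"
  and predual_nrm: "nrm E0 = nrm (dual_space V)"
  by (simp_all add: embedding_predual_def)

lemma scl_dual_apply: "scl (dual_space V) c f x = c * f x"
  by (simp add: dual_space_def)

sublocale D: normed_carrier "dual_space V"
  by (rule normed_carrier.intro[OF complex_normed_space_dual])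

sublocale P: normed_carrier E0
proof (rule normed_carrier.intro)
  have "D.subspace {\<phi> \<in> carr (dual_space V). factors_through V \<kappa> 1 \<phi>}"
    unfolding D.subspace_def
  proof (intro conjI allI ballI)
    show "0 \<in> {\<phi> \<in> carr (dual_space V). factors_through V \<kappa> 1 \<phi>}"
      by (auto simp: D.carr_closed intro!: factors_throughI[where g = "\<lambda>_. 0"])
  next
    fix f g assume "f \<in> {\<phi> \<in> carr (dual_space V). factors_through V \<kappa> 1 \<phi>}"
      "g \<in> {\<phi> \<in> carr (dual_space V). factors_through V \<kappa> 1 \<phi>}"
    then have fg: "f \<in> carr (dual_space V)" "g \<in> carr (dual_space V)"
      "factors_through V \<kappa> 1 f" "factors_through V \<kappa> 1 g" by auto
    obtain f' where f': "continuous_on (\<kappa> ` norm_ball V 1) f'" "\<And>x. x \<in> norm_ball V 1 \<Longrightarrow> f x = f' (\<kappa> x)"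
      using fg(3) by (rule factors_throughE) (rule that)
    obtain g' where g': "continuous_on (\<kappa> ` norm_ball V 1) g'" "\<And>x. x \<in> norm_ball V 1 \<Longrightarrow> g x = g' (\<kappa> x)"
      using fg(4) by (rule factors_throughE) (rule that)
    have "factors_through V \<kappa> 1 (f + g)"
      by (intro factors_throughI[where g = "\<lambda>p. f' p + g' p"] continuous_intros f' g') (simp add: f' g')
    then show "f + g \<in> {\<phi> \<in> carr (dual_space V). factors_through V \<kappa> 1 \<phi>}"
      using fg by (simp add: D.carr_closed)
  next
    fix c f assume "f \<in> {\<phi> \<in> carr (dual_space V). factors_through V \<kappa> 1 \<phi>}"
    then have f: "f \<in> carr (dual_space V)" "factors_through V \<kappa> 1 f" by auto
    obtain f' where f': "continuous_on (\<kappa> ` norm_ball V 1) f'" "\<And>x. x \<in> norm_ball V 1 \<Longrightarrow> f x = f' (\<kappa> x)"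
      using f(2) by (rule factors_throughE) (rule that)
    have "factors_through V \<kappa> 1 (scl (dual_space V) c f)"
      by (intro factors_throughI[where g = "\<lambda>p. c * f' p"] continuous_intros f')
        (simp add: scl_dual_apply f')
    then show "scl (dual_space V) c f \<in> {\<phi> \<in> carr (dual_space V). factors_through V \<kappa> 1 \<phi>}"
      using f by (simp add: D.carr_closed)
  qed
  then show "complex_normed_space E0"
    unfolding embedding_predual_def by (intro D.complex_normed_space_subspace) auto
qed

lemma factors_through_inv:
  assumes "factors_through V \<kappa> 1 \<phi>"
  shows "continuous_on (\<kappa> ` norm_ball V 1) (\<lambda>p. \<phi> (inv_into (carr V) \<kappa> p))"
proof -
  obtain g where "continuous_on (\<kappa> ` norm_ball V 1) g" and g: "\<And>x. x \<in> norm_ball V 1 \<Longrightarrow> \<phi> x = g (\<kappa> x)"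
    using assms by (rule factors_throughE) blast
  moreover have "\<phi> (inv_into (carr V) \<kappa> p) = g p" if "p \<in> \<kappa> ` norm_ball V 1" for p
    using that g by (auto simp: norm_ball_def inv_into_f_f[OF emb_inj])
  ultimately show ?thesis by (metis (no_types, lifting) continuous_on_cong)
qed

lemma complex_banach_space_predual: "complex_banach_space E0"
  unfolding complex_banach_space_def
proof (intro conjI P.normed allI impI)
  fix X :: "nat \<Rightarrow> 'x \<Rightarrow> complex"
  assume X: "range X \<subseteq> carr E0" and C: "\<forall>e>0. \<exists>N. \<forall>i\<ge>N. \<forall>j\<ge>N. nrm E0 (X i - X j) < e"
  have XD: "X i \<in> carr (dual_space V)" and Xf: "factors_through V \<kappa> 1 (X i)" for i
    using range_subsetD[OF X, of i] by (simp_all add: predual_mem_iff)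
  obtain \<phi> where \<phi>: "\<phi> \<in> carr (dual_space V)" and lim: "(\<lambda>k. nrm (dual_space V) (X k - \<phi>)) \<longlonglongrightarrow> 0"
    using complex_banach_space_dual C XD
    unfolding complex_banach_space_def predual_nrm by (metis image_subset_iff)
  have "uniform_limit (\<kappa> ` norm_ball V 1) (\<lambda>k p. X k (inv_into (carr V) \<kappa> p))
      (\<lambda>p. \<phi> (inv_into (carr V) \<kappa> p)) sequentially"
  proof (rule uniform_limitI)
    fix e :: real assume "e > 0"
    then have "\<forall>\<^sub>F k in sequentially. nrm (dual_space V) (X k - \<phi>) < e"
      using order_tendstoD(2)[OF lim] by simp
    then show "\<forall>\<^sub>F k in sequentially. \<forall>p\<in>\<kappa> ` norm_ball V 1.
        dist (X k (inv_into (carr V) \<kappa> p)) (\<phi> (inv_into (carr V) \<kappa> p)) < e"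
    proof (rule eventually_mono, intro ballI)
      fix k p assume k: "nrm (dual_space V) (X k - \<phi>) < e" and "p \<in> \<kappa> ` norm_ball V 1"
      then obtain x where x: "x \<in> norm_ball V 1" "p = \<kappa> x" by blast
      have "cmod ((X k - \<phi>) x) \<le> nrm (dual_space V) (X k - \<phi>)"
        using x XD \<phi> by (intro dual_unit_le D.carr_closed) (auto dest: norm_ballD)
      then show "dist (X k (inv_into (carr V) \<kappa> p)) (\<phi> (inv_into (carr V) \<kappa> p)) < e"
        using k x by (simp add: norm_ball_def inv_into_f_f[OF emb_inj] dist_norm)
    qed
  qed
  then have "continuous_on (\<kappa> ` norm_ball V 1) (\<lambda>p. \<phi> (inv_into (carr V) \<kappa> p))"
    by (rule uniform_limit_theorem[rotated, OF _ trivial_limit_sequentially])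
      (intro always_eventually allI factors_through_inv Xf)
  then have "factors_through V \<kappa> 1 \<phi>"
    by (rule factors_throughI) (simp add: norm_ball_def inv_into_f_f[OF emb_inj])
  then show "\<exists>\<phi>\<in>carr E0. (\<lambda>k. nrm E0 (X k - \<phi>)) \<longlonglongrightarrow> 0"
    using \<phi> lim unfolding predual_nrm by (auto simp: predual_mem_iff)
qed

lemma coordinate_in_predual: "(\<lambda>x. if x \<in> carr V then \<kappa> x i else 0) \<in> carr E0"
proof -
  have "compact ((\<lambda>p. p i) ` \<kappa> ` norm_ball V 1)"
    by (intro compact_continuous_image compact_unit_ball continuous_on_coordinate)
  then have "bounded ((\<lambda>p. p i) ` \<kappa> ` norm_ball V 1)" by (rule compact_imp_bounded)
  then obtain K where K: "\<And>x. x \<in> norm_ball V 1 \<Longrightarrow> cmod (\<kappa> x i) \<le> K"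
    unfolding bounded_iff by auto
  have "(\<lambda>x. if x \<in> carr V then \<kappa> x i else 0) \<in> carr (dual_space V)"
  proof (rule dual_memI[where K = K])
    fix x assume x: "x \<in> carr V"
    show "cmod (if x \<in> carr V then \<kappa> x i else 0) \<le> K * nrm V x"
    proof (cases "x = 0")
      case True
      then show ?thesis by (simp add: emb_zero p_zero)
    next
      case False
      then have pos: "nrm V x > 0" using p_nonneg[OF x] nrm_eq_0_iff[OF x] by simp
      show ?thesis
        using K[OF normalize_in_norm_ball[OF x order_refl pos]] x pos
        by (simp add: emb_scale norm_mult norm_inverse norm_divide field_simps)
    qed
  qed (auto simp: emb_add emb_scale carr_closed)
  moreover have "factors_through V \<kappa> 1 (\<lambda>x. if x \<in> carr V then \<kappa> x i else 0)"
    by (rule factors_throughI[OF continuous_on_coordinate]) (simp add: norm_ball_def)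
  ultimately show ?thesis by (simp add: predual_mem_iff)
qed

text \<open>A form of Helly's theorem. Minimise \<open>\<Sum> \<bar>F \<phi> - \<phi> x\<bar>\<^sup>2\<close> over the compact unit ball and let \<open>x\<^sub>0\<close> be
  a minimiser. Let \<open>\<psi>\<close> be the linear combination of \<open>\<Phi>\<close> whose coefficients are the conjugates of the
  residuals \<open>F \<phi> - \<phi> x\<^sub>0\<close>. Moving from \<open>x\<^sub>0\<close> towards another point of the ball does not
  decrease the sum, which says that \<open>Re \<psi>\<close> is maximal at \<open>x\<^sub>0\<close>; thus \<open>Re (\<psi> x\<^sub>0)\<close> bounds the norm
  of \<open>\<psi>\<close>. But \<open>Re (F \<psi>)\<close>, which is at most this norm, exceeds \<open>Re (\<psi> x\<^sub>0)\<close> by exactly the minimal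
  sum, so the residuals vanish.\<close>

lemma finite_interpolation:
  assumes F: "F \<in> norm_ball (dual_space E0) 1" and fin: "finite \<Phi>" and \<Phi>: "\<Phi> \<subseteq> carr E0"
  shows "\<exists>x\<in>norm_ball V 1. \<forall>\<phi>\<in>\<Phi>. \<phi> x = F \<phi>"
proof -
  let ?K = "\<kappa> ` norm_ball V 1"
  define d where "d x = (\<Sum>\<phi>\<in>\<Phi>. (cmod (F \<phi> - \<phi> x))\<^sup>2)" for x
  have "continuous_on ?K (\<lambda>p. d (inv_into (carr V) \<kappa> p))"
    unfolding d_def using \<Phi> by (intro continuous_intros factors_through_inv) (auto simp: predual_mem_iff)
  moreover have "?K \<noteq> {}" using zero_in_norm_ball[of 1] by auto
  ultimately obtain p0 where p0: "p0 \<in> ?K"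
    "\<And>p. p \<in> ?K \<Longrightarrow> d (inv_into (carr V) \<kappa> p0) \<le> d (inv_into (carr V) \<kappa> p)"
    using continuous_attains_inf[OF compact_unit_ball] by blast
  then obtain x0 where x0: "x0 \<in> norm_ball V 1" "p0 = \<kappa> x0" by blast
  have min: "d x0 \<le> d y" if "y \<in> norm_ball V 1" for y
    using p0(2)[of "\<kappa> y"] x0 that by (simp add: norm_ball_def inv_into_f_f[OF emb_inj])
  have x0C: "x0 \<in> carr V" using x0 by (auto dest: norm_ballD)
  have \<Phi>D: "\<phi> \<in> carr (dual_space V)" if "\<phi> \<in> \<Phi>" for \<phi> using \<Phi> that by (auto simp: predual_mem_iff)
  define a where "a \<phi> = F \<phi> - \<phi> x0" for \<phi> :: "'x \<Rightarrow> complex"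
  define \<psi> where "\<psi> = (\<Sum>\<phi>\<in>\<Phi>. scl E0 (cnj (a \<phi>)) \<phi>)"
  have \<psi>E: "\<psi> \<in> carr E0" unfolding \<psi>_def using \<Phi> by (intro P.lin_comb_mem) auto
  then have \<psi>D: "\<psi> \<in> carr (dual_space V)" by (simp add: predual_mem_iff)
  have \<psi>_apply: "\<psi> y = (\<Sum>\<phi>\<in>\<Phi>. cnj (a \<phi>) * \<phi> y)" for y
    by (simp add: \<psi>_def sum_fun_apply predual_scl scl_dual_apply)
  have F\<psi>: "F \<psi> = (\<Sum>\<phi>\<in>\<Phi>. cnj (a \<phi>) * F \<phi>)"
    unfolding \<psi>_def using \<Phi> by (intro P.dual_lin_comb norm_ballD[OF F]) auto
  have max: "Re (\<psi> y) \<le> Re (\<psi> x0)" if y: "y \<in> norm_ball V 1" for y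
  proof -
    have yC: "y \<in> carr V" using y by (auto dest: norm_ballD)
    define b where "b \<phi> = \<phi> y - \<phi> x0" for \<phi> :: "'x \<Rightarrow> complex"
    define T where "T = Re (\<psi> y) - Re (\<psi> x0)"
    define B where "B = (\<Sum>\<phi>\<in>\<Phi>. (cmod (b \<phi>))\<^sup>2)"
    have T: "T = (\<Sum>\<phi>\<in>\<Phi>. Re (cnj (a \<phi>) * b \<phi>))"
      unfolding T_def \<psi>_apply b_def by (simp add: right_diff_distrib sum_subtractf)
    \<comment> \<open>\<open>- 2 T\<close> is the derivative of \<open>d\<close> at \<open>x\<^sub>0\<close> in the direction of \<open>y\<close>.\<close>
    have le: "2 * T \<le> s * B" if s: "0 < s" "s \<le> 1" for s
    proof -
      define z where "z = scl V (complex_of_real (1 - s)) x0 + scl V (complex_of_real s) y"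
      have "nrm V z \<le> (1 - s) * nrm V x0 + s * nrm V y"
        unfolding z_def using p_triangle[of "scl V (complex_of_real (1 - s)) x0" "scl V (complex_of_real s) y"] s x0C yC
        by (simp add: p_scale carr_closed flip: of_real_diff)
      also have "\<dots> \<le> (1 - s) * 1 + s * 1"
        using s norm_ballD(2)[OF x0(1)] norm_ballD(2)[OF y] by (intro add_mono mult_left_mono) auto
      finally have z: "z \<in> norm_ball V 1" using x0C yC by (simp add: norm_ball_def z_def carr_closed)
      have "\<phi> z = \<phi> x0 + complex_of_real s * b \<phi>" if "\<phi> \<in> \<Phi>" for \<phi>
      proof -
        have "\<phi> z = complex_of_real (1 - s) * \<phi> x0 + complex_of_real s * \<phi> y"
          unfolding z_def using \<Phi>D[OF that] x0C yC
          by (simp only: dual_add dual_scale carr_closed)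
        then show ?thesis by (simp add: b_def algebra_simps)
      qed
      then have "d z = (\<Sum>\<phi>\<in>\<Phi>. (cmod (a \<phi> - complex_of_real s * b \<phi>))\<^sup>2)"
        unfolding d_def a_def by (intro sum.cong refl) (simp add: algebra_simps)
      also have "\<dots> = (\<Sum>\<phi>\<in>\<Phi>. (cmod (a \<phi>))\<^sup>2 - 2 * s * Re (cnj (a \<phi>) * b \<phi>) + s\<^sup>2 * (cmod (b \<phi>))\<^sup>2)"
        unfolding cmod_power2 by (intro sum.cong refl) (simp add: power2_eq_square algebra_simps)
      also have "\<dots> = d x0 - 2 * s * T + s\<^sup>2 * B"
        unfolding T B_def d_def a_def[symmetric]
        by (simp only: sum.distrib sum_subtractf sum_distrib_left)
      finally have "s * (2 * T) \<le> s * (s * B)" using min[OF z] by (simp add: power2_eq_square algebra_simps)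
      then show ?thesis using s by simp
    qed
    have "T \<le> 0"
    proof (rule ccontr)
      assume "\<not> T \<le> 0"
      then have T0: "T > 0" by simp
      have B0: "B \<ge> 0" unfolding B_def by (intro sum_nonneg) simp
      have "2 * T \<le> min 1 (T / (B + 1)) * B" using T0 B0 by (intro le) auto
      also have "\<dots> \<le> T / (B + 1) * B" using B0 by (intro mult_right_mono) auto
      also have "\<dots> \<le> T" using T0 B0 by (simp add: field_simps)
      finally show False using T0 by simp
    qed
    then show ?thesis by (simp add: T_def)
  qed
  have "nrm E0 \<psi> \<le> Re (\<psi> x0)"
    unfolding predual_nrm
  proof (rule dual_nrm_le)
    fix y assume y: "y \<in> carr V" "nrm V y \<le> 1"
    obtain c where c: "cmod c = 1" "c * \<psi> y = complex_of_real (cmod (\<psi> y))"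
      using rotate_to_nonneg by blast
    have "cmod (\<psi> y) = Re (\<psi> (scl V c y))" using c y by (simp add: dual_scale[OF \<psi>D])
    also have "\<dots> \<le> Re (\<psi> x0)"
      using c y by (intro max scale_in_norm_ball[of _ 1]) (auto simp: norm_ball_def)
    finally show "cmod (\<psi> y) \<le> Re (\<psi> x0)" .
  qed
  moreover have "Re (F \<psi>) \<le> nrm E0 \<psi>"
  proof -
    have "cmod (F \<psi>) \<le> nrm (dual_space E0) F * nrm E0 \<psi>"
      by (rule P.dual_apply_le[OF norm_ballD(1)[OF F] \<psi>E])
    also have "\<dots> \<le> 1 * nrm E0 \<psi>" by (intro mult_right_mono norm_ballD(2)[OF F] P.p_nonneg[OF \<psi>E])
    finally show ?thesis using complex_Re_le_cmod[of "F \<psi>"] by simp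
  qed
  moreover have "Re (F \<psi>) - Re (\<psi> x0) = (\<Sum>\<phi>\<in>\<Phi>. (cmod (a \<phi>))\<^sup>2)"
  proof -
    have "Re (F \<psi>) - Re (\<psi> x0) = (\<Sum>\<phi>\<in>\<Phi>. Re (cnj (a \<phi>) * a \<phi>))"
      unfolding F\<psi> \<psi>_apply by (simp add: a_def right_diff_distrib sum_subtractf)
    also have "\<dots> = (\<Sum>\<phi>\<in>\<Phi>. (cmod (a \<phi>))\<^sup>2)"
      unfolding cmod_power2 by (intro sum.cong refl) (simp add: power2_eq_square)
    finally show ?thesis .
  qed
  ultimately have "(\<Sum>\<phi>\<in>\<Phi>. (cmod (a \<phi>))\<^sup>2) \<le> 0" by linarith
  then have "\<forall>\<phi>\<in>\<Phi>. (cmod (a \<phi>))\<^sup>2 = 0"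
    using sum_nonneg_eq_0_iff[OF fin, of "\<lambda>\<phi>. (cmod (a \<phi>))\<^sup>2"] sum_nonneg[of \<Phi> "\<lambda>\<phi>. (cmod (a \<phi>))\<^sup>2"]
    by auto
  then show ?thesis using x0(1) by (intro bexI[of _ x0]) (auto simp: a_def)
qed

text \<open>Compactness of the unit ball passes from finite sets of conditions \<open>\<phi> x = F \<phi>\<close> to all of them.\<close>

lemma predual_dual_is_evaluation:
  assumes F: "F \<in> norm_ball (dual_space E0) 1"
  shows "\<exists>x\<in>norm_ball V 1. \<forall>\<phi>\<in>carr E0. \<phi> x = F \<phi>"
proof -
  let ?K = "\<kappa> ` norm_ball V 1"
  let ?g = "\<lambda>\<phi> p. \<phi> (inv_into (carr V) \<kappa> p)"
  have "?K \<inter> (\<Inter>\<phi>\<in>carr E0. {p \<in> ?K. ?g \<phi> p = F \<phi>}) \<noteq> {}"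
  proof (rule compact_imp_fip_image[OF compact_unit_ball])
    show "closed {p \<in> ?K. ?g \<phi> p = F \<phi>}" if "\<phi> \<in> carr E0" for \<phi>
      using that by (intro continuous_closed_preimage_constant factors_through_inv
          compact_imp_closed_fun compact_unit_ball) (simp add: predual_mem_iff)
    fix \<Phi> assume "finite \<Phi>" "\<Phi> \<subseteq> carr E0"
    then obtain x where x: "x \<in> norm_ball V 1" "\<forall>\<phi>\<in>\<Phi>. \<phi> x = F \<phi>"
      using finite_interpolation[OF F] by blast
    then have "\<kappa> x \<in> ?K \<inter> (\<Inter>\<phi>\<in>\<Phi>. {p \<in> ?K. ?g \<phi> p = F \<phi>})"
      by (auto simp: norm_ball_def inv_into_f_f[OF emb_inj])
    then show "?K \<inter> (\<Inter>\<phi>\<in>\<Phi>. {p \<in> ?K. ?g \<phi> p = F \<phi>}) \<noteq> {}" by blast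
  qed
  then obtain x where "x \<in> norm_ball V 1" "\<forall>\<phi>\<in>carr E0. ?g \<phi> (\<kappa> x) = F \<phi>" by auto
  then show ?thesis by (intro bexI[of _ x]) (auto simp: norm_ball_def inv_into_f_f[OF emb_inj])
qed

end

lemma isometrically_isomorphic_sym:
  assumes V: "complex_normed_space V" and iso: "isometrically_isomorphic V W"
  shows "isometrically_isomorphic W V"
proof -
  interpret normed_carrier V by (rule normed_carrier.intro[OF V])
  obtain J where J: "bij_betw J (carr V) (carr W)"
    and add: "\<And>x y. \<lbrakk>x \<in> carr V; y \<in> carr V\<rbrakk> \<Longrightarrow> J (x + y) = J x + J y"
    and scl: "\<And>c x. x \<in> carr V \<Longrightarrow> J (scl V c x) = scl W c (J x)"
    and nrm: "\<And>x. x \<in> carr V \<Longrightarrow> nrm W (J x) = nrm V x"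
    using iso unfolding isometrically_isomorphic_def by (elim exE conjE) (rule that; blast)
  define I where "I = inv_into (carr V) J"
  have I: "I u \<in> carr V" "J (I u) = u" if "u \<in> carr W" for u
    using J that unfolding I_def by (auto simp: bij_betw_def inv_into_into f_inv_into_f)
  have IJ: "I (J x) = x" if "x \<in> carr V" for x
    using J that unfolding I_def by (simp add: bij_betw_def inv_into_f_f)
  have "bij_betw I (carr W) (carr V)" unfolding I_def by (rule bij_betw_inv_into[OF J])
  moreover have "I (u + v) = I u + I v" if "u \<in> carr W" "v \<in> carr W" for u v
    using IJ[of "I u + I v"] that by (simp add: add I carr_closed)
  moreover have "I (scl W c u) = scl V c (I u)" if "u \<in> carr W" for c u
    using IJ[of "scl V c (I u)"] that by (simp add: scl I carr_closed)
  moreover have "nrm V (I u) = nrm W u" if "u \<in> carr W" for u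
    using nrm[of "I u"] that by (simp add: I)
  ultimately show ?thesis unfolding isometrically_isomorphic_def by blast
qed

lemma isometrically_isomorphic_trans:
  assumes "isometrically_isomorphic U V" "isometrically_isomorphic V W"
  shows "isometrically_isomorphic U W"
proof -
  obtain J where J: "bij_betw J (carr U) (carr V)"
    "\<forall>x\<in>carr U. \<forall>y\<in>carr U. J (x + y) = J x + J y"
    "\<forall>c. \<forall>x\<in>carr U. J (scl U c x) = scl V c (J x)"
    "\<forall>x\<in>carr U. nrm V (J x) = nrm U x"
    using assms(1) unfolding isometrically_isomorphic_def by blast
  obtain I where I: "bij_betw I (carr V) (carr W)"
    "\<forall>x\<in>carr V. \<forall>y\<in>carr V. I (x + y) = I x + I y"
    "\<forall>c. \<forall>x\<in>carr V. I (scl V c x) = scl W c (I x)"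
    "\<forall>x\<in>carr V. nrm W (I x) = nrm V x"
    using assms(2) unfolding isometrically_isomorphic_def by blast
  have "J x \<in> carr V" if "x \<in> carr U" for x using J(1) that by (auto simp: bij_betw_def)
  then show ?thesis
    unfolding isometrically_isomorphic_def
    by (intro exI[of _ "I \<circ> J"]) (simp add: bij_betw_trans[OF J(1) I(1)] J I)
qed

context compact_embedded
begin

text \<open>Evaluation identifies \<open>V\<close> with the dual of \<open>E0\<close>. It is contractive by definition of the norm
  of \<open>E0\<close>, and since every functional of norm at most \<open>r\<close> is evaluation at a point of norm at
  most \<open>r\<close>, it is isometric and onto.\<close>

lemma predual_evaluation_isometry:
  defines "ev \<equiv> \<lambda>x \<phi>. if \<phi> \<in> carr E0 then \<phi> x else 0"
  shows "bij_betw ev (carr V) (carr (dual_space E0))"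
    and "x \<in> carr V \<Longrightarrow> nrm (dual_space E0) (ev x) = nrm V x"
proof -
  have le: "cmod (ev x \<phi>) \<le> nrm V x * nrm E0 \<phi>" if "x \<in> carr V" "\<phi> \<in> carr E0" for x \<phi>
    using dual_apply_le[of \<phi> x] that by (simp add: ev_def predual_mem_iff predual_nrm mult.commute)
  have mem: "ev x \<in> carr (dual_space E0)" if x: "x \<in> carr V" for x
    by (rule P.dual_memI[where K = "nrm V x"])
      (use x le[OF x] P.carr_closed(3)[unfolded predual_scl] in
        \<open>auto simp: ev_def P.carr_closed(1) predual_scl scl_dual_apply\<close>)
  have contr: "nrm (dual_space E0) (ev x) \<le> nrm V x" if x: "x \<in> carr V" for x
  proof (rule P.dual_nrm_le)
    fix \<phi> assume "\<phi> \<in> carr E0" "nrm E0 \<phi> \<le> 1"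
    then show "cmod (ev x \<phi>) \<le> nrm V x"
      using le[OF x, of \<phi>] mult_left_mono[of "nrm E0 \<phi>" 1 "nrm V x"] p_nonneg[OF x] by simp
  qed
  have inj: "inj_on ev (carr V)"
  proof (rule inj_onI)
    fix x y assume xy: "x \<in> carr V" "y \<in> carr V" "ev x = ev y"
    have "\<kappa> x i = \<kappa> y i" for i
      using fun_cong[OF xy(3), of "\<lambda>x. if x \<in> carr V then \<kappa> x i else 0"] xy(1,2)
        coordinate_in_predual[of i] by (simp add: ev_def)
    then show "x = y" using inj_onD[OF emb_inj _ xy(1,2)] by (simp add: fun_eq_iff)
  qed
  have ev_scale: "ev (scl V c x) = (\<lambda>\<phi>. c * ev x \<phi>)" if "x \<in> carr V" for c x
    using that by (auto simp: ev_def predual_mem_iff dual_scale)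
  have onto: "\<exists>x\<in>carr V. nrm V x \<le> r \<and> ev x = F"
    if F: "F \<in> carr (dual_space E0)" "nrm (dual_space E0) F \<le> r" and r: "r > 0" for F r
  proof -
    interpret DP: normed_carrier "dual_space E0" by (rule normed_carrier.intro[OF P.complex_normed_space_dual])
    obtain x where x: "x \<in> norm_ball V 1"
      and ev: "\<forall>\<phi>\<in>carr E0. \<phi> x = scl (dual_space E0) (complex_of_real (inverse r)) F \<phi>"
      using predual_dual_is_evaluation[OF DP.normalize_in_norm_ball[OF F r]] by blast
    have xV: "x \<in> carr V" by (rule norm_ballD(1)[OF x])
    have ev': "\<phi> x = complex_of_real (inverse r) * F \<phi>" if "\<phi> \<in> carr E0" for \<phi>
      using ev that by (simp add: dual_space_def)
    have "ev (scl V (complex_of_real r) x) \<phi> = F \<phi>" for \<phi>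
      using r ev'[of \<phi>] P.dual_outside[OF F(1), of \<phi>] by (simp add: ev_scale[OF xV]) (simp add: ev_def)
    moreover have "scl V (complex_of_real r) x \<in> norm_ball V r"
      using x r by (intro scale_in_norm_ball) auto
    ultimately show ?thesis by (intro bexI[of _ "scl V (complex_of_real r) x"]) (auto dest: norm_ballD)
  qed
  show "bij_betw ev (carr V) (carr (dual_space E0))"
    unfolding bij_betw_def
  proof (intro conjI inj equalityI subsetI)
    fix F assume F: "F \<in> carr (dual_space E0)"
    then show "F \<in> ev ` carr V"
      using onto[of F "nrm (dual_space E0) F + 1"] P.dual_nrm_nonneg[OF F] by fastforce
  qed (use mem in auto)
  show "nrm (dual_space E0) (ev x) = nrm V x" if x: "x \<in> carr V"
  proof (rule antisym[OF contr[OF x]], rule field_le_epsilon)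
    fix e :: real assume "e > 0"
    then obtain y where y: "y \<in> carr V" "nrm V y \<le> nrm (dual_space E0) (ev x) + e" "ev y = ev x"
      using onto[OF mem[OF x], of "nrm (dual_space E0) (ev x) + e"] P.dual_nrm_nonneg[OF mem[OF x]] by force
    then show "nrm V x \<le> nrm (dual_space E0) (ev x) + e" using inj_onD[OF inj y(3) y(1) x] by simp
  qed
qed

theorem Dixmier_Ng: "is_predual E0 V"
  unfolding is_predual_def
proof (intro conjI complex_banach_space_predual)
  let ?ev = "\<lambda>x \<phi>. if \<phi> \<in> carr E0 then \<phi> x else 0"
  have "isometrically_isomorphic V (dual_space E0)"
    unfolding isometrically_isomorphic_def
  proof (intro exI[of _ ?ev] conjI ballI allI)
    show "bij_betw ?ev (carr V) (carr (dual_space E0))" by (rule predual_evaluation_isometry)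
    fix x assume x: "x \<in> carr V"
    show "nrm (dual_space E0) (?ev x) = nrm V x" by (rule predual_evaluation_isometry(2)[OF x])
    show "?ev (scl V c x) = scl (dual_space E0) c (?ev x)" for c
      using x by (auto simp: fun_eq_iff dual_space_def[of E0] predual_mem_iff dual_scale)
    show "?ev (x + y) = ?ev x + ?ev y" if "y \<in> carr V" for y
      using x that by (auto simp: fun_eq_iff predual_mem_iff dual_add)
  qed
  then show "isometrically_isomorphic (dual_space E0) V"
    by (rule isometrically_isomorphic_sym[OF normed])
qed

end

section \<open>A criterion for uniqueness of the predual\<close>

text \<open>A vector outside of a complete subspace has a positive distance from it, and this distance is a
  seminorm; the Hahn-Banach theorem applied to it yields the annihilating functional.\<close>

lemma (in normed_carrier) annihilator_of_complete_subspace: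
  assumes M: "subspace M" "M \<subseteq> carr V"
    and complete: "\<And>X :: nat \<Rightarrow> 'e. \<lbrakk>range X \<subseteq> M; \<forall>e>0. \<exists>N. \<forall>i\<ge>N. \<forall>j\<ge>N. nrm V (X i - X j) < e\<rbrakk>
      \<Longrightarrow> \<exists>x\<in>M. (\<lambda>k. nrm V (X k - x)) \<longlonglongrightarrow> 0"
    and v: "v \<in> carr V" "v \<notin> M"
  shows "\<exists>h\<in>carr (dual_space V). (\<forall>m\<in>M. h m = 0) \<and> h v \<noteq> 0"
proof -
  note MC = subsetD[OF M(2)] and Ms = subspace_add[OF M(1)] subspace_scale[OF M(1)] subspace_0[OF M(1)] subspace_neg[OF M(1)]
  define q where "q x = (INF m\<in>M. nrm V (x - m))" for x
  have bdd: "bdd_below ((\<lambda>m. nrm V (x - m)) ` M)" if "x \<in> carr V" for x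
    using that MC by (intro bdd_belowI2[where m = 0] p_nonneg carr_closed)
  have ne: "M \<noteq> {}" using Ms by blast
  have q_le: "q x \<le> nrm V (x - m)" if "x \<in> carr V" "m \<in> M" for x m
    unfolding q_def by (rule cINF_lower[OF bdd[OF that(1)] that(2)])
  have q_near: "\<exists>m\<in>M. nrm V (x - m) < q x + e" if "x \<in> carr V" "e > 0" for x e
    using cINF_less_iff[OF ne bdd[OF that(1)], of "q x + e"] that(2) unfolding q_def by simp
  have q_nonneg: "0 \<le> q x" if "x \<in> carr V" for x
    unfolding q_def using that MC ne by (intro cINF_greatest p_nonneg carr_closed)
  have q_scale_le: "q (scl V c x) \<le> cmod c * q x" if x: "x \<in> carr V" for c x
  proof (rule field_le_epsilon)
    fix e :: real assume e: "e > 0"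
    define d where "d = e / (cmod c + 1)"
    have d: "d > 0" "cmod c * d \<le> e" using e by (simp_all add: d_def field_simps add_pos_nonneg)
    obtain m where m: "m \<in> M" "nrm V (x - m) < q x + d" using q_near[OF x d(1)] by blast
    have "q (scl V c x) \<le> nrm V (scl V c x - scl V c m)"
      using x m by (intro q_le carr_closed Ms)
    also have "\<dots> = cmod c * nrm V (x - m)"
      using x m MC by (simp add: p_scale carr_closed flip: scale_right_diff_distrib)
    also have "\<dots> \<le> cmod c * (q x + d)" using m by (intro mult_left_mono) auto
    also have "\<dots> \<le> cmod c * q x + e" using d by (simp add: distrib_left)
    finally show "q (scl V c x) \<le> cmod c * q x + e" .
  qed
  interpret q: complex_seminorm "scl V" "carr V" q
  proof unfold_locales
    show "subspace (carr V)" by (rule subspace_C)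
    fix x assume x: "x \<in> carr V"
    show "q (scl V c x) = cmod c * q x" for c
    proof (cases "c = 0")
      case True
      then show ?thesis using q_scale_le[OF x, of c] q_nonneg[of 0] by (simp add: carr_closed)
    next
      case False
      have "q (scl V (inverse c) (scl V c x)) \<le> cmod (inverse c) * q (scl V c x)"
        using x by (intro q_scale_le carr_closed)
      then show ?thesis using False q_scale_le[OF x, of c] by (simp add: norm_inverse norm_divide field_simps)
    qed
    fix y assume y: "y \<in> carr V"
    show "q (x + y) \<le> q x + q y"
    proof (rule field_le_epsilon)
      fix e :: real assume e: "e > 0"
      obtain m n where m: "m \<in> M" "nrm V (x - m) < q x + e/2" and n: "n \<in> M" "nrm V (y - n) < q y + e/2"
        using q_near[OF x, of "e/2"] q_near[OF y, of "e/2"] e by auto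
      have "q (x + y) \<le> nrm V (x + y - (m + n))" using x y m n by (intro q_le carr_closed Ms)
      also have "\<dots> = nrm V ((x - m) + (y - n))" by (simp add: algebra_simps)
      also have "\<dots> \<le> nrm V (x - m) + nrm V (y - n)" using x y m n MC by (intro p_triangle carr_closed)
      finally show "q (x + y) \<le> q x + q y + e" using m n by simp
    qed
  qed
  have q_pos: "q v \<noteq> 0"
  proof
    assume q0: "q v = 0"
    have "\<exists>m\<in>M. nrm V (v - m) < inverse (real (Suc n))" for n
      using q_near[OF v(1), of "inverse (real (Suc n))"] q0 by simp
    then obtain X where X: "\<And>n. X n \<in> M" "\<And>n. nrm V (v - X n) < inverse (real (Suc n))" by metis
    have lim: "(\<lambda>n. nrm V (v - X n)) \<longlonglongrightarrow> 0"
    proof (rule tendsto_sandwich[OF _ _ tendsto_const LIMSEQ_inverse_real_of_nat])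
      show "\<forall>\<^sub>F n in sequentially. 0 \<le> nrm V (v - X n)"
        by (intro always_eventually allI p_nonneg carr_closed v MC X(1))
      show "\<forall>\<^sub>F n in sequentially. nrm V (v - X n) \<le> inverse (real (Suc n))"
        by (intro always_eventually allI less_imp_le X(2))
    qed
    have "\<forall>e>0. \<exists>N. \<forall>i\<ge>N. \<forall>j\<ge>N. nrm V (X i - X j) < e"
    proof (intro allI impI)
      fix e :: real assume "e > 0"
      then have "\<forall>\<^sub>F n in sequentially. nrm V (v - X n) < e/2" by (intro order_tendstoD(2)[OF lim]) simp
      then obtain N where N: "\<And>n. n \<ge> N \<Longrightarrow> nrm V (v - X n) < e/2" by (auto simp: eventually_sequentially)
      have "nrm V (X i - X j) < e" if "i \<ge> N" "j \<ge> N" for i j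
        using nrm_triangle_diff[of "X i" v "X j"] nrm_diff_commute[of "X i" v] N[OF that(1)] N[OF that(2)] X(1) MC v(1)
        by fastforce
      then show "\<exists>N. \<forall>i\<ge>N. \<forall>j\<ge>N. nrm V (X i - X j) < e" by blast
    qed
    then obtain x where x: "x \<in> M" "(\<lambda>k. nrm V (X k - x)) \<longlonglongrightarrow> 0" using complete[of X] X(1) by blast
    have "nrm V (v - x) \<le> 0"
    proof (rule tendsto_lowerbound)
      show "(\<lambda>k. nrm V (v - X k) + nrm V (X k - x)) \<longlonglongrightarrow> 0" using tendsto_add[OF lim x(2)] by simp
      show "\<forall>\<^sub>F k in sequentially. nrm V (v - x) \<le> nrm V (v - X k) + nrm V (X k - x)"
        by (intro always_eventually allI nrm_triangle_diff v MC X(1) x(1))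
    qed simp
    then have "v - x = 0"
      using p_nonneg[of "v - x"] nrm_eq_0_iff[of "v - x"] v(1) MC[OF x(1)] by (simp add: carr_closed)
    then show False using v(2) x(1) by simp
  qed
  obtain h where h: "\<And>x y. \<lbrakk>x \<in> carr V; y \<in> carr V\<rbrakk> \<Longrightarrow> h (x + y) = h x + h y"
    "\<And>c x. x \<in> carr V \<Longrightarrow> h (scl V c x) = c * h x"
    "\<And>x. x \<in> carr V \<Longrightarrow> cmod (h x) \<le> q x"
    "\<And>x. x \<notin> carr V \<Longrightarrow> h x = 0" "h v = complex_of_real (q v)"
    using q.Hahn_Banach[OF v(1)] by metis
  have "h \<in> carr (dual_space V)"
  proof (rule dual_memI[where K = 1])
    fix x assume x: "x \<in> carr V"
    show "cmod (h x) \<le> 1 * nrm V x" using h(3)[OF x] q_le[OF x Ms(3)] by simp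
  qed (use h in auto)
  moreover have "h m = 0" if "m \<in> M" for m
    using order_trans[OF h(3)[OF MC[OF that]] q_le[OF MC[OF that] that]] by (simp add: p_zero)
  moreover have "h v \<noteq> 0" using h(5) q_pos by simp
  ultimately show ?thesis by blast
qed

context compact_embedded
begin

text \<open>A predual \<open>E\<close> turns \<open>V\<close> into a dual space, whose unit ball is compact for pointwise
  convergence on \<open>E\<close>. If all coordinates of \<open>\<kappa>\<close> are continuous there, compactness makes the
  two topologies on the unit ball equal, so that \<open>E\<close> sits isometrically inside \<open>E0\<close>; a
  functional on \<open>E0\<close> that annihilates \<open>E\<close> is evaluation at some \<open>x\<close> on which all of \<open>E\<close>
  vanishes, hence zero.\<close>

theorem predual_isomorphic_embedding_predual:
  fixes E :: "'f::ab_group_add cnormed"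
  assumes E: "is_predual E V"
    and cont: "\<And>(\<theta> :: 'x \<Rightarrow> 'f \<Rightarrow> complex) i. compact_embedding V \<theta> \<Longrightarrow> factors_through V \<theta> 1 (\<lambda>x. \<kappa> x i)"
  shows "isometrically_isomorphic E E0"
proof -
  have banE: "complex_banach_space E" and iso: "isometrically_isomorphic (dual_space E) V"
    using E unfolding is_predual_def by auto
  interpret E: normed_carrier E
    using banE unfolding complex_banach_space_def by unfold_locales simp
  have "isometrically_isomorphic V (dual_space E)"
    by (rule isometrically_isomorphic_sym[OF E.complex_normed_space_dual iso])
  then obtain \<theta> where bij: "bij_betw \<theta> (carr V) (carr (dual_space E))"
    and add: "\<And>x y. \<lbrakk>x \<in> carr V; y \<in> carr V\<rbrakk> \<Longrightarrow> \<theta> (x + y) = \<theta> x + \<theta> y"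
    and scl: "\<And>c x. x \<in> carr V \<Longrightarrow> \<theta> (scl V c x) = scl (dual_space E) c (\<theta> x)"
    and nrm: "\<And>x. x \<in> carr V \<Longrightarrow> nrm (dual_space E) (\<theta> x) = nrm V x"
    unfolding isometrically_isomorphic_def by (elim exE conjE) (rule that; blast)
  have \<theta>D: "\<theta> x \<in> carr (dual_space E)" if "x \<in> carr V" for x using bij that by (auto simp: bij_betw_def)
  have scl': "\<theta> (scl V c x) e = c * \<theta> x e" if "x \<in> carr V" for c x e
    using scl[OF that] by (simp add: dual_space_def)
  have ball: "\<theta> ` norm_ball V 1 = norm_ball (dual_space E) 1"
  proof (intro equalityI subsetI)
    fix f assume f: "f \<in> norm_ball (dual_space E) 1"
    then obtain x where "x \<in> carr V" "f = \<theta> x" using bij by (auto simp: bij_betw_def dest!: norm_ballD(1))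
    then show "f \<in> \<theta> ` norm_ball V 1" using f nrm by (auto simp: norm_ball_def)
  qed (use \<theta>D nrm in \<open>auto simp: norm_ball_def\<close>)
  have cpt: "compact (\<theta> ` norm_ball V 1)" unfolding ball by (rule Banach_Alaoglu[OF E.normed])
  have inj: "inj_on \<theta> (carr V)" using bij by (simp add: bij_betw_def)
  have emb: "compact_embedding V \<theta>"
    unfolding compact_embedding_def using add scl' inj cpt by auto
  have "\<forall>i. \<exists>g. continuous_on (\<theta> ` norm_ball V 1) g \<and> (\<forall>x\<in>norm_ball V 1. \<kappa> x i = g (\<theta> x))"
    using cont[OF emb] unfolding factors_through_def by blast
  then obtain g where g: "\<And>i. continuous_on (\<theta> ` norm_ball V 1) (g i)"
    "\<And>i x. x \<in> norm_ball V 1 \<Longrightarrow> \<kappa> x i = g i (\<theta> x)" by metis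
  define h where "h p = (\<lambda>i. g i p)" for p
  have h: "h (\<theta> x) = \<kappa> x" if "x \<in> norm_ball V 1" for x
    unfolding h_def by (rule ext) (rule g(2)[OF that, symmetric])
  have hc: "continuous_on (\<theta> ` norm_ball V 1) h"
    unfolding h_def by (intro continuous_on_coordinatewise_then_product g)
  have "continuous_on (h ` \<theta> ` norm_ball V 1) (\<lambda>p. \<theta> (inv_into (carr V) \<kappa> p))"
    by (rule continuous_on_inv_fun[OF hc cpt])
      (auto simp: h norm_ballD(1) inv_into_f_f[OF emb_inj])
  moreover have "h ` \<theta> ` norm_ball V 1 = \<kappa> ` norm_ball V 1"
    unfolding image_image by (rule image_cong[OF refl h])
  ultimately have inv: "continuous_on (\<kappa> ` norm_ball V 1) (\<lambda>p. \<theta> (inv_into (carr V) \<kappa> p))" by simp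
  define T where "T e = (\<lambda>x. if x \<in> carr V then \<theta> x e else 0)" for e
  have T_mem: "T e \<in> carr E0" if e: "e \<in> carr E" for e
  proof -
    have "T e \<in> carr (dual_space V)"
    proof (rule dual_memI[where K = "nrm E e"])
      fix x assume x: "x \<in> carr V"
      show "cmod (T e x) \<le> nrm E e * nrm V x"
        using E.dual_apply_le[OF \<theta>D[OF x] e] x by (simp add: T_def nrm mult.commute)
    qed (auto simp: T_def add scl' carr_closed)
    moreover have "factors_through V \<kappa> 1 (T e)"
      by (rule factors_throughI[OF continuous_on_product_then_coordinatewise[OF inv, of e]])
        (simp add: T_def norm_ballD(1) inv_into_f_f[OF emb_inj])
    ultimately show ?thesis by (simp add: predual_mem_iff)
  qed
  have T_add: "T (d + e) = T d + T e" if "d \<in> carr E" "e \<in> carr E" for d e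
    using that by (auto simp: T_def fun_eq_iff E.dual_add[OF \<theta>D])
  have T_scl: "T (scl E c e) = scl E0 c (T e)" if "e \<in> carr E" for c e
    using that by (auto simp: T_def fun_eq_iff E.dual_scale[OF \<theta>D] predual_scl scl_dual_apply)
  have T_diff: "T (d - e) = T d - T e" if "d \<in> carr E" "e \<in> carr E" for d e
    using that by (auto simp: T_def fun_eq_iff E.dual_diff[OF \<theta>D])
  have T_nrm: "nrm E0 (T e) = nrm E e" if e: "e \<in> carr E" for e
  proof (rule antisym)
    show "nrm E0 (T e) \<le> nrm E e"
      unfolding predual_nrm
    proof (rule dual_nrm_le)
      fix x assume x: "x \<in> carr V" "nrm V x \<le> 1"
      have "cmod (\<theta> x e) \<le> nrm V x * nrm E e" using E.dual_apply_le[OF \<theta>D[OF x(1)] e] x by (simp add: nrm)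
      also have "\<dots> \<le> 1 * nrm E e" using x E.p_nonneg[OF e] by (intro mult_right_mono)
      finally show "cmod (T e x) \<le> nrm E e" using x by (simp add: T_def)
    qed
    obtain f where f: "f \<in> norm_ball (dual_space E) 1" "f e = complex_of_real (nrm E e)"
      using E.dual_norming[OF e] by blast
    then obtain x where x: "x \<in> norm_ball V 1" "f = \<theta> x" using ball by blast
    have "cmod (T e x) \<le> nrm E0 (T e)"
      unfolding predual_nrm using T_mem[OF e] x by (intro dual_unit_le) (auto simp: predual_mem_iff norm_ball_def)
    then show "nrm E e \<le> nrm E0 (T e)"
      using f x E.p_nonneg[OF e] by (simp add: T_def norm_ballD(1))
  qed
  have inj_T: "inj_on T (carr E)"
  proof (rule inj_onI)
    fix d e assume de: "d \<in> carr E" "e \<in> carr E" "T d = T e"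
    then have "nrm E (d - e) = nrm E0 0" using T_nrm[of "d - e"] by (simp add: E.carr_closed T_diff)
    then show "d = e" using de E.nrm_eq_0_iff[of "d - e"] by (simp add: E.carr_closed P.p_zero)
  qed
  have sub: "P.subspace (T ` carr E)"
    unfolding P.subspace_def
  proof (intro conjI allI ballI)
    have "T 0 = 0" using T_diff[of 0 0] by (simp add: E.carr_closed)
    then show "0 \<in> T ` carr E" using E.carr_closed by (metis image_eqI)
  qed (auto simp: E.carr_closed simp flip: T_add T_scl)
  have "carr E0 \<subseteq> T ` carr E"
  proof (rule ccontr)
    assume "\<not> carr E0 \<subseteq> T ` carr E"
    then obtain \<phi> where \<phi>: "\<phi> \<in> carr E0" "\<phi> \<notin> T ` carr E" by blast
    have "\<exists>F\<in>carr (dual_space E0). (\<forall>m\<in>T ` carr E. F m = 0) \<and> F \<phi> \<noteq> 0"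
    proof (rule P.annihilator_of_complete_subspace[OF sub _ _ \<phi>])
      show "T ` carr E \<subseteq> carr E0" using T_mem by blast
      fix X :: "nat \<Rightarrow> 'x \<Rightarrow> complex"
      assume X: "range X \<subseteq> T ` carr E" and C: "\<forall>e>0. \<exists>N. \<forall>i\<ge>N. \<forall>j\<ge>N. nrm E0 (X i - X j) < e"
      have "\<forall>n. \<exists>e\<in>carr E. X n = T e" using X by blast
      then obtain Y where Y: "\<And>n. Y n \<in> carr E" "\<And>n. X n = T (Y n)" by metis
      have "nrm E0 (X i - X j) = nrm E (Y i - Y j)" for i j
        using T_nrm[of "Y i - Y j"] by (simp add: Y T_diff E.carr_closed)
      then have "\<forall>e>0. \<exists>N. \<forall>i\<ge>N. \<forall>j\<ge>N. nrm E (Y i - Y j) < e" using C by simp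
      then obtain y where y: "y \<in> carr E" "(\<lambda>k. nrm E (Y k - y)) \<longlonglongrightarrow> 0"
        using banE Y(1) unfolding complex_banach_space_def by (metis image_subsetI)
      have "nrm E0 (X k - T y) = nrm E (Y k - y)" for k
        using T_nrm[of "Y k - y"] y(1) by (simp add: Y T_diff E.carr_closed)
      then show "\<exists>x\<in>T ` carr E. (\<lambda>k. nrm E0 (X k - x)) \<longlonglongrightarrow> 0" using y by (intro bexI[of _ "T y"]) auto
    qed
    then obtain F where F: "F \<in> carr (dual_space E0)" "\<And>e. e \<in> carr E \<Longrightarrow> F (T e) = 0" "F \<phi> \<noteq> 0" by auto
    obtain x where x: "x \<in> carr V" "F = (\<lambda>\<phi>. if \<phi> \<in> carr E0 then \<phi> x else 0)"
      using predual_evaluation_isometry(1) F(1) unfolding bij_betw_def by blast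
    have "\<theta> x e = 0" for e
    proof (cases "e \<in> carr E")
      case True
      then show ?thesis using F(2)[OF True] x T_mem[OF True] by (simp add: T_def)
    next
      case False
      then show ?thesis using E.dual_outside[OF \<theta>D[OF x(1)]] by simp
    qed
    then have "\<theta> x = \<theta> 0" using scl'[of 0 0] by (simp add: fun_eq_iff carr_closed)
    then have "x = 0" using inj_onD[OF inj] x(1) carr_closed(5) by blast
    then show False using F(3) x(2) \<phi>(1) dual_zero[of \<phi>] by (simp add: predual_mem_iff)
  qed
  then have "bij_betw T (carr E) (carr E0)"
    using inj_T T_mem unfolding bij_betw_def by blast
  then show ?thesis
    unfolding isometrically_isomorphic_def using T_add T_scl T_nrm by blast
qed

end

section \<open>Square-summable families and bounded forms\<close>

lemma cinner_summable: "(\<lambda>w. ell2_coeff x w * cnj (ell2_coeff y w)) summable_on UNIV"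
  by (intro ell2_mult_summable ell2_summable)

lemma cinner_add_left: "ell2_cinner (x + y) z = ell2_cinner x z + ell2_cinner y z"
  unfolding ell2_cinner_def plus_ell2.rep_eq
  by (subst infsum_add[symmetric]) (auto intro: cinner_summable simp: algebra_simps)

lemma cinner_add_right: "ell2_cinner z (x + y) = ell2_cinner z x + ell2_cinner z y"
  unfolding ell2_cinner_def plus_ell2.rep_eq
  by (subst infsum_add[symmetric]) (auto intro: cinner_summable simp: algebra_simps)

lemma cinner_scale_left: "ell2_cinner (ell2_scale c x) y = c * ell2_cinner x y"
  unfolding ell2_cinner_def ell2_scale.rep_eq
  by (subst infsum_cmult_right'[symmetric]) (simp add: mult.assoc)

lemma cinner_scale_right: "ell2_cinner x (ell2_scale c y) = cnj c * ell2_cinner x y"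
  unfolding ell2_cinner_def ell2_scale.rep_eq
  by (subst infsum_cmult_right'[symmetric]) (simp add: mult_ac)

lemma cmod_cinner_le: "cmod (ell2_cinner x y) \<le> norm x * norm y"
proof -
  obtain c where c: "cmod c = 1" "c * ell2_cinner x y = complex_of_real (cmod (ell2_cinner x y))"
    using rotate_to_nonneg by blast
  have "cmod (ell2_cinner x y) = inner (ell2_scale c x) y"
    using c(2) by (simp add: inner_ell2_def cinner_scale_left)
  also have "\<dots> \<le> norm (ell2_scale c x) * norm y" by (rule norm_cauchy_schwarz)
  finally show ?thesis using c(1) by (simp add: norm_ell2_scale)
qed

lemma cinner_basis: "ell2_cinner x (ell2_basis w) = ell2_coeff x w"
proof -
  have "ell2_cinner x (ell2_basis w) = (\<Sum>\<^sub>\<infinity>u\<in>{w}. ell2_coeff x u * cnj (ell2_coeff (ell2_basis w) u))"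
    unfolding ell2_cinner_def by (rule infsum_cong_neutral) (auto simp: ell2_coeff_basis)
  then show ?thesis by (simp add: ell2_coeff_basis)
qed

lemma cmod_coeff_le_norm: "cmod (ell2_coeff x w) \<le> norm x"
  using sum_coeff_le_norm_ell2[of "{w}" x] by (simp add: power2_le_iff_abs_le)

lemma norm_basis [simp]: "norm (ell2_basis w) = 1"
proof -
  have "(norm (ell2_basis w))\<^sup>2 = Re (ell2_cinner (ell2_basis w) (ell2_basis w))"
    by (simp add: power2_norm_eq_inner inner_ell2_def)
  then show ?thesis by (simp add: cinner_basis ell2_coeff_basis power2_eq_1_iff)
      (metis norm_ge_zero not_one_le_zero order_trans neg_0_le_iff_le zero_le_one)
qed

lemma ell2_eqI: "(\<And>w. ell2_coeff x w = ell2_coeff y w) \<Longrightarrow> x = y"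
  by (metis ell2_coeff_inject ext)

lemma ell2_coeff_sum: "ell2_coeff (\<Sum>i\<in>F. x i) w = (\<Sum>i\<in>F. ell2_coeff (x i) w)"
  by (induction F rule: infinite_finite_induct) (auto simp: zero_ell2.rep_eq plus_ell2.rep_eq)

lemma ell2_coeff_truncation:
  assumes "finite F"
  shows "ell2_coeff (\<Sum>w\<in>F. ell2_scale (f w) (ell2_basis w)) u = (if u \<in> F then f u else 0)"
  using assms by (simp add: ell2_coeff_sum ell2_scale.rep_eq ell2_coeff_basis sum.delta if_distrib cong: if_cong)

lemma norm_truncation_sq:
  assumes "finite F"
  shows "(norm (\<Sum>w\<in>F. ell2_scale (f w) (ell2_basis w)))\<^sup>2 = (\<Sum>w\<in>F. (cmod (f w))\<^sup>2)"
proof -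
  have "(norm (\<Sum>w\<in>F. ell2_scale (f w) (ell2_basis w)))\<^sup>2 = (\<Sum>\<^sub>\<infinity>u\<in>F. (cmod (f u))\<^sup>2)"
    unfolding norm_ell2_sq ell2_coeff_truncation[OF assms] by (rule infsum_cong_neutral) auto
  then show ?thesis using assms by simp
qed

lemma truncation_approximates:
  assumes "e > 0"
  shows "\<exists>F. finite F \<and> norm (x - (\<Sum>w\<in>F. ell2_scale (ell2_coeff x w) (ell2_basis w))) < e"
proof -
  let ?g = "\<lambda>w. (cmod (ell2_coeff x w))\<^sup>2"
  have "(?g has_sum (norm x)\<^sup>2) UNIV"
    unfolding norm_ell2_sq by (rule has_sum_infsum[OF ell2_summable])
  then have "(sum ?g \<longlongrightarrow> (norm x)\<^sup>2) (finite_subsets_at_top UNIV)" by (simp add: has_sum_def)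
  then have "\<forall>\<^sub>F F in finite_subsets_at_top UNIV. dist (sum ?g F) ((norm x)\<^sup>2) < e\<^sup>2"
    using assms by (intro tendstoD) auto
  then obtain F where F: "finite F" "dist (sum ?g F) ((norm x)\<^sup>2) < e\<^sup>2"
    by (auto simp: eventually_finite_subsets_at_top)
  let ?d = "x - (\<Sum>w\<in>F. ell2_scale (ell2_coeff x w) (ell2_basis w))"
  have "(norm ?d)\<^sup>2 = (\<Sum>\<^sub>\<infinity>u\<in>UNIV - F. ?g u)"
    unfolding norm_ell2_sq minus_ell2.rep_eq ell2_coeff_truncation[OF F(1)]
    by (rule infsum_cong_neutral) auto
  moreover have "(norm x)\<^sup>2 = sum ?g F + (\<Sum>\<^sub>\<infinity>u\<in>UNIV - F. ?g u)"
    using infsum_Un_disjoint[of ?g F "UNIV - F"] F(1) summable_on_subset_banach[OF ell2_summable[of x], of "UNIV - F"]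
    by (simp add: norm_ell2_sq)
  ultimately have "(norm ?d)\<^sup>2 < e\<^sup>2" using F(2) by (simp add: dist_real_def)
  then have "norm ?d < e" using assms by (simp add: power2_less_imp_less)
  then show ?thesis using F(1) by blast
qed

lemma bounded_linear_zero_on_basis:
  assumes f: "bounded_linear f" and basis_zero: "\<And>c w. f (ell2_scale c (ell2_basis w)) = 0"
  shows "f x = 0"
proof -
  interpret bounded_linear f by (rule f)
  obtain K where K: "K > 0" "\<And>x. norm (f x) \<le> norm x * K" using pos_bounded by blast
  have "norm (f x) \<le> 0 + e" if e: "e > 0" for e
  proof -
    obtain F where F: "finite F" "norm (x - (\<Sum>w\<in>F. ell2_scale (ell2_coeff x w) (ell2_basis w))) < e / K"
      using truncation_approximates[OF divide_pos_pos[OF e K(1)], of x] by blast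
    let ?y = "\<Sum>w\<in>F. ell2_scale (ell2_coeff x w) (ell2_basis w)"
    have "f x = f (x - ?y)" by (simp add: diff sum basis_zero)
    then have "norm (f x) \<le> norm (x - ?y) * K" using K(2)[of "x - ?y"] by simp
    also have "\<dots> \<le> e / K * K" using F(2) K(1) by (intro mult_right_mono) auto
    finally show ?thesis using K(1) by simp
  qed
  then have "norm (f x) \<le> 0" by (rule field_le_epsilon)
  then show ?thesis by simp
qed

text \<open>The weak operator topology is pulled back from the product topology along \<open>op_form\<close>, so compactness
  of its unit ball is compactness of a set of sesquilinear forms.\<close>

definition op_form :: "'w ell2_op \<Rightarrow> 'w ell2 \<times> 'w ell2 \<Rightarrow> complex" where
  "op_form T = (\<lambda>(x, y). ell2_cinner (blinfun_apply T x) y)"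

definition contractive_forms :: "('w ell2 \<times> 'w ell2 \<Rightarrow> complex) set" where
  "contractive_forms = {\<beta>.
    (\<forall>x x' y. \<beta> (x + x', y) = \<beta> (x, y) + \<beta> (x', y)) \<and>
    (\<forall>c x y. \<beta> (ell2_scale c x, y) = c * \<beta> (x, y)) \<and>
    (\<forall>x y y'. \<beta> (x, y + y') = \<beta> (x, y) + \<beta> (x, y')) \<and>
    (\<forall>c x y. \<beta> (x, ell2_scale c y) = cnj c * \<beta> (x, y)) \<and>
    (\<forall>p. \<beta> p \<in> cball 0 (norm (fst p) * norm (snd p)))}"

lemma compact_contractive_forms: "compact (contractive_forms :: ('w ell2 \<times> 'w ell2 \<Rightarrow> complex) set)"
proof -
  let ?P = "{\<beta> :: 'w ell2 \<times> 'w ell2 \<Rightarrow> complex. \<forall>p. \<beta> p \<in> cball 0 (norm (fst p) * norm (snd p))}"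
  let ?L = "{\<beta> :: 'w ell2 \<times> 'w ell2 \<Rightarrow> complex.
    (\<forall>x x' y. \<beta> (x + x', y) = \<beta> (x, y) + \<beta> (x', y)) \<and>
    (\<forall>c x y. \<beta> (ell2_scale c x, y) = c * \<beta> (x, y)) \<and>
    (\<forall>x y y'. \<beta> (x, y + y') = \<beta> (x, y) + \<beta> (x, y')) \<and>
    (\<forall>c x y. \<beta> (x, ell2_scale c y) = cnj c * \<beta> (x, y))}"
  have "compact ?P" by (intro compact_PiE_UNIV) simp
  moreover have "closed ?L"
    by (intro closed_Collect_conj closed_Collect_all closed_Collect_eq continuous_intros
        continuous_on_coordinate)
  ultimately have "compact (?P \<inter> ?L)" by (rule compact_Int_closed)
  moreover have "contractive_forms = ?P \<inter> ?L" unfolding contractive_forms_def by blast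
  ultimately show ?thesis by (simp only:)
qed

lemma op_form_contractive:
  assumes "T \<in> clinear_ops" "norm T \<le> 1"
  shows "op_form T \<in> contractive_forms"
proof -
  have "cmod (ell2_cinner (blinfun_apply T x) y) \<le> norm x * norm y" for x y
  proof -
    have "cmod (ell2_cinner (blinfun_apply T x) y) \<le> norm (blinfun_apply T x) * norm y"
      by (rule cmod_cinner_le)
    also have "\<dots> \<le> (norm T * norm x) * norm y" by (intro mult_right_mono norm_blinfun) simp
    also have "\<dots> \<le> (1 * norm x) * norm y" using assms(2) by (intro mult_right_mono) auto
    finally show ?thesis by simp
  qed
  then show ?thesis
    using assms(1) unfolding contractive_forms_def op_form_def clinear_ops_def
    by (simp add: blinfun.add_right cinner_add_left cinner_add_right cinner_scale_left cinner_scale_right)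
qed

text \<open>The Riesz representation: the image of \<open>x\<close> has the coefficients \<open>\<beta> (x, \<xi>\<^sub>w)\<close>, which are
  square-summable because \<open>\<beta> (x, \<cdot>)\<close> is bounded on the truncations of that very family.\<close>

lemma contractive_form_is_op_form:
  assumes \<beta>: "\<beta> \<in> contractive_forms"
  shows "\<exists>T\<in>clinear_ops. norm T \<le> 1 \<and> op_form T = \<beta>"
proof -
  have add1: "\<beta> (x + x', y) = \<beta> (x, y) + \<beta> (x', y)" and scl1: "\<beta> (ell2_scale c x, y) = c * \<beta> (x, y)"
    and add2: "\<beta> (x, y + y') = \<beta> (x, y) + \<beta> (x, y')"
    and scl2: "\<beta> (x, ell2_scale c y) = cnj c * \<beta> (x, y)"
    and bound: "cmod (\<beta> (x, y)) \<le> norm x * norm y" for x x' y y' c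
    using \<beta> unfolding contractive_forms_def by auto
  have zero2: "\<beta> (x, 0) = 0" for x using add2[of x 0 0] by simp
  have sum2: "\<beta> (x, \<Sum>i\<in>F. g i) = (\<Sum>i\<in>F. \<beta> (x, g i))" for x F and g :: "_ \<Rightarrow> 'a ell2"
    by (induction F rule: infinite_finite_induct) (auto simp: add2 zero2)
  have fin: "(\<Sum>w\<in>F. (cmod (\<beta> (x, ell2_basis w)))\<^sup>2) \<le> (norm x)\<^sup>2" if F: "finite F" for x F
  proof -
    let ?f = "\<lambda>w. \<beta> (x, ell2_basis w)"
    let ?y = "\<Sum>w\<in>F. ell2_scale (?f w) (ell2_basis w)"
    have "\<beta> (x, ?y) = complex_of_real ((norm ?y)\<^sup>2)"
      unfolding norm_truncation_sq[OF F]
      by (simp add: sum2 scl2 complex_norm_square mult.commute del: of_real_power)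
    then have "(norm ?y)\<^sup>2 \<le> norm x * norm ?y" using bound[of x ?y] by (simp add: norm_power)
    then have "norm ?y \<le> norm x" by (cases "norm ?y = 0") (auto simp: power2_eq_square)
    then have "(norm ?y)\<^sup>2 \<le> (norm x)\<^sup>2" by (intro power_mono) auto
    then show ?thesis by (simp add: norm_truncation_sq[OF F])
  qed
  have summable: "(\<lambda>w. (cmod (\<beta> (x, ell2_basis w)))\<^sup>2) summable_on UNIV" for x
    by (rule nonneg_bdd_above_summable_on) (auto intro!: bdd_aboveI2[where M = "(norm x)\<^sup>2"] fin)
  define t where "t x = Abs_ell2 (\<lambda>w. \<beta> (x, ell2_basis w))" for x
  have coeff: "ell2_coeff (t x) w = \<beta> (x, ell2_basis w)" for x w
    unfolding t_def using summable by (subst Abs_ell2_inverse) auto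
  have t_norm: "norm (t x) \<le> norm x" for x
  proof -
    have "(norm (t x))\<^sup>2 \<le> (norm x)\<^sup>2"
      unfolding norm_ell2_sq[of "t x"] coeff
      by (rule infsum_le_finite_sums[OF summable]) (auto intro: fin)
    then show ?thesis by (simp add: power2_le_iff_abs_le)
  qed
  have t_scale: "t (ell2_scale c x) = ell2_scale c (t x)" for c x
    by (rule ell2_eqI) (simp add: coeff scl1 ell2_scale.rep_eq)
  have lin: "bounded_linear t"
  proof (rule bounded_linear_intro[where K = 1])
    show "t (x + y) = t x + t y" for x y by (rule ell2_eqI) (simp add: coeff add1 plus_ell2.rep_eq)
    show "t (r *\<^sub>R x) = r *\<^sub>R t x" for r x by (simp add: scaleR_ell2_def t_scale)
  qed (simp add: t_norm)
  define T where "T = Blinfun t"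
  have T: "blinfun_apply T = t" unfolding T_def by (rule bounded_linear_Blinfun_apply[OF lin])
  have "ell2_cinner (t x) y - \<beta> (x, y) = 0" for x y
  proof (rule bounded_linear_zero_on_basis[of "\<lambda>y. ell2_cinner (t x) y - \<beta> (x, y)"])
    show "bounded_linear (\<lambda>y. ell2_cinner (t x) y - \<beta> (x, y))"
    proof (rule bounded_linear_intro[where K = "2 * norm x"])
      fix y y' :: "'a ell2"
      show "ell2_cinner (t x) (y + y') - \<beta> (x, y + y')
          = (ell2_cinner (t x) y - \<beta> (x, y)) + (ell2_cinner (t x) y' - \<beta> (x, y'))"
        by (simp add: cinner_add_right add2)
      show "ell2_cinner (t x) (r *\<^sub>R y) - \<beta> (x, r *\<^sub>R y) = r *\<^sub>R (ell2_cinner (t x) y - \<beta> (x, y))" for r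
        by (simp add: scaleR_ell2_def cinner_scale_right scl2 scaleR_conv_of_real algebra_simps)
      have "cmod (ell2_cinner (t x) y) \<le> norm x * norm y"
        using cmod_cinner_le[of "t x" y] mult_right_mono[OF t_norm[of x] norm_ge_zero[of y]] by linarith
      then show "norm (ell2_cinner (t x) y - \<beta> (x, y)) \<le> norm y * (2 * norm x)"
        using norm_triangle_ineq4[of "ell2_cinner (t x) y" "\<beta> (x, y)"] bound[of x y]
        by (simp add: mult.left_commute mult.commute[of "norm y"])
    qed
    show "ell2_cinner (t x) (ell2_scale c (ell2_basis w)) - \<beta> (x, ell2_scale c (ell2_basis w)) = 0" for c w
      by (simp add: cinner_scale_right scl2 cinner_basis coeff)
  qed
  then have "op_form T = \<beta>" unfolding op_form_def T by (simp add: fun_eq_iff)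
  moreover have "T \<in> clinear_ops" by (simp add: clinear_ops_def T t_scale)
  moreover have "norm T \<le> 1" by (rule norm_blinfun_bound) (simp_all add: T t_norm)
  ultimately show ?thesis by blast
qed

lemma closedin_weak_operator_topology_iff:
  "closedin weak_operator_topology A \<longleftrightarrow> (\<exists>C. closed C \<and> A = {T \<in> clinear_ops. op_form T \<in> C})"
proof
  have top: "topspace weak_operator_topology = (clinear_ops :: 'w ell2_op set)"
    by (simp add: weak_operator_topology_def topspace_pullback_topology)
  have opn: "openin weak_operator_topology S \<longleftrightarrow> (\<exists>U. open U \<and> S = op_form -` U \<inter> clinear_ops)"
    for S :: "'w ell2_op set"
    unfolding weak_operator_topology_def openin_pullback_topology op_form_def by simp
  {
    assume "closedin weak_operator_topology A"
    then obtain U where "A \<subseteq> clinear_ops" "open U" "clinear_ops - A = op_form -` U \<inter> clinear_ops"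
      unfolding closedin_def top opn by blast
    then show "\<exists>C. closed C \<and> A = {T \<in> clinear_ops. op_form T \<in> C}"
      by (intro exI[of _ "- U"]) auto
  next
    assume "\<exists>C. closed C \<and> A = {T \<in> clinear_ops. op_form T \<in> C}"
    then obtain C where "closed C" "A = {T \<in> clinear_ops. op_form T \<in> C}" by blast
    then show "closedin weak_operator_topology A"
      unfolding closedin_def top opn by (auto intro!: exI[of _ "- C"])
  }
qed

theorem compact_op_form_ball:
  assumes "closedin weak_operator_topology A"
  shows "compact (op_form ` {T \<in> A. norm T \<le> 1})"
proof -
  obtain C where C: "closed C" "A = {T \<in> clinear_ops. op_form T \<in> C}"
    using assms closedin_weak_operator_topology_iff by blast
  have "op_form ` {T \<in> A. norm T \<le> 1} = contractive_forms \<inter> C"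
    using C(2) contractive_form_is_op_form op_form_contractive by blast
  then show ?thesis using compact_Int_closed[OF compact_contractive_forms C(1)] by (simp only:)
qed

section \<open>Fourier coefficients of the noncommutative analytic Toeplitz algebra\<close>

definition fourier :: "'a list ell2_op \<Rightarrow> 'a list \<Rightarrow> complex" where
  "fourier T w = ell2_coeff (blinfun_apply T (ell2_basis [])) w"

lemma fourier_add: "fourier (S + T) w = fourier S w + fourier T w"
  by (simp add: fourier_def blinfun.add_left plus_ell2.rep_eq)

lemma fourier_diff: "fourier (S - T) w = fourier S w - fourier T w"
  by (simp add: fourier_def blinfun.diff_left minus_ell2.rep_eq)

lemma fourier_scale: "fourier (op_scale c T) w = c * fourier T w"
  by (simp add: fourier_def op_scale_apply ell2_scale.rep_eq)

lemma fourier_left_shift: "fourier (left_shift v) w = (if w = v then 1 else 0)"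
  by (simp add: fourier_def left_shift_basis ell2_coeff_basis)

lemma fourier_id: "fourier id_blinfun w = (if w = [] then 1 else 0)"
  by (simp add: fourier_def ell2_coeff_basis)

lemma cmod_fourier_le: "cmod (fourier T w) \<le> norm T"
proof -
  have "cmod (fourier T w) \<le> norm (blinfun_apply T (ell2_basis []))"
    unfolding fourier_def by (rule cmod_coeff_le_norm)
  also have "\<dots> \<le> norm T" using norm_blinfun[of T "ell2_basis []"] by simp
  finally show ?thesis .
qed

lemma nc_toeplitz_algebra_subset:
  assumes "unital_op_algebra A" "closedin weak_operator_topology A" "\<And>i. left_shift [i] \<in> A"
  shows "nc_toeplitz_algebra \<subseteq> A"
  unfolding nc_toeplitz_algebra_def by (rule hull_minimal) (use assms in auto)

definition convolution_op :: "'a list ell2_op \<Rightarrow> bool" where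
  "convolution_op T \<longleftrightarrow> (\<forall>x u. ell2_coeff (blinfun_apply T x) u =
    (\<Sum>k\<le>length u. fourier T (take k u) * ell2_coeff x (drop k u)))"

lemma convolution_op_compose:
  fixes S T :: "'a list ell2_op"
  assumes S: "convolution_op S" and T: "convolution_op T"
  shows "convolution_op (S o\<^sub>L T)"
  unfolding convolution_op_def
proof (intro allI)
  fix x :: "'a list ell2" and u :: "'a list"
  let ?n = "length u"
  have prod: "fourier (S o\<^sub>L T) v = (\<Sum>k\<le>length v. fourier S (take k v) * fourier T (drop k v))" for v
    using S[unfolded convolution_op_def, rule_format, of "blinfun_apply T (ell2_basis [])" v]
    unfolding fourier_def[of T] fourier_def[of "S o\<^sub>L T"] by simp
  have "ell2_coeff (blinfun_apply (S o\<^sub>L T) x) u = (\<Sum>k\<le>?n. fourier S (take k u) *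
      (\<Sum>j\<le>?n - k. fourier T (take j (drop k u)) * ell2_coeff x (drop (k + j) u)))"
    using S T unfolding convolution_op_def by (simp add: add.commute)
  also have "\<dots> = (\<Sum>k\<le>?n. \<Sum>j\<le>?n - k. fourier S (take k u) *
      fourier T (take j (drop k u)) * ell2_coeff x (drop (k + j) u))"
    by (simp add: sum_distrib_left mult.assoc)
  also have "\<dots> = (\<Sum>(k, j)\<in>{(k, j). k + j \<le> ?n}. fourier S (take k u) *
      fourier T (take j (drop k u)) * ell2_coeff x (drop (k + j) u))"
  proof -
    have "{(k, j). k + j \<le> ?n} = (SIGMA k:{..?n}. {..?n - k})" by auto
    then show ?thesis by (simp add: sum.Sigma)
  qed
  also have "\<dots> = (\<Sum>m\<le>?n. \<Sum>k\<le>m. fourier S (take k u) *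
      fourier T (take (m - k) (drop k u)) * ell2_coeff x (drop (k + (m - k)) u))"
    by (rule sum.triangle_reindex_eq)
  also have "\<dots> = (\<Sum>m\<le>?n. fourier (S o\<^sub>L T) (take m u) * ell2_coeff x (drop m u))"
    unfolding prod by (intro sum.cong refl) (auto simp: sum_distrib_right min_def drop_take intro!: sum.cong)
  finally show "ell2_coeff (blinfun_apply (S o\<^sub>L T) x) u =
      (\<Sum>k\<le>?n. fourier (S o\<^sub>L T) (take k u) * ell2_coeff x (drop k u))" .
qed

lemma convolution_op_left_shift: "convolution_op (left_shift v)"
  unfolding convolution_op_def
proof (intro allI)
  fix x u
  have "(\<Sum>k\<le>length u. fourier (left_shift v) (take k u) * ell2_coeff x (drop k u))
      = (\<Sum>k\<le>length u. if k = length v then (if prefix v u then ell2_coeff x (drop k u) else 0) else 0)"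
  proof (intro sum.cong refl)
    fix k assume "k \<in> {..length u}"
    then have "take k u = v \<longleftrightarrow> k = length v \<and> prefix v u"
      by (auto simp: prefix_def take_is_prefix) (metis append_take_drop_id)
    then show "fourier (left_shift v) (take k u) * ell2_coeff x (drop k u)
      = (if k = length v then (if prefix v u then ell2_coeff x (drop k u) else 0) else 0)"
      by (simp add: fourier_left_shift)
  qed
  also have "\<dots> = ell2_coeff (blinfun_apply (left_shift v) x) u"
    by (auto simp: sum.delta left_shift_apply left_shift_fun.rep_eq shift_coeff_def dest: prefix_length_le)
  finally show "ell2_coeff (blinfun_apply (left_shift v) x) u =
      (\<Sum>k\<le>length u. fourier (left_shift v) (take k u) * ell2_coeff x (drop k u))" by simp
qed

lemma left_shift_Nil: "left_shift [] = id_blinfun"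
  by (rule blinfun_eqI, rule ell2_eqI) (simp add: left_shift_apply left_shift_fun.rep_eq shift_coeff_def)

lemma left_shift_append: "left_shift (u @ v) = left_shift u o\<^sub>L left_shift v"
proof (rule blinfun_eqI, rule ell2_eqI)
  fix x w
  show "ell2_coeff (blinfun_apply (left_shift (u @ v)) x) w =
      ell2_coeff (blinfun_apply (left_shift u o\<^sub>L left_shift v) x) w"
    by (auto simp: left_shift_apply left_shift_fun.rep_eq shift_coeff_def prefix_def)
qed

text \<open>The operators with this property form a closed algebra that contains the generators. The formula
  also says that they commute with right translations of words.\<close>

theorem convolution_formula:
  assumes "T \<in> nc_toeplitz_algebra"
  shows "ell2_coeff (blinfun_apply T x) u =
    (\<Sum>k\<le>length u. fourier T (take k u) * ell2_coeff x (drop k u))"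
proof -
  let ?A = "{T \<in> clinear_ops. convolution_op T} :: 'a list ell2_op set"
  note clinear = unital_op_algebra_clinear_ops[where 'a = "'a list", unfolded unital_op_algebra_def]
  have "unital_op_algebra ?A"
    unfolding unital_op_algebra_def
  proof (intro conjI ballI allI)
    show "id_blinfun \<in> ?A"
      using convolution_op_left_shift[of "[] :: 'a list"] clinear by (simp add: left_shift_Nil)
    fix S T assume ST: "S \<in> ?A" "T \<in> ?A"
    then show "S o\<^sub>L T \<in> ?A"
      using clinear by (simp add: convolution_op_compose)
    have "convolution_op (S + T)"
      using ST unfolding convolution_op_def
      by (simp add: fourier_add blinfun.add_left plus_ell2.rep_eq distrib_right sum.distrib)
    then show "S + T \<in> ?A"
      using ST clinear by simp
  next
    fix c T assume T: "T \<in> ?A"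
    then have "convolution_op (op_scale c T)"
      unfolding convolution_op_def
      by (simp add: fourier_scale op_scale_apply ell2_scale.rep_eq sum_distrib_left mult.assoc)
    then show "op_scale c T \<in> ?A"
      using T clinear by simp
  qed auto
  moreover have "closedin weak_operator_topology ?A"
    unfolding closedin_weak_operator_topology_iff
  proof (intro exI conjI)
    let ?C = "{\<beta> :: 'a list ell2 \<times> 'a list ell2 \<Rightarrow> complex. \<forall>x u. \<beta> (x, ell2_basis u) =
      (\<Sum>k\<le>length u. \<beta> (ell2_basis [], ell2_basis (take k u)) * ell2_coeff x (drop k u))}"
    show "closed ?C"
      by (intro closed_Collect_all closed_Collect_eq continuous_intros continuous_on_coordinate)
    show "?A = {T \<in> clinear_ops. op_form T \<in> ?C}"
      unfolding convolution_op_def op_form_def fourier_def by (simp add: cinner_basis)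
  qed
  moreover have "left_shift [i] \<in> ?A" for i
    by (simp add: left_shift_clinear convolution_op_left_shift)
  ultimately have "T \<in> ?A" using nc_toeplitz_algebra_subset assms by blast
  then show ?thesis by (simp add: convolution_op_def)
qed

lemma fourier_inject:
  assumes "S \<in> nc_toeplitz_algebra" "T \<in> nc_toeplitz_algebra" "fourier S = fourier T"
  shows "S = T"
  by (rule blinfun_eqI, rule ell2_eqI) (simp add: convolution_formula assms)

lemma fourier_compose:
  assumes "S \<in> nc_toeplitz_algebra"
  shows "fourier (S o\<^sub>L T) w = (\<Sum>k\<le>length w. fourier S (take k w) * fourier T (drop k w))"
  using convolution_formula[OF assms, of "blinfun_apply T (ell2_basis [])" w]
  unfolding fourier_def[of T] fourier_def[of "S o\<^sub>L T"] by simp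

lemma nc_toeplitz_simps [simp]:
  "carr nc_toeplitz = nc_toeplitz_algebra" "scl nc_toeplitz = op_scale" "nrm nc_toeplitz = norm"
  by (simp_all add: nc_toeplitz_def)

interpretation toeplitz: normed_carrier "nc_toeplitz :: 'a list ell2_op cnormed"
  rewrites "carr nc_toeplitz = nc_toeplitz_algebra" and "scl nc_toeplitz = op_scale"
    and "nrm nc_toeplitz = norm"
  by (rule normed_carrier.intro[OF complex_normed_space_nc_toeplitz]) simp_all

lemma id_in_toeplitz: "id_blinfun \<in> nc_toeplitz_algebra"
  and toeplitz_compose: "\<lbrakk>S \<in> nc_toeplitz_algebra; T \<in> nc_toeplitz_algebra\<rbrakk> \<Longrightarrow> S o\<^sub>L T \<in> nc_toeplitz_algebra"
  using nc_toeplitz_algebra_props(1) unfolding unital_op_algebra_def by blast+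

lemma left_shift_in_toeplitz: "left_shift v \<in> nc_toeplitz_algebra"
proof (induction v)
  case (Cons i v)
  then show ?case
    using toeplitz_compose[OF nc_toeplitz_algebra_props(3)[of i]] left_shift_append[of "[i]" v] by simp
qed (simp add: left_shift_Nil id_in_toeplitz)

text \<open>The Fourier coefficients are among the matrix coefficients that define the weak operator topology,
  hence the compact set of forms is mapped onto a compact set; the convolution formula recovers the
  operator from them.\<close>

theorem compact_embedding_fourier:
  "compact_embedding (nc_toeplitz :: 'a list ell2_op cnormed) fourier"
  unfolding compact_embedding_def
proof (intro conjI ballI allI)
  show "inj_on fourier (carr (nc_toeplitz :: 'a list ell2_op cnormed))" by (auto intro: inj_onI fourier_inject)
  have "fourier ` norm_ball (nc_toeplitz :: 'a list ell2_op cnormed) 1 =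
      (\<lambda>\<beta> w. \<beta> (ell2_basis [], ell2_basis w)) ` op_form ` {T \<in> nc_toeplitz_algebra. norm T \<le> 1}"
    unfolding image_image norm_ball_def op_form_def fourier_def by (simp add: cinner_basis)
  moreover have "compact \<dots>"
    by (intro compact_continuous_image compact_op_form_ball nc_toeplitz_algebra_props(2)
        continuous_on_coordinatewise_then_product continuous_on_coordinate)
  ultimately show "compact (fourier ` norm_ball (nc_toeplitz :: 'a list ell2_op cnormed) 1)" by (simp only:)
qed (simp_all add: fourier_add fourier_scale fun_eq_iff)

section \<open>Division by a generator\<close>

lift_definition ell2_unshift :: "'a \<Rightarrow> 'a list ell2 \<Rightarrow> 'a list ell2" is "\<lambda>i f w. f (i # w)"
proof -
  fix i :: 'a and f :: "'a list \<Rightarrow> complex"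
  assume "(\<lambda>w. (cmod (f w))\<^sup>2) summable_on UNIV"
  then have "(\<lambda>w. (cmod (f w))\<^sup>2) summable_on range ((#) i)" by (rule summable_on_subset_banach) simp
  then show "(\<lambda>w. (cmod (f (i # w)))\<^sup>2) summable_on UNIV"
    by (simp add: summable_on_reindex o_def)
qed

definition left_unshift :: "'a \<Rightarrow> 'a list ell2_op" where
  "left_unshift i = Blinfun (ell2_unshift i)"

lemma norm_ell2_unshift: "norm (ell2_unshift i x) \<le> norm x"
proof -
  have "(norm (ell2_unshift i x))\<^sup>2 = (\<Sum>\<^sub>\<infinity>w\<in>range ((#) i). (cmod (ell2_coeff x w))\<^sup>2)"
    unfolding norm_ell2_sq ell2_unshift.rep_eq by (subst infsum_reindex) (auto simp: o_def)
  also have "\<dots> \<le> (norm x)\<^sup>2"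
    unfolding norm_ell2_sq
    by (rule infsum_mono_neutral) (auto intro: ell2_summable summable_on_subset_banach[OF ell2_summable])
  finally show ?thesis by (simp add: power2_le_iff_abs_le)
qed

lemma left_unshift_apply: "blinfun_apply (left_unshift i) = ell2_unshift i"
  unfolding left_unshift_def
proof (intro bounded_linear_Blinfun_apply bounded_linear_intro[where K = 1])
  show "ell2_unshift i (x + y) = ell2_unshift i x + ell2_unshift i y" for x y by (transfer; simp)
  show "ell2_unshift i (r *\<^sub>R x) = r *\<^sub>R ell2_unshift i x" for r x
    unfolding scaleR_ell2_def by (transfer; simp)
qed (simp add: norm_ell2_unshift)

lemma left_unshift_clinear: "left_unshift i \<in> clinear_ops"
proof -
  have "ell2_unshift i (ell2_scale c x) = ell2_scale c (ell2_unshift i x)" for c x by (transfer; simp)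
  then show ?thesis by (simp add: clinear_ops_def left_unshift_apply)
qed

lemma cinner_unshift: "ell2_cinner (ell2_unshift i x) y = ell2_cinner x (left_shift_fun [i] y)"
proof -
  have "ell2_cinner x (left_shift_fun [i] y) =
      (\<Sum>\<^sub>\<infinity>w\<in>range ((#) i). ell2_coeff x w * cnj (ell2_coeff (left_shift_fun [i] y) w))"
    unfolding ell2_cinner_def
  proof (rule infsum_cong_neutral)
    fix w :: "'a list" assume "w \<in> UNIV - range ((#) i)"
    then have "\<not> prefix [i] w" by (cases w) auto
    then show "ell2_coeff x w * cnj (ell2_coeff (left_shift_fun [i] y) w) = 0"
      by (simp add: left_shift_fun.rep_eq shift_coeff_def)
  qed auto
  also have "\<dots> = ell2_cinner (ell2_unshift i x) y"
    unfolding ell2_cinner_def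
    by (subst infsum_reindex)
      (auto simp: o_def left_shift_fun.rep_eq shift_coeff_def ell2_unshift.rep_eq)
  finally show ?thesis by simp
qed

text \<open>The adjoint \<open>left_unshift i\<close> of a generator does not map the algebra into itself: it sends the
  identity to an operator outside of it. Removing the constant coefficient first repairs this, and
  on the remaining part the operation deletes a leading \<open>i\<close> and drops the words that start with
  another letter.\<close>

definition left_quotient :: "'a \<Rightarrow> 'a list ell2_op \<Rightarrow> 'a list ell2_op" where
  "left_quotient i T = left_unshift i o\<^sub>L (T - op_scale (fourier T []) id_blinfun)"

lemma fourier_left_quotient: "fourier (left_quotient i T) w = fourier T (i # w)"
  by (simp add: left_quotient_def fourier_def left_unshift_apply ell2_unshift.rep_eq blinfun.diff_left
      op_scale_apply minus_ell2.rep_eq ell2_scale.rep_eq ell2_coeff_basis)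

lemma clinear_ops_closed:
  assumes "S \<in> clinear_ops" "T \<in> clinear_ops"
  shows "S - T \<in> clinear_ops" "S o\<^sub>L T \<in> clinear_ops" "op_scale c T \<in> clinear_ops" "id_blinfun \<in> clinear_ops"
proof -
  have 1: "op_scale d R \<in> clinear_ops" if "R \<in> clinear_ops" for d and R :: "'a ell2_op"
    using unital_op_algebra_clinear_ops that unfolding unital_op_algebra_def by blast
  show "op_scale c T \<in> clinear_ops" by (rule 1[OF assms(2)])
  show "S o\<^sub>L T \<in> clinear_ops" "id_blinfun \<in> clinear_ops"
    using unital_op_algebra_clinear_ops assms unfolding unital_op_algebra_def by blast+
  have "S + op_scale (-1) T \<in> clinear_ops"
    using unital_op_algebra_clinear_ops assms 1 unfolding unital_op_algebra_def by blast
  moreover have "ell2_scale (-1) x = - x" for x :: "'a ell2" by (transfer; simp)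
  then have "S + op_scale (-1) T = S - T"
    by (intro blinfun_eqI) (simp add: blinfun.add_left blinfun.diff_left op_scale_apply)
  ultimately show "S - T \<in> clinear_ops" by simp
qed

text \<open>The operators \<open>T\<close> with \<open>left_quotient i T\<close> in the algebra form a closed algebra. The product
  rule \<open>left_quotient i (S T) = a\<^sub>S left_quotient i T + left_quotient i S T\<close>, with \<open>a\<^sub>S\<close> the constant
  coefficient of \<open>S\<close>, is what makes it multiplicative.\<close>

lemma left_quotient_in_toeplitz:
  assumes "T \<in> nc_toeplitz_algebra"
  shows "left_quotient i T \<in> nc_toeplitz_algebra"
proof -
  let ?X = "nc_toeplitz_algebra :: 'a list ell2_op set"
  let ?A = "{T \<in> ?X. left_quotient i T \<in> ?X}"
  note X = nc_toeplitz_algebra_props(1)[unfolded unital_op_algebra_def, where 'a = 'a]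
  have usimps: "ell2_unshift i (x + y) = ell2_unshift i x + ell2_unshift i y"
    "ell2_unshift i (x - y) = ell2_unshift i x - ell2_unshift i y"
    "ell2_unshift i (ell2_scale c x) = ell2_scale c (ell2_unshift i x)" for c x y
    by (transfer; simp)+
  have vs: "ell2_scale a (x + y) = ell2_scale a x + ell2_scale a y"
    "ell2_scale a (x - y) = ell2_scale a x - ell2_scale a y"
    "ell2_scale (a + b) x = ell2_scale a x + ell2_scale b x"
    "ell2_scale a (ell2_scale b x) = ell2_scale (a * b) x" for a b and x y :: "'a list ell2"
    by (transfer; simp add: algebra_simps)+
  have apply_quot: "blinfun_apply (left_quotient i T) x
      = ell2_unshift i (blinfun_apply T x) - ell2_scale (fourier T []) (ell2_unshift i x)" for T x
    by (simp add: left_quotient_def left_unshift_apply blinfun.diff_left op_scale_apply usimps)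
  have quot_scale: "left_quotient i (op_scale c T) = op_scale c (left_quotient i T)" for c T
    by (rule blinfun_eqI) (simp add: apply_quot op_scale_apply fourier_scale usimps vs)
  have quot_add: "left_quotient i (S + T) = left_quotient i S + left_quotient i T" for S T
    by (rule blinfun_eqI) (simp add: apply_quot blinfun.add_left fourier_add usimps vs)
  have quot_mult: "left_quotient i (S o\<^sub>L T) = op_scale (fourier S []) (left_quotient i T) + (left_quotient i S o\<^sub>L T)"
    if "S \<in> ?X" for S T
    by (rule blinfun_eqI)
      (simp add: apply_quot blinfun.add_left op_scale_apply fourier_compose[OF that] usimps vs)
  have "unital_op_algebra ?A"
    unfolding unital_op_algebra_def
  proof (intro conjI ballI allI)
    have "left_quotient i id_blinfun = op_scale 0 (id_blinfun :: 'a list ell2_op)"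
      by (rule blinfun_eqI, rule ell2_eqI)
        (simp add: apply_quot op_scale_apply fourier_id minus_ell2.rep_eq ell2_scale.rep_eq zero_ell2.rep_eq)
    then show "id_blinfun \<in> ?A" using X toeplitz.carr_closed by auto
  next
    fix S T assume ST: "S \<in> ?A" "T \<in> ?A"
    then show "S + T \<in> ?A" using X by (simp add: quot_add)
    show "S o\<^sub>L T \<in> ?A" using X ST by (simp add: quot_mult)
  next
    fix c T assume "T \<in> ?A"
    then show "op_scale c T \<in> ?A" using X by (simp add: quot_scale)
  qed (use X in auto)
  moreover have "closedin weak_operator_topology ?A"
  proof -
    obtain C where C: "closed C" "?X = {T \<in> clinear_ops. op_form T \<in> C}"
      using nc_toeplitz_algebra_props(2) closedin_weak_operator_topology_iff by blast
    define G :: "('a list ell2 \<times> 'a list ell2 \<Rightarrow> complex) \<Rightarrow> 'a list ell2 \<times> 'a list ell2 \<Rightarrow> complex"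
      where "G \<beta> p = \<beta> (fst p, left_shift_fun [i] (snd p))
        - \<beta> (ell2_basis [], ell2_basis []) * ell2_cinner (fst p) (left_shift_fun [i] (snd p))" for \<beta> p
    have cdiff: "ell2_cinner (x - y) z = ell2_cinner x z - ell2_cinner y z" for x y z :: "'a list ell2"
      using cinner_add_left[of "x - y" y z] by simp
    have form: "op_form (left_quotient i T) = G (op_form T)" for T
      by (auto simp: op_form_def G_def apply_quot cdiff cinner_scale_left cinner_unshift cinner_basis fourier_def)
    have lin: "left_quotient i T \<in> clinear_ops" if "T \<in> clinear_ops" for T
      unfolding left_quotient_def using that by (intro clinear_ops_closed left_unshift_clinear)
    have "closed (G -` C)"
      unfolding G_def
      by (intro closed_vimage C(1) continuous_on_coordinatewise_then_product continuous_intros continuous_on_coordinate)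
    then have "closed (C \<inter> G -` C)" by (intro closed_Int C(1))
    moreover have "?A = {T \<in> clinear_ops. op_form T \<in> C \<inter> G -` C}"
      using C(2) lin by (auto simp: form[symmetric])
    ultimately show ?thesis unfolding closedin_weak_operator_topology_iff by blast
  qed
  moreover have "left_shift [j] \<in> ?A" for j
  proof -
    have "left_quotient i (left_shift [j]) = (if i = j then id_blinfun else op_scale 0 id_blinfun)"
      by (rule blinfun_eqI, rule ell2_eqI)
        (auto simp: apply_quot op_scale_apply fourier_left_shift left_shift_apply left_shift_fun.rep_eq
          shift_coeff_def ell2_unshift.rep_eq minus_ell2.rep_eq ell2_scale.rep_eq zero_ell2.rep_eq)
    then show ?thesis using X toeplitz.carr_closed nc_toeplitz_algebra_props(3)[of j] by auto
  qed
  ultimately show ?thesis using nc_toeplitz_algebra_subset assms by blast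
qed

section \<open>Ideals generated by letters are closed in every predual topology\<close>

lemma norm_left_shift_le: "norm (left_shift v) \<le> 1"
  by (rule norm_blinfun_bound) (simp_all add: left_shift_apply norm_left_shift_fun)

lemma norm_left_unshift_le: "norm (left_unshift i) \<le> 1"
  by (rule norm_blinfun_bound) (simp_all add: left_unshift_apply norm_ell2_unshift)

lemma norm_left_shift_compose_le: "norm (left_shift v o\<^sub>L T) \<le> norm T"
  using norm_blinfun_compose[of "left_shift v" T] mult_right_mono[OF norm_left_shift_le[of v] norm_ge_zero[of T]]
  by simp

lemma norm_op_scale_id_le: "norm (op_scale c id_blinfun) \<le> cmod c"
  by (rule norm_blinfun_bound) (simp_all add: op_scale_apply norm_ell2_scale)

lemma norm_left_quotient_le:
  fixes T :: "'a list ell2_op"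
  shows "norm (left_quotient i T) \<le> norm T + cmod (fourier T [])"
proof -
  let ?D = "T - op_scale (fourier T []) id_blinfun"
  have "norm (left_quotient i T) \<le> norm (left_unshift i) * norm ?D"
    unfolding left_quotient_def by (rule norm_blinfun_compose)
  also have "\<dots> \<le> 1 * norm ?D" by (intro mult_right_mono norm_left_unshift_le) simp
  also have "\<dots> \<le> norm T + norm (op_scale (fourier T []) (id_blinfun :: 'a list ell2_op))"
    by (simp add: norm_triangle_ineq4)
  also have "\<dots> \<le> norm T + cmod (fourier T [])" by (intro add_left_mono norm_op_scale_id_le)
  finally show ?thesis .
qed

text \<open>The values of \<open>y\<close> are supported on words that do not start with \<open>j\<close>, hence they are orthogonal
  to the values of the shift, and Pythagoras applies to every vector.\<close>

lemma norm_add_orthogonal_shift: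
  assumes y: "y \<in> nc_toeplitz_algebra" "fourier y [] = 0" "\<And>w. fourier y (j # w) = 0"
  shows "(norm (y + op_scale t (left_shift (j # u))))\<^sup>2 \<le> (norm y)\<^sup>2 + (cmod t)\<^sup>2"
proof -
  let ?K = "sqrt ((norm y)\<^sup>2 + (cmod t)\<^sup>2)"
  have "norm (y + op_scale t (left_shift (j # u))) \<le> ?K"
  proof (rule norm_blinfun_bound)
    fix x
    let ?p = "blinfun_apply y x" and ?q = "ell2_scale t (left_shift_fun (j # u) x)"
    have p0: "ell2_coeff ?p (j # w) = 0" for w
    proof -
      have "fourier y (take k (j # w)) = 0" for k using y(2,3) by (cases k) auto
      then show ?thesis by (simp only: convolution_formula[OF y(1)] mult_zero_left sum.neutral_const)
    qed
    have q0: "ell2_coeff ?q w = 0" if "\<not> (\<exists>v. w = j # v)" for w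
      using that by (auto simp: ell2_scale.rep_eq left_shift_fun.rep_eq shift_coeff_def prefix_def)
    have "ell2_coeff ?p w * cnj (ell2_coeff ?q w) = 0" for w
      using p0 q0[of w] by (cases "\<exists>v. w = j # v") auto
    then have "inner ?p ?q = 0" unfolding inner_ell2_def ell2_cinner_def by (subst infsum_0) auto
    then have "(norm (?p + ?q))\<^sup>2 = (norm ?p)\<^sup>2 + (norm ?q)\<^sup>2"
      by (simp add: power2_norm_eq_inner inner_add_left inner_add_right inner_commute)
    also have "norm ?q = cmod t * norm x" by (simp add: norm_ell2_scale norm_left_shift_fun)
    also have "(norm ?p)\<^sup>2 \<le> (norm y * norm x)\<^sup>2" by (intro power_mono norm_blinfun) simp
    finally have "(norm (?p + ?q))\<^sup>2 \<le> (?K * norm x)\<^sup>2" by (simp add: power_mult_distrib algebra_simps)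
    then have "norm (?p + ?q) \<le> ?K * norm x" by (simp add: power2_le_iff_abs_le)
    then show "norm (blinfun_apply (y + op_scale t (left_shift (j # u))) x) \<le> ?K * norm x"
      by (simp add: blinfun.add_left op_scale_apply left_shift_apply)
  qed simp
  then have "(norm (y + op_scale t (left_shift (j # u))))\<^sup>2 \<le> ?K\<^sup>2" by (intro power_mono) auto
  then show ?thesis by simp
qed

text \<open>On the powers of \<open>j\<close> the operator acts like the analytic Toeplitz operator with the symbol
  \<open>a + b z\<close>, where \<open>a\<close> and \<open>b\<close> are the coefficients at the empty word and at \<open>j\<close>. The sum of the
  basis vectors of the first powers of \<open>j\<close> is an approximate eigenvector of the backward shift, and
  testing against it evaluates the symbol at the point 1.\<close>

lemma fourier_sum_le_norm:
  assumes T: "T \<in> nc_toeplitz_algebra" and zero: "\<And>k. 2 \<le> k \<Longrightarrow> fourier T (replicate k j) = 0"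
  shows "cmod (fourier T [] + fourier T [j]) \<le> norm T"
proof (rule field_le_epsilon)
  fix e :: real assume e: "e > 0"
  \<comment> \<open>The test vector has \<open>n + 1\<close> terms and misses one of the \<open>n + 1\<close> contributions of \<open>fourier T [j]\<close>.\<close>
  obtain n where n: "cmod (fourier T [j]) < real n * e" using reals_Archimedean3[OF e] by blast
  let ?a = "fourier T []" and ?b = "fourier T [j]"
  define F where "F = (\<lambda>m. replicate m j) ` {..n}"
  have inj: "inj_on (\<lambda>m. replicate m j) {..n}" by (rule inj_onI) (metis length_replicate)
  have F: "finite F" "card F = Suc n" by (auto simp: F_def card_image[OF inj])
  define \<eta> where "\<eta> = (\<Sum>w\<in>F. ell2_scale 1 (ell2_basis w))"
  have \<eta>: "ell2_coeff \<eta> u = (if u \<in> F then 1 else 0)" for u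
    unfolding \<eta>_def by (rule ell2_coeff_truncation[OF F(1)])
  have norm_\<eta>: "(norm \<eta>)\<^sup>2 = real (Suc n)" unfolding \<eta>_def norm_truncation_sq[OF F(1)] using F(2) by simp
  have coeff: "ell2_coeff (blinfun_apply T \<eta>) (replicate m j) = ?a + (if m = 0 then 0 else ?b)" if "m \<le> n" for m
  proof -
    have "ell2_coeff (blinfun_apply T \<eta>) (replicate m j) = (\<Sum>k\<le>m. fourier T (replicate k j))"
      unfolding convolution_formula[OF T]
    proof (intro sum.cong)
      fix k assume "k \<in> {..m}"
      then have "take k (replicate m j) = replicate k j" "drop k (replicate m j) = replicate (m - k) j"
        "replicate (m - k) j \<in> F"
        using that by (auto simp: F_def min_def)
      then show "fourier T (take k (replicate m j)) * ell2_coeff \<eta> (drop k (replicate m j)) = fourier T (replicate k j)"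
        by (simp add: \<eta>)
    qed simp
    also have "\<dots> = (\<Sum>k\<in>{..m} \<inter> {..1}. fourier T (replicate k j))"
      by (rule sum.mono_neutral_right) (auto intro: zero)
    also have "\<dots> = ?a + (if m = 0 then 0 else ?b)"
    proof (cases "m = 0")
      case False
      then have "{..m} \<inter> {..1} = {0, 1}" by auto
      then show ?thesis using False by simp
    qed simp
    finally show ?thesis .
  qed
  have "ell2_cinner (blinfun_apply T \<eta>) \<eta> = (\<Sum>\<^sub>\<infinity>w\<in>F. ell2_coeff (blinfun_apply T \<eta>) w)"
    unfolding ell2_cinner_def by (rule infsum_cong_neutral) (auto simp: \<eta>)
  also have "\<dots> = (\<Sum>m\<le>n. ell2_coeff (blinfun_apply T \<eta>) (replicate m j))"
    using F(1) unfolding F_def by (simp add: sum.reindex[OF inj])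
  also have "\<dots> = (\<Sum>m\<le>n. ?a + ?b - (if m = 0 then ?b else 0))"
    by (intro sum.cong refl) (auto simp: coeff)
  also have "\<dots> = of_nat (Suc n) * (?a + ?b) - ?b" by (simp add: sum_subtractf)
  finally have "cmod (of_nat (Suc n) * (?a + ?b) - ?b) = cmod (ell2_cinner (blinfun_apply T \<eta>) \<eta>)" by simp
  also have "\<dots> \<le> norm (blinfun_apply T \<eta>) * norm \<eta>" by (rule cmod_cinner_le)
  also have "\<dots> \<le> (norm T * norm \<eta>) * norm \<eta>" by (intro mult_right_mono norm_blinfun) simp
  also have "\<dots> = norm T * real (Suc n)" using norm_\<eta> by (simp add: power2_eq_square mult.assoc)
  finally have "cmod (of_nat (Suc n) * (?a + ?b)) \<le> norm T * real (Suc n) + cmod ?b"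
    using norm_triangle_ineq2[of "of_nat (Suc n) * (?a + ?b)" ?b] by linarith
  then have "real (Suc n) * cmod (?a + ?b) \<le> norm T * real (Suc n) + cmod ?b"
    by (simp only: norm_mult norm_of_nat)
  also have "\<dots> \<le> real (Suc n) * (norm T + e)" using n e by (simp add: algebra_simps)
  finally show "cmod (?a + ?b) \<le> norm T + e" by (simp only: mult_le_cancel_left_pos of_nat_0_less_iff zero_less_Suc)
qed

lemma zero_if_translates_bounded:
  fixes a :: complex
  assumes "\<And>t. (cmod (a + t))\<^sup>2 \<le> M\<^sup>2 + (cmod t)\<^sup>2"
  shows "a = 0"
proof (rule ccontr)
  assume "a \<noteq> 0"
  then have pos: "0 < (cmod a)\<^sup>2" by simp
  \<comment> \<open>At \<open>t = s a\<close> the quadratic terms in \<open>s\<close> cancel, and a large \<open>s\<close> violates what remains.\<close>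
  define s where "s = M\<^sup>2 / (cmod a)\<^sup>2"
  have "a + complex_of_real s * a = complex_of_real (1 + s) * a" by (simp add: algebra_simps)
  then have "(cmod (a + complex_of_real s * a))\<^sup>2 = (1 + s)\<^sup>2 * (cmod a)\<^sup>2"
    by (simp only: norm_mult norm_of_real power_mult_distrib power2_abs)
  then have "(1 + s)\<^sup>2 * (cmod a)\<^sup>2 \<le> M\<^sup>2 + s\<^sup>2 * (cmod a)\<^sup>2"
    using assms[of "complex_of_real s * a"] by (simp add: norm_mult power_mult_distrib)
  then have "(cmod a)\<^sup>2 + 2 * (s * (cmod a)\<^sup>2) \<le> M\<^sup>2" by (simp add: power2_eq_square algebra_simps)
  moreover have "s * (cmod a)\<^sup>2 = M\<^sup>2" using pos by (simp add: s_def)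
  ultimately show False using pos zero_le_power2[of M] by linarith
qed

text \<open>The right ideal of the elements supported on words that start with a letter in \<open>G\<close>.\<close>

definition letter_ideal :: "'a set \<Rightarrow> 'a list ell2_op set" where
  "letter_ideal G = {T \<in> nc_toeplitz_algebra. fourier T [] = 0 \<and> (\<forall>j w. j \<notin> G \<longrightarrow> fourier T (j # w) = 0)}"

text \<open>Let \<open>x\<close> be in the closure. Balls are closed, so norm estimates for the translates of the members
  of the ideal pass to the translates of \<open>x\<close>. Translation by multiples of \<open>left_shift (j # u)\<close> with \<open>j\<close>
  outside \<open>G\<close> shows that the coefficients of \<open>x\<close> at words starting outside \<open>G\<close> vanish. Given this,
  translation by multiples of \<open>left_shift [j0]\<close> shows that the constant coefficient vanishes.\<close>

lemma closed_letter_ideal_ball: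
  fixes \<theta> :: "'a list ell2_op \<Rightarrow> 'i \<Rightarrow> complex"
  assumes \<theta>: "compact_embedding nc_toeplitz \<theta>" and j0: "j0 \<notin> G" and r: "0 \<le> r"
  shows "closed (\<theta> ` (letter_ideal G \<inter> norm_ball nc_toeplitz r))"
proof -
  interpret compact_embedded "nc_toeplitz :: 'a list ell2_op cnormed" \<theta>
    by (intro compact_embedded.intro normed_carrier.intro complex_normed_space_nc_toeplitz
        compact_embedded_axioms.intro \<theta>)
  let ?S = "letter_ideal G \<inter> norm_ball nc_toeplitz r"
  have cl: "closed (\<theta> ` norm_ball nc_toeplitz s)" if "0 \<le> s" for s
    by (rule compact_imp_closed_fun[OF compact_norm_ball[OF that]])
  have "closure (\<theta> ` ?S) \<subseteq> \<theta> ` ?S"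
  proof
    fix p assume p: "p \<in> closure (\<theta> ` ?S)"
    have "closure (\<theta> ` ?S) \<subseteq> \<theta> ` norm_ball nc_toeplitz r"
      by (rule closure_minimal[OF _ cl[OF r]]) auto
    then obtain x where x: "x \<in> norm_ball nc_toeplitz r" "p = \<theta> x" using p by blast
    then have xX: "x \<in> nc_toeplitz_algebra" by (auto dest: norm_ballD)
    have translate: "norm (x + z) \<le> \<rho>"
      if z: "z \<in> nc_toeplitz_algebra" and \<rho>: "0 \<le> \<rho>" and le: "\<And>y. y \<in> ?S \<Longrightarrow> norm (y + z) \<le> \<rho>" for z \<rho>
    proof -
      have "continuous_on (closure (\<theta> ` ?S)) (\<lambda>q i. q i + \<theta> z i)"
        by (intro continuous_on_coordinatewise_then_product continuous_intros continuous_on_coordinate)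
      moreover have "(\<lambda>q i. q i + \<theta> z i) ` \<theta> ` ?S \<subseteq> \<theta> ` norm_ball nc_toeplitz \<rho>"
      proof (clarsimp simp: image_image)
        fix y assume y: "y \<in> letter_ideal G" "y \<in> norm_ball nc_toeplitz r"
        then have "(\<lambda>i. \<theta> y i + \<theta> z i) = \<theta> (y + z)"
          using emb_add[of y z] z by (simp add: letter_ideal_def fun_eq_iff)
        moreover have "y + z \<in> norm_ball nc_toeplitz \<rho>"
          using le[of y] y z toeplitz.carr_closed(1) by (auto simp: norm_ball_def)
        ultimately show "(\<lambda>i. \<theta> y i + \<theta> z i) \<in> \<theta> ` norm_ball nc_toeplitz \<rho>" by simp
      qed
      ultimately have "(\<lambda>q i. q i + \<theta> z i) ` closure (\<theta> ` ?S) \<subseteq> \<theta> ` norm_ball nc_toeplitz \<rho>"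
        by (intro image_closure_subset cl[OF \<rho>])
      then have "(\<lambda>i. \<theta> x i + \<theta> z i) \<in> \<theta> ` norm_ball nc_toeplitz \<rho>" using p x(2) by auto
      moreover have "(\<lambda>i. \<theta> x i + \<theta> z i) = \<theta> (x + z)"
        using emb_add[of x z] z xX by (simp add: fun_eq_iff)
      ultimately obtain v where v: "v \<in> norm_ball nc_toeplitz \<rho>" "\<theta> (x + z) = \<theta> v" by auto
      then have "x + z = v"
        using inj_onD[OF emb_inj v(2)] toeplitz.carr_closed(1)[OF xX z] by (simp add: norm_ball_def)
      then show ?thesis using v(1) by (simp add: norm_ball_def)
    qed
    have shift_mem: "op_scale t (left_shift u) \<in> nc_toeplitz_algebra" for t :: complex and u :: "'a list"
      by (intro toeplitz.carr_closed left_shift_in_toeplitz)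
    have bound: "(norm (x + op_scale t (left_shift (j # u))))\<^sup>2 \<le> r\<^sup>2 + (cmod t)\<^sup>2" if j: "j \<notin> G" for j u t
    proof -
      have "norm (x + op_scale t (left_shift (j # u))) \<le> sqrt (r\<^sup>2 + (cmod t)\<^sup>2)"
      proof (rule translate[OF shift_mem])
        fix y assume y: "y \<in> ?S"
        have "(norm (y + op_scale t (left_shift (j # u))))\<^sup>2 \<le> (norm y)\<^sup>2 + (cmod t)\<^sup>2"
          using y j by (intro norm_add_orthogonal_shift) (auto simp: letter_ideal_def)
        also have "\<dots> \<le> r\<^sup>2 + (cmod t)\<^sup>2" using y by (simp add: norm_ball_def power_mono)
        finally show "norm (y + op_scale t (left_shift (j # u))) \<le> sqrt (r\<^sup>2 + (cmod t)\<^sup>2)"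
          by (rule real_le_rsqrt)
      qed simp
      then have "(norm (x + op_scale t (left_shift (j # u))))\<^sup>2 \<le> (sqrt (r\<^sup>2 + (cmod t)\<^sup>2))\<^sup>2"
        by (intro power_mono) auto
      then show ?thesis by simp
    qed
    have zero: "fourier x (j # u) = 0" if "j \<notin> G" for j u
    proof (rule zero_if_translates_bounded[where M = r])
      fix t
      have "cmod (fourier x (j # u) + t) \<le> norm (x + op_scale t (left_shift (j # u)))"
        using cmod_fourier_le[of "x + op_scale t (left_shift (j # u))" "j # u"]
        by (simp add: fourier_add fourier_scale fourier_left_shift)
      then have "(cmod (fourier x (j # u) + t))\<^sup>2 \<le> (norm (x + op_scale t (left_shift (j # u))))\<^sup>2"
        by (intro power_mono) auto
      also have "\<dots> \<le> r\<^sup>2 + (cmod t)\<^sup>2" by (rule bound[OF that])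
      finally show "(cmod (fourier x (j # u) + t))\<^sup>2 \<le> r\<^sup>2 + (cmod t)\<^sup>2" .
    qed
    have "fourier x [] = 0"
    proof (rule zero_if_translates_bounded[where M = r])
      fix t
      let ?z = "x + op_scale t (left_shift [j0])"
      have "cmod (fourier ?z [] + fourier ?z [j0]) \<le> norm ?z"
      proof (rule fourier_sum_le_norm)
        show "?z \<in> nc_toeplitz_algebra" by (intro toeplitz.carr_closed(1) xX shift_mem)
        fix k :: nat assume "2 \<le> k"
        then obtain m where "k = Suc (Suc m)" by (metis add_2_eq_Suc le_Suc_ex)
        then show "fourier ?z (replicate k j0) = 0"
          by (simp add: fourier_add fourier_scale fourier_left_shift zero[OF j0])
      qed
      then have "cmod (fourier x [] + t) \<le> norm ?z"
        by (simp add: fourier_add fourier_scale fourier_left_shift zero[OF j0])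
      then have "(cmod (fourier x [] + t))\<^sup>2 \<le> (norm ?z)\<^sup>2" by (intro power_mono) auto
      also have "\<dots> \<le> r\<^sup>2 + (cmod t)\<^sup>2" by (rule bound[OF j0])
      finally show "(cmod (fourier x [] + t))\<^sup>2 \<le> r\<^sup>2 + (cmod t)\<^sup>2" .
    qed
    then have "x \<in> letter_ideal G" using zero xX by (simp add: letter_ideal_def)
    then show "p \<in> \<theta> ` ?S" using x by blast
  qed
  then show ?thesis by (metis closure_closed closure_subset subset_antisym closed_closure)
qed

section \<open>Fourier coefficients are continuous in every predual topology\<close>

text \<open>The component of \<open>T\<close> supported on the words that start with \<open>i\<close>.\<close>

definition letter_part :: "'a \<Rightarrow> 'a list ell2_op \<Rightarrow> 'a list ell2_op" where
  "letter_part i T = left_shift [i] o\<^sub>L left_quotient i T"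

lemma fourier_left_shift_compose:
  "fourier (left_shift [i] o\<^sub>L T) w = (case w of [] \<Rightarrow> 0 | j # v \<Rightarrow> if j = i then fourier T v else 0)"
  by (auto simp: fourier_def left_shift_apply left_shift_fun.rep_eq shift_coeff_def split: list.split)

lemma fourier_letter_part:
  "fourier (letter_part i T) w = (case w of [] \<Rightarrow> 0 | j # v \<Rightarrow> if j = i then fourier T w else 0)"
  by (auto simp: letter_part_def fourier_left_shift_compose fourier_left_quotient split: list.split)

lemma letter_part_in_toeplitz: "T \<in> nc_toeplitz_algebra \<Longrightarrow> letter_part i T \<in> nc_toeplitz_algebra"
  unfolding letter_part_def by (intro toeplitz_compose left_shift_in_toeplitz left_quotient_in_toeplitz)

lemma norm_left_quotient_le2: "norm (left_quotient i T) \<le> 2 * norm T"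
  using norm_left_quotient_le[of i T] cmod_fourier_le[of T "[]"] by simp

lemma norm_letter_part_le: "norm (letter_part i T) \<le> 2 * norm T"
  unfolding letter_part_def
  using norm_left_shift_compose_le[of "[i]" "left_quotient i T"] norm_left_quotient_le2[of i T] by simp

text \<open>The algebra is the direct sum of the scalars, the words starting with \<open>i\<close> and the words
  starting with another letter. On bounded sets all three summands are compact, so the addition
  map has a continuous inverse there.\<close>

lemma letter_decomposition_continuous:
  fixes \<theta> :: "'a list ell2_op \<Rightarrow> 'i \<Rightarrow> complex"
  assumes \<theta>: "compact_embedding nc_toeplitz \<theta>" and ij: "i \<noteq> j" and r: "0 \<le> r"
  shows "factors_through nc_toeplitz \<theta> r (\<lambda>T. fourier T [])"
    and "factors_through nc_toeplitz \<theta> r (\<lambda>T. \<theta> (letter_part i T))"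
proof -
  interpret compact_embedded "nc_toeplitz :: 'a list ell2_op cnormed" \<theta>
    by (intro compact_embedded.intro normed_carrier.intro complex_normed_space_nc_toeplitz
        compact_embedded_axioms.intro \<theta>)
  let ?X = "nc_toeplitz_algebra :: 'a list ell2_op set"
  let ?one = "\<lambda>c. op_scale c id_blinfun :: 'a list ell2_op"
  let ?P = "\<theta> ` (letter_ideal {i} \<inter> norm_ball nc_toeplitz (2 * r))"
  let ?Q = "\<theta> ` (letter_ideal (- {i}) \<inter> norm_ball nc_toeplitz (4 * r))"
  \<comment> \<open>The constant term of an element of norm at most \<open>r\<close> has norm at most \<open>r\<close>, its letter part at most
    \<open>2 r\<close>, and hence the rest at most \<open>4 r\<close>.\<close>
  define K where "K = cball (0 :: complex) r \<times> ?P \<times> ?Q"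
  have cpt: "compact (\<theta> ` (letter_ideal G \<inter> norm_ball nc_toeplitz s))" if "k \<notin> G" "0 \<le> s" for k G s
  proof -
    have "compact (\<theta> ` norm_ball nc_toeplitz s \<inter> \<theta> ` (letter_ideal G \<inter> norm_ball nc_toeplitz s))"
      by (intro compact_Int_closed compact_norm_ball closed_letter_ideal_ball[OF \<theta> that(1)] that(2))
    moreover have "\<theta> ` norm_ball nc_toeplitz s \<inter> \<theta> ` (letter_ideal G \<inter> norm_ball nc_toeplitz s)
        = \<theta> ` (letter_ideal G \<inter> norm_ball nc_toeplitz s)" by blast
    ultimately show ?thesis by (simp only:)
  qed
  have K: "compact K"
    unfolding K_def using r ij by (intro compact_Times compact_cball cpt[of j] cpt[of i]) auto
  define add3 where "add3 z = (\<lambda>l. fst z * \<theta> id_blinfun l + fst (snd z) l + snd (snd z) l)"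
    for z :: "complex \<times> ('i \<Rightarrow> complex) \<times> ('i \<Rightarrow> complex)"
  have contf: "continuous_on K (\<lambda>z. fst (snd z) l)" "continuous_on K (\<lambda>z. snd (snd z) l)" for l
    by (rule continuous_on_product_then_coordinatewise; intro continuous_intros)+
  have add3: "continuous_on K add3"
    unfolding add3_def by (intro continuous_on_coordinatewise_then_product continuous_intros contf)
  define rest where "rest R = R - ?one (fourier R []) - letter_part i R" for R
  define split where "split p = (let R = inv_into ?X \<theta> p in (fourier R [], \<theta> (letter_part i R), \<theta> (rest R)))" for p
  note inv = inv_into_f_f[OF emb_inj, simplified]
  have one: "?one c \<in> ?X" for c by (intro toeplitz.carr_closed id_in_toeplitz)
  have \<theta>add: "\<theta> (?one c + S + T) = add3 (c, \<theta> S, \<theta> T)" if "S \<in> ?X" "T \<in> ?X" for c S T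
  proof -
    have "?one c + S \<in> ?X" by (intro toeplitz.carr_closed(1) one that)
    then show ?thesis
      using that one[of c] id_in_toeplitz[where 'a = 'a]
      by (simp add: emb_add emb_scale[of id_blinfun c, simplified] add3_def fun_eq_iff)
  qed
  have split_add3: "split (add3 z) = z" if zK: "z \<in> K" for z
  proof -
    obtain c S T where z: "z = (c, \<theta> S, \<theta> T)" and S: "S \<in> letter_ideal {i}" and T: "T \<in> letter_ideal (- {i})"
      using zK unfolding K_def by auto
    define R where "R = ?one c + S + T"
    have X: "S \<in> ?X" "T \<in> ?X" "?one c \<in> ?X" using S T one by (auto simp: letter_ideal_def)
    then have RX: "R \<in> ?X" unfolding R_def by (intro toeplitz.carr_closed(1))
    have R: "inv_into ?X \<theta> (add3 z) = R"
      unfolding z \<theta>add[OF X(1,2), symmetric] R_def[symmetric] by (rule inv[OF RX])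
    have c: "fourier R [] = c"
      using S T by (simp add: R_def fourier_add fourier_scale fourier_id letter_ideal_def)
    have part: "letter_part i R = S"
    proof (rule fourier_inject[OF letter_part_in_toeplitz[OF RX] X(1)], rule ext)
      fix w show "fourier (letter_part i R) w = fourier S w"
        using S T by (auto simp: R_def fourier_letter_part fourier_add fourier_scale fourier_id letter_ideal_def
            split: list.split)
    qed
    have "rest R = T" by (simp add: rest_def part c) (simp add: R_def)
    then show ?thesis unfolding split_def R Let_def by (simp add: c part z)
  qed
  have cont: "continuous_on (add3 ` K) split"
    by (rule continuous_on_inv_fun[OF add3 K split_add3])
  have in_K: "\<theta> R = add3 (fourier R [], \<theta> (letter_part i R), \<theta> (rest R))
      \<and> (fourier R [], \<theta> (letter_part i R), \<theta> (rest R)) \<in> K" if R: "R \<in> norm_ball nc_toeplitz r" for R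
  proof
    have RX: "R \<in> ?X" and nR: "norm R \<le> r" using R by (auto simp: norm_ball_def)
    have X: "letter_part i R \<in> ?X" "rest R \<in> ?X"
      unfolding rest_def by (intro toeplitz.carr_closed letter_part_in_toeplitz RX id_in_toeplitz)+
    have "R = ?one (fourier R []) + letter_part i R + rest R" by (simp add: rest_def)
    then show "\<theta> R = add3 (fourier R [], \<theta> (letter_part i R), \<theta> (rest R))" using \<theta>add[OF X] by metis
    have "norm (rest R) \<le> norm R + norm (?one (fourier R [])) + norm (letter_part i R)"
      unfolding rest_def by (meson add_mono norm_triangle_ineq4 order_refl order_trans)
    then have "norm (rest R) \<le> 4 * r"
      using norm_op_scale_id_le[of "fourier R []", where 'a = "'a list"] cmod_fourier_le[of R "[]"] norm_letter_part_le[of i R] nR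
      by (smt (verit))
    moreover have "rest R \<in> letter_ideal (- {i})"
      using X by (auto simp: letter_ideal_def rest_def fourier_diff fourier_scale fourier_id fourier_letter_part)
    moreover have "letter_part i R \<in> letter_ideal {i}"
      using X by (auto simp: letter_ideal_def fourier_letter_part)
    moreover have "norm (letter_part i R) \<le> 2 * r" using norm_letter_part_le[of i R] nR by simp
    moreover have "cmod (fourier R []) \<le> r" using cmod_fourier_le[of R "[]"] nR by simp
    ultimately show "(fourier R [], \<theta> (letter_part i R), \<theta> (rest R)) \<in> K"
      using X by (auto simp: K_def norm_ball_def)
  qed
  have sub: "\<theta> ` norm_ball nc_toeplitz r \<subseteq> add3 ` K" using in_K by blast
  note cont' = continuous_on_subset[OF cont sub]
  have val: "split (\<theta> R) = (fourier R [], \<theta> (letter_part i R), \<theta> (rest R))"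
    if "R \<in> norm_ball nc_toeplitz r" for R
    using in_K[OF that] split_add3 by metis
  show "factors_through nc_toeplitz \<theta> r (\<lambda>T. fourier T [])"
    by (rule factors_throughI[OF continuous_on_fst[OF cont']]) (simp add: val)
  show "factors_through nc_toeplitz \<theta> r (\<lambda>T. \<theta> (letter_part i T))"
    by (rule factors_throughI[OF continuous_on_fst[OF continuous_on_snd[OF cont']]]) (simp add: val)
qed

text \<open>Multiplication by the generator is isometric and maps the unit ball onto the unit ball of the
  letter ideal, which is closed; hence its image is compact.\<close>

lemma compact_embedding_shift:
  fixes \<theta> :: "'a list ell2_op \<Rightarrow> 'i \<Rightarrow> complex"
  assumes \<theta>: "compact_embedding nc_toeplitz \<theta>" and ij: "i \<noteq> j"
  shows "compact_embedding nc_toeplitz (\<lambda>T. \<theta> (left_shift [i] o\<^sub>L T))"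
proof -
  interpret compact_embedded "nc_toeplitz :: 'a list ell2_op cnormed" \<theta>
    by (intro compact_embedded.intro normed_carrier.intro complex_normed_space_nc_toeplitz
        compact_embedded_axioms.intro \<theta>)
  have mem: "left_shift [i] o\<^sub>L T \<in> nc_toeplitz_algebra" if "T \<in> nc_toeplitz_algebra" for T
    by (intro toeplitz_compose left_shift_in_toeplitz that)
  have inj: "S = T" if "S \<in> nc_toeplitz_algebra" "T \<in> nc_toeplitz_algebra"
    "left_shift [i] o\<^sub>L S = left_shift [i] o\<^sub>L T" for S T
  proof (rule fourier_inject[OF that(1,2)], rule ext)
    fix w show "fourier S w = fourier T w"
      using arg_cong[OF that(3), of "\<lambda>R. fourier R (i # w)"] by (simp add: fourier_left_shift_compose)
  qed
  have "(\<lambda>T. \<theta> (left_shift [i] o\<^sub>L T)) ` norm_ball nc_toeplitz 1 =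
      \<theta> ` (letter_ideal {i} \<inter> norm_ball nc_toeplitz 1)"
  proof (intro equalityI subsetI)
    fix p assume "p \<in> (\<lambda>T. \<theta> (left_shift [i] o\<^sub>L T)) ` norm_ball nc_toeplitz 1"
    then obtain T where T: "T \<in> norm_ball nc_toeplitz 1" "p = \<theta> (left_shift [i] o\<^sub>L T)" by blast
    have "left_shift [i] o\<^sub>L T \<in> letter_ideal {i} \<inter> norm_ball nc_toeplitz 1"
      using T(1) mem norm_left_shift_compose_le[of "[i]" T]
      by (auto simp: letter_ideal_def norm_ball_def fourier_left_shift_compose)
    then show "p \<in> \<theta> ` (letter_ideal {i} \<inter> norm_ball nc_toeplitz 1)" using T(2) by blast
  next
    fix p assume "p \<in> \<theta> ` (letter_ideal {i} \<inter> norm_ball nc_toeplitz 1)"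
    then obtain S where S: "S \<in> letter_ideal {i}" "S \<in> norm_ball nc_toeplitz 1" "p = \<theta> S" by blast
    have SX: "S \<in> nc_toeplitz_algebra" using S by (simp add: norm_ball_def)
    have "letter_part i S = S"
    proof (rule fourier_inject[OF letter_part_in_toeplitz[OF SX] SX], rule ext)
      fix w show "fourier (letter_part i S) w = fourier S w"
        using S(1) by (auto simp: fourier_letter_part letter_ideal_def split: list.split)
    qed
    moreover have "left_quotient i S \<in> norm_ball nc_toeplitz 1"
      using S left_quotient_in_toeplitz[OF SX, of i] norm_left_quotient_le[of i S]
      by (simp add: norm_ball_def letter_ideal_def)
    ultimately show "p \<in> (\<lambda>T. \<theta> (left_shift [i] o\<^sub>L T)) ` norm_ball nc_toeplitz 1"
      using S(3) unfolding letter_part_def by (metis image_eqI)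
  qed
  moreover have "compact (\<theta> ` norm_ball nc_toeplitz 1 \<inter> \<theta> ` (letter_ideal {i} \<inter> norm_ball nc_toeplitz 1))"
    using ij by (intro compact_Int_closed compact_unit_ball closed_letter_ideal_ball[OF \<theta>, of j]) auto
  moreover have "\<theta> ` norm_ball nc_toeplitz 1 \<inter> \<theta> ` (letter_ideal {i} \<inter> norm_ball nc_toeplitz 1)
      = \<theta> ` (letter_ideal {i} \<inter> norm_ball nc_toeplitz 1)" by blast
  ultimately have cpt: "compact ((\<lambda>T. \<theta> (left_shift [i] o\<^sub>L T)) ` norm_ball nc_toeplitz 1)" by (simp only:)
  show ?thesis
    unfolding compact_embedding_def
  proof (intro conjI ballI allI cpt)
    fix S T :: "'a list ell2_op" assume ST: "S \<in> carr nc_toeplitz" "T \<in> carr nc_toeplitz"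
    have "left_shift [i] o\<^sub>L (S + T) = (left_shift [i] o\<^sub>L S) + (left_shift [i] o\<^sub>L T)"
      by (rule blinfun_eqI) (simp add: blinfun.add_left blinfun.add_right)
    then show "\<theta> (left_shift [i] o\<^sub>L (S + T)) = \<theta> (left_shift [i] o\<^sub>L S) + \<theta> (left_shift [i] o\<^sub>L T)"
      using ST mem by (simp add: emb_add)
  next
    fix c l and T :: "'a list ell2_op" assume T: "T \<in> carr nc_toeplitz"
    have "left_shift [i] o\<^sub>L op_scale c T = op_scale c (left_shift [i] o\<^sub>L T)"
      using left_shift_clinear[of "[i]"] by (intro blinfun_eqI) (simp add: op_scale_apply clinear_ops_def)
    then show "\<theta> (left_shift [i] o\<^sub>L scl nc_toeplitz c T) l = c * \<theta> (left_shift [i] o\<^sub>L T) l"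
      using T mem emb_scale[of "left_shift [i] o\<^sub>L T" c l] by simp
  next
    show "inj_on (\<lambda>T. \<theta> (left_shift [i] o\<^sub>L T)) (carr nc_toeplitz)"
      using inj mem inj_onD[OF emb_inj] by (auto intro!: inj_onI)
  qed
qed

text \<open>Induction on the word, for all compact embeddings at once: multiplication by a generator
  transports an embedding \<open>\<theta>\<close> to another one, for which the remaining word is shorter.\<close>

theorem fourier_factors_through:
  fixes \<theta> :: "'a list ell2_op \<Rightarrow> 'i \<Rightarrow> complex"
  assumes other: "\<And>i :: 'a. \<exists>j. i \<noteq> j"
    and "compact_embedding nc_toeplitz \<theta>" "0 \<le> r"
  shows "factors_through nc_toeplitz \<theta> r (\<lambda>T. fourier T w)"
  using assms(2,3)
proof (induction w arbitrary: \<theta> r)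
  case Nil
  then show ?case using letter_decomposition_continuous(1) other by metis
next
  case (Cons i w)
  obtain j where ij: "i \<noteq> j" using other by blast
  let ?\<theta>' = "\<lambda>T. \<theta> (left_shift [i] o\<^sub>L T)"
  have "factors_through nc_toeplitz ?\<theta>' (2 * r) (\<lambda>T. fourier T w)"
    using Cons.prems by (intro Cons.IH compact_embedding_shift[OF _ ij]) auto
  then obtain g where g: "continuous_on (?\<theta>' ` norm_ball nc_toeplitz (2 * r)) g"
    "\<And>S. S \<in> norm_ball nc_toeplitz (2 * r) \<Longrightarrow> fourier S w = g (?\<theta>' S)"
    by (rule factors_throughE) (rule that)
  have "factors_through nc_toeplitz \<theta> r (\<lambda>T. \<theta> (letter_part i T))"
    by (rule letter_decomposition_continuous(2)[OF Cons.prems(1) ij Cons.prems(2)])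
  then obtain h where h: "continuous_on (\<theta> ` norm_ball nc_toeplitz r) h"
    "\<And>T. T \<in> norm_ball nc_toeplitz r \<Longrightarrow> \<theta> (letter_part i T) = h (\<theta> T)"
    by (rule factors_throughE) (rule that)
  have quot: "left_quotient i T \<in> norm_ball nc_toeplitz (2 * r)" if "T \<in> norm_ball nc_toeplitz r" for T
    using that left_quotient_in_toeplitz[of T i] norm_left_quotient_le2[of i T] by (simp add: norm_ball_def)
  have h': "h (\<theta> T) = ?\<theta>' (left_quotient i T)" if "T \<in> norm_ball nc_toeplitz r" for T
    using h(2)[OF that] by (simp add: letter_part_def)
  show ?case
  proof (rule factors_throughI)
    show "continuous_on (\<theta> ` norm_ball nc_toeplitz r) (\<lambda>p. g (h p))"
      by (rule continuous_on_compose2[OF g(1) h(1)]) (auto simp: h' intro!: imageI quot)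
    show "fourier T (i # w) = g (h (\<theta> T))" if "T \<in> norm_ball nc_toeplitz r" for T
      using g(2)[OF quot[OF that]] by (simp add: h'[OF that] fourier_left_quotient)
  qed
qed

section \<open>The unique predual\<close>

theorem theorem3p3:
  assumes "countable (UNIV :: 'a set)"
    and "infinite (UNIV :: 'a set) \<or> CARD('a) \<ge> 2"
  shows "(\<exists>E :: ('a list ell2_op \<Rightarrow> complex) cnormed.
            is_predual E (nc_toeplitz :: 'a list ell2_op cnormed)) \<and>
         (\<forall>(E :: 'e::ab_group_add cnormed) (F :: 'f::ab_group_add cnormed).
            is_predual E (nc_toeplitz :: 'a list ell2_op cnormed) \<longrightarrow>
            is_predual F (nc_toeplitz :: 'a list ell2_op cnormed) \<longrightarrow>
            isometrically_isomorphic E F)"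
proof -
  have other: "\<exists>j. i \<noteq> j" for i :: 'a
  proof (rule ccontr)
    assume "\<nexists>j. i \<noteq> j"
    then have "(UNIV :: 'a set) = {i}" by auto
    then have "finite (UNIV :: 'a set)" "card (UNIV :: 'a set) = card {i}"
      by (metis finite.emptyI finite.insertI, simp only:)
    then show False using assms(2) by simp
  qed
  interpret compact_embedded "nc_toeplitz :: 'a list ell2_op cnormed" fourier
    by (intro compact_embedded.intro normed_carrier.intro complex_normed_space_nc_toeplitz
        compact_embedded_axioms.intro compact_embedding_fourier)
  show ?thesis
  proof (intro conjI allI impI)
    show "\<exists>E :: ('a list ell2_op \<Rightarrow> complex) cnormed. is_predual E (nc_toeplitz :: 'a list ell2_op cnormed)"
      using Dixmier_Ng by blast
    fix E :: "'e cnormed" and F :: "'f cnormed"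
    assume E: "is_predual E (nc_toeplitz :: 'a list ell2_op cnormed)"
      and F: "is_predual F (nc_toeplitz :: 'a list ell2_op cnormed)"
    have "isometrically_isomorphic E E0"
      by (rule predual_isomorphic_embedding_predual[OF E fourier_factors_through[OF other _ zero_le_one]])
    moreover have "isometrically_isomorphic F E0"
      by (rule predual_isomorphic_embedding_predual[OF F fourier_factors_through[OF other _ zero_le_one]])
    then have "isometrically_isomorphic E0 F"
      by (rule isometrically_isomorphic_sym[rotated])
        (rule F[unfolded is_predual_def complex_banach_space_def, THEN conjunct1, THEN conjunct1])
    ultimately show "isometrically_isomorphic E F" by (rule isometrically_isomorphic_trans)
  qed
qed

end
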